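(* Let $\Delta>0$ and let $G=(X,E,\omega)$ be an undirected graph with positive edge weights, $n$ vertices and $m$ edges, given in adjacency-list representation, and let $\rho$ be the shortest-path metric of $G$. Then one can sample a $\Delta$-bounded CKR partition of $(X,\rho)$ in expected time $O(m\log n+n\log^2 n)$.
   Context: Model of computation: unit-cost real-word RAM (words hold reals; arithmetic, comparison and truncation take unit time). For a finite metric space $(X,\rho)$ and $\Delta>0$, a $\Delta$-bounded CKR partition is the random partition of $X$ produced as follows: choose a uniformly random ordering $x_{\pi(1)},\dots,x_{\pi(|X|)}$ of $X$ and, independently, a number $R$ uniformly at random in $[\Delta/4,\Delta/2]$; for $i=1,\dots,|X|$ let $C_i=\{y\in X:\rho(y,x_{\pi(i)})\le R\}\setminus\bigcup_{j<i}C_j$; output $\{C_1,\dots,C_{|X|}\}\setminus\{\emptyset\}$. "Sampling" means outputting a partition distributed exactly according to this distribution. *)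

theory Defs
  imports
    "HOL-Probability.Probability"
    "HOL-Combinatorics.Multiset_Permutations"
    "Graph_Theory.Graph_Theory"
begin

section \<open>Weighted undirected graphs on the vertex set \<open>{..<n}\<close>\<close>

definition weighted_graph :: "nat \<Rightarrow> nat set set \<Rightarrow> (nat set \<Rightarrow> real) \<Rightarrow> bool" where
  "weighted_graph n E \<omega> \<longleftrightarrow>
     E \<subseteq> {e. e \<subseteq> {..<n} \<and> card e = 2} \<and> (\<forall>e\<in>E. 0 < \<omega> e)"

definition symmetric_digraph :: "nat \<Rightarrow> nat set set \<Rightarrow> nat pair_pre_digraph" where
  "symmetric_digraph n E = \<lparr> pverts = {..<n}, parcs = {(u, v). {u, v} \<in> E} \<rparr>"

lemma pair_graph_symmetric_digraph:
  assumes "weighted_graph n E \<omega>"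
  shows "pair_graph (symmetric_digraph n E)"
proof -
  have *: "u < n \<and> v < n \<and> u \<noteq> v" if "{u, v} \<in> E" for u v
    using that assms by (force simp: weighted_graph_def card_2_iff doubleton_eq_iff)
  have "{(u, v). {u, v} \<in> E} \<subseteq> {..<n} \<times> {..<n}"
    using * by auto
  then have "finite {(u, v). {u, v} \<in> E}"
    by (rule finite_subset) simp
  then show ?thesis
    by unfold_locales
      (auto simp: symmetric_digraph_def symmetric_def sym_def insert_commute dest: *)
qed

text \<open>The infimum of the weights of all walks from \<open>u\<close> to \<open>v\<close>. It is extended-real valued:
  vertices in different components have distance \<open>\<infinity>\<close>.\<close>

definition shortest_path_metric ::
    "nat \<Rightarrow> nat set set \<Rightarrow> (nat set \<Rightarrow> real) \<Rightarrow> nat \<Rightarrow> nat \<Rightarrow> ereal" where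
  "shortest_path_metric n E \<omega> =
     wf_digraph.\<mu> (with_proj (symmetric_digraph n E)) (\<lambda>(u, v). \<omega> {u, v})"

text \<open>The list at index \<open>v\<close> holds the neighbours of \<open>v\<close>, each exactly once and in arbitrary order,
  together with the weights of the connecting edges.\<close>

definition adjacency_lists ::
    "nat \<Rightarrow> nat set set \<Rightarrow> (nat set \<Rightarrow> real) \<Rightarrow> (nat \<times> real) list list \<Rightarrow> bool" where
  "adjacency_lists n E \<omega> adj \<longleftrightarrow>
     length adj = n \<and>
     (\<forall>v<n. distinct (adj ! v) \<and> set (adj ! v) = {(u, \<omega> {u, v}) | u. {u, v} \<in> E})"


section \<open>CKR partitions\<close>

fun ckr_cluster ::
    "'a set \<Rightarrow> ('a \<Rightarrow> 'a \<Rightarrow> ereal) \<Rightarrow> real \<Rightarrow> 'a list \<Rightarrow> nat \<Rightarrow> 'a set" where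
  "ckr_cluster X \<rho> R xs i =
     {y \<in> X. \<rho> y (xs ! i) \<le> ereal R} - (\<Union>j\<in>{..<i}. ckr_cluster X \<rho> R xs j)"

declare ckr_cluster.simps [simp del]

definition ckr_clusters ::
    "'a set \<Rightarrow> ('a \<Rightarrow> 'a \<Rightarrow> ereal) \<Rightarrow> real \<Rightarrow> 'a list \<Rightarrow> 'a set set" where
  "ckr_clusters X \<rho> R xs = ckr_cluster X \<rho> R xs ` {..<length xs} - {{}}"

definition ckr_partition ::
    "real \<Rightarrow> 'a set \<Rightarrow> ('a \<Rightarrow> 'a \<Rightarrow> ereal) \<Rightarrow> 'a set set measure" where
  "ckr_partition \<Delta> X \<rho> =
     distr (uniform_count_measure (permutations_of_set X) \<Otimes>\<^sub>M
              uniform_measure lborel {\<Delta> / 4 .. \<Delta> / 2})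
       (count_space UNIV) (\<lambda>(xs, R). ckr_clusters X \<rho> R xs)"

text \<open>For finite \<open>X\<close> the map above is measurable, so \<open>ckr_partition\<close> is a genuine
  probability distribution.\<close>

lemma measurable_ckr_clusters:
  assumes "finite X"
  shows "(\<lambda>(xs, R). ckr_clusters X \<rho> R xs) \<in>
           count_space (permutations_of_set X) \<Otimes>\<^sub>M borel \<rightarrow>\<^sub>M count_space UNIV"
proof (rule measurable_pair_measure_countable1)
  fix xs assume "xs \<in> permutations_of_set X"
  then have xs: "set xs = X"
    by (simp add: permutations_of_set_def)
  define S where "S R = {p \<in> X \<times> X. \<rho> (fst p) (snd p) \<le> ereal R}" for R
  define g where "g T = ckr_clusters X (\<lambda>x y. if (x, y) \<in> T then -\<infinity> else \<infinity>) 0 xs" for T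
  have cl: "ckr_cluster X \<rho> R xs i =
      ckr_cluster X (\<lambda>x y. if (x, y) \<in> S R then -\<infinity> else \<infinity>) 0 xs i"
    if "i < length xs" for R i
    using that
  proof (induction i rule: less_induct)
    case (less i)
    then have "xs ! i \<in> X"
      using xs by auto
    with less show ?case
      by (subst (1 2) ckr_cluster.simps) (auto simp: S_def)
  qed
  have eq: "ckr_clusters X \<rho> R xs = g (S R)" for R
    unfolding g_def ckr_clusters_def
    by (intro arg_cong[where f = "\<lambda>A. A - {{}}"] image_cong refl cl) simp
  have "S \<in> borel \<rightarrow>\<^sub>M count_space (Pow (X \<times> X))"
  proof (subst measurable_count_space_eq_countable)
    show "countable (Pow (X \<times> X))"
      using assms by (simp add: countable_finite)
    have "S -` {T} \<in> sets borel" if "T \<subseteq> X \<times> X" for T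
    proof -
      have fin: "finite (X \<times> X)" using assms by simp
      have "S -` {T} = {R. \<forall>p\<in>X \<times> X. (\<rho> (fst p) (snd p) \<le> ereal R) = (p \<in> T)}"
        using that unfolding S_def vimage_def by blast
      also have "\<dots> \<in> sets borel"
        using fin by measurable
      finally show ?thesis .
    qed
    then show "S \<in> space borel \<rightarrow> Pow (X \<times> X) \<and>
        (\<forall>T\<in>Pow (X \<times> X). S -` {T} \<inter> space borel \<in> sets borel)"
      by (auto simp: S_def)
  qed
  then have "(\<lambda>R. g (S R)) \<in> borel \<rightarrow>\<^sub>M count_space UNIV"
    by (rule measurable_compose) simp
  then show "(\<lambda>R. case (xs, R) of (xs, R) \<Rightarrow> ckr_clusters X \<rho> R xs) \<in> borel \<rightarrow>\<^sub>M count_space UNIV"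
    by (simp add: eq)
qed (use assms in \<open>simp add: countable_finite\<close>)

lemma prob_space_ckr_partition:
  assumes "finite X" "0 < \<Delta>"
  shows "prob_space (ckr_partition \<Delta> X \<rho>)"
proof -
  let ?A = "uniform_count_measure (permutations_of_set X)"
  let ?B = "uniform_measure lborel {\<Delta> / 4 .. \<Delta> / 2}"
  have "prob_space ?A"
    using assms by (intro prob_space_uniform_count_measure) auto
  moreover have "prob_space ?B"
    using assms by (intro prob_space_uniform_measure) auto
  ultimately interpret pair_prob_space ?A ?B
    by (simp add: pair_prob_space_def pair_sigma_finite_def prob_space_imp_sigma_finite)
  have "sets (?A \<Otimes>\<^sub>M ?B) = sets (count_space (permutations_of_set X) \<Otimes>\<^sub>M borel)"
    by (intro sets_pair_measure_cong) (simp_all add: sets_uniform_count_measure)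
  then have "(\<lambda>(xs, R). ckr_clusters X \<rho> R xs) \<in> ?A \<Otimes>\<^sub>M ?B \<rightarrow>\<^sub>M count_space UNIV"
    using measurable_ckr_clusters[OF assms(1)] by (simp cong: measurable_cong_sets)
  then show ?thesis
    unfolding ckr_partition_def by (rule P.prob_space_distr)
qed


section \<open>A unit-cost real RAM with a source of random reals\<close>

text \<open>A program has finitely many directly addressed registers and an unbounded memory that is
  addressed through registers; every word holds a real. \<open>Rand\<close> draws a fresh number
  uniformly from \<open>[0, 1]\<close>. Programs contain only integer constants, so that a program cannot
  carry advice hidden in a real. The last argument of \<open>Jump_le\<close> is the target.\<close>

datatype instr =
    Const nat int
  | Add nat nat nat
  | Sub nat nat nat
  | Mul nat nat nat
  | Div nat nat nat
  | Trunc nat nat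
  | Load nat nat
  | Store nat nat
  | Rand nat
  | Jump_le nat nat nat

record config =
  pc :: nat
  reg :: "nat \<Rightarrow> real"
  mem :: "nat \<Rightarrow> real"
  drawn :: nat

definition address :: "real \<Rightarrow> nat" where
  "address x = nat \<lfloor>x\<rfloor>"

definition set_reg :: "nat \<Rightarrow> real \<Rightarrow> config \<Rightarrow> config" where
  "set_reg i x c = c\<lparr>pc := Suc (pc c), reg := (reg c)(i := x)\<rparr>"

text \<open>The random tape \<open>t\<close> supplies the results of the \<open>Rand\<close> instructions in the order of their
  execution.\<close>

fun exec :: "(nat \<Rightarrow> real) \<Rightarrow> instr \<Rightarrow> config \<Rightarrow> config" where
  "exec t (Const i k) c = set_reg i (of_int k) c"
| "exec t (Add i j k) c = set_reg i (reg c j + reg c k) c"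
| "exec t (Sub i j k) c = set_reg i (reg c j - reg c k) c"
| "exec t (Mul i j k) c = set_reg i (reg c j * reg c k) c"
| "exec t (Div i j k) c = set_reg i (reg c j / reg c k) c"
| "exec t (Trunc i j) c = set_reg i (of_int \<lfloor>reg c j\<rfloor>) c"
| "exec t (Load i j) c = set_reg i (mem c (address (reg c j))) c"
| "exec t (Store i j) c = c\<lparr>pc := Suc (pc c), mem := (mem c)(address (reg c i) := reg c j)\<rparr>"
| "exec t (Rand i) c = (set_reg i (t (drawn c)) c)\<lparr>drawn := Suc (drawn c)\<rparr>"
| "exec t (Jump_le i j l) c = c\<lparr>pc := (if reg c i \<le> reg c j then l else Suc (pc c))\<rparr>"

text \<open>The machine halts when the program counter leaves the program.\<close>

definition halted :: "instr list \<Rightarrow> config \<Rightarrow> bool" where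
  "halted P c \<longleftrightarrow> length P \<le> pc c"

definition step :: "instr list \<Rightarrow> (nat \<Rightarrow> real) \<Rightarrow> config \<Rightarrow> config" where
  "step P t c = (if halted P c then c else exec t (P ! pc c) c)"

definition initial :: "real list \<Rightarrow> config" where
  "initial inp =
     \<lparr>pc = 0, reg = (\<lambda>_. 0), mem = (\<lambda>a. if a < length inp then inp ! a else 0), drawn = 0\<rparr>"

definition run :: "instr list \<Rightarrow> real list \<Rightarrow> (nat \<Rightarrow> real) \<Rightarrow> nat \<Rightarrow> config" where
  "run P inp t k = (step P t ^^ k) (initial inp)"

text \<open>The number of executed instructions; it is \<open>\<infinity>\<close> if the program does not halt.\<close>

definition running_time :: "instr list \<Rightarrow> real list \<Rightarrow> (nat \<Rightarrow> real) \<Rightarrow> ennreal" where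
  "running_time P inp t = (INF k\<in>{k. halted P (run P inp t k)}. of_nat k)"

definition final_memory :: "instr list \<Rightarrow> real list \<Rightarrow> (nat \<Rightarrow> real) \<Rightarrow> (nat \<Rightarrow> real) option" where
  "final_memory P inp t =
     (if \<exists>k. halted P (run P inp t k)
      then Some (mem (run P inp t (LEAST k. halted P (run P inp t k))))
      else None)"

definition random_tape :: "(nat \<Rightarrow> real) measure" where
  "random_tape = (\<Pi>\<^sub>M i\<in>UNIV. uniform_measure lborel {0..1})"

text \<open>The output of \<open>P\<close>, decoded from the final memory by \<open>dec\<close>, has distribution exactly \<open>D\<close>.
  As the outcome \<open>None\<close> gets probability zero, \<open>P\<close> halts almost surely.\<close>

definition samples :: "instr list \<Rightarrow> real list \<Rightarrow> ((nat \<Rightarrow> real) \<Rightarrow> 'b) \<Rightarrow> 'b measure \<Rightarrow> bool" where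
  "samples P inp dec D \<longleftrightarrow>
     (\<lambda>t. map_option dec (final_memory P inp t)) \<in> random_tape \<rightarrow>\<^sub>M count_space UNIV \<and>
     distr random_tape (count_space UNIV) (\<lambda>t. map_option dec (final_memory P inp t)) =
       distr D (count_space UNIV) Some"

text \<open>The measurability requirement is there because \<open>nn_integral\<close> is only a lower integral
  for non-measurable functions.\<close>

definition expected_time_le :: "instr list \<Rightarrow> real list \<Rightarrow> real \<Rightarrow> bool" where
  "expected_time_le P inp B \<longleftrightarrow>
     running_time P inp \<in> borel_measurable random_tape \<and>
     (\<integral>\<^sup>+ t. running_time P inp t \<partial>random_tape) \<le> ennreal B"


section \<open>Input and output conventions\<close>

text \<open>The input consists of the diameter bound, the number \<open>n\<close> of vertices, \<open>n + 1\<close> pointers, and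
  the concatenated adjacency lists with two words per entry. The list of vertex \<open>v\<close> occupies the
  addresses from the \<open>v\<close>-th pointer (inclusive) to the next pointer (exclusive).\<close>

definition encode_input :: "real \<Rightarrow> (nat \<times> real) list list \<Rightarrow> real list" where
  "encode_input \<Delta> adj =
     [\<Delta>, real (length adj)] @
     map (\<lambda>v. real (length adj + 3 + 2 * (\<Sum>u<v. length (adj ! u)))) [0..<length adj + 1] @
     concat (map (\<lambda>(u, x). [real u, x]) (concat adj))"

text \<open>On output, the first \<open>n\<close> memory cells label the vertices with their clusters.\<close>

definition decode_partition :: "nat \<Rightarrow> (nat \<Rightarrow> real) \<Rightarrow> nat set set" where
  "decode_partition n l = (\<lambda>v. {u \<in> {..<n}. l u = l v}) ` {..<n}"

end

theory Submission
  imports Defs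
begin

text \<open>
  The permutation comes from an inside-out Fisher-Yates shuffle, the radius from one further random
  number. All weights are rounded up to integer multiples of a small unit, and the program runs
  Dijkstra's algorithm from the centers in the order of the permutation. A run is pruned at every
  vertex that an earlier center reaches at most as far. A vertex is thus visited once for every strict
  prefix minimum of its distances along the permutation, and there are at most \<open>H\<^sub>n\<close> of these in
  expectation.

  Rounding can affect the result only if some rounded distance lies just above the radius. Whenever
  such a distance is met, the computation is repeated with half the unit; since the radius is
  continuous, the expected number of repetitions is bounded, and this event is independent of the
  permutation.

  Rounding also makes the priority queue trivial. A vertex \<open>v\<close> at integer distance \<open>d\<close> has the key
  \<open>k = n * d + v\<close>, and the queue is the single real number \<open>\<Sum> 2\<^sup>-\<^sup>k\<close> over the queued vertices.
  Insertion and decrease-key are an addition and a subtraction, and the minimum is found by binary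
  search for the leading power of two, which takes logarithmic time.
\<close>

section \<open>A structured language and its compiler\<close>

text \<open>The output law must be exact although only rounded distances are computed. What helps is
  the one-sided error: with s units per length, a rounded distance d satisfies s * \<rho> <= d <= s
  * \<rho> + n, as a shortest path has at most n edges. So only d in (S, S + n], with S the radius
  in units, leaves the side of the radius open. For the unit \<Delta> / (4 * N), S is uniform on an
  interval of length N, so the n^2 pairs of vertices spoil a trial with probability at most n^3 / N.
  This is why N starts from (n + 1)^3 and doubles. The exponent J of trial k is O(k + log n), and
  the sum of (k + 1) / 2^k converges.

  The time bound hinges on where a factor J is paid. About m * H_n relaxations are expected, so one
  must cost O(1): a stored factor per edge turns the power of one end point's key into that of the
  other by a single multiplication. Binary search is paid once per edge in each trial, to compute
  this factor, which gives m log n; and once per extracted minimum, of which n * H_n are expected,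
  which gives n log^2 n.\<close>

datatype aop = Plus | Minus | Times | Over

datatype expr =
    V nat
  | Num int
  | Op aop expr expr
  | Flr expr
  | Arr nat expr
  | Low expr

datatype com =
    Skip
  | Assign nat expr
  | StoreA nat expr expr
  | StoreL expr expr
  | Sample nat
  | Seq com com
  | If expr expr com com
  | While expr expr com

text \<open>\<open>lo\<close> is the part of the memory below \<open>bnd\<close>, which initially holds the input, and \<open>tm\<close> counts
  the machine instructions executed so far.\<close>

record state =
  vr :: "nat \<Rightarrow> real"
  ar :: "nat \<Rightarrow> nat \<Rightarrow> real"
  lo :: "nat \<Rightarrow> real"
  bnd :: nat
  dr :: nat
  tm :: nat

fun opval :: "aop \<Rightarrow> real \<Rightarrow> real \<Rightarrow> real" where
  "opval Plus x y = x + y"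
| "opval Minus x y = x - y"
| "opval Times x y = x * y"
| "opval Over x y = x / y"

fun opinstr :: "aop \<Rightarrow> nat \<Rightarrow> nat \<Rightarrow> nat \<Rightarrow> instr" where
  "opinstr Plus = Add"
| "opinstr Minus = Sub"
| "opinstr Times = Mul"
| "opinstr Over = Div"

fun eval :: "expr \<Rightarrow> state \<Rightarrow> real" where
  "eval (V x) s = vr s x"
| "eval (Num k) s = of_int k"
| "eval (Op f a b) s = opval f (eval a s) (eval b s)"
| "eval (Flr a) s = of_int \<lfloor>eval a s\<rfloor>"
| "eval (Arr k a) s = ar s (k mod 8) (nat \<lfloor>eval a s\<rfloor>)"
| "eval (Low a) s = lo s (nat \<lfloor>eval a s\<rfloor>)"

text \<open>Keeps the two memory regions apart: a negative index could move an array cell into the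
  input area, and \<open>Low\<close> must stay below \<open>bnd\<close>, where the arrays
  begin.\<close>

fun defd :: "expr \<Rightarrow> state \<Rightarrow> bool" where
  "defd (V x) s = True"
| "defd (Num k) s = True"
| "defd (Op f a b) s = (defd a s \<and> defd b s)"
| "defd (Flr a) s = defd a s"
| "defd (Arr k a) s = (defd a s \<and> 0 \<le> eval a s)"
| "defd (Low a) s = (defd a s \<and> nat \<lfloor>eval a s\<rfloor> < bnd s)"

text \<open>Equals the length of the compiled code, which is straight-line and so runs once per
  evaluation. A variable costs 2 because the machine has no move instruction: copying means adding
  to a freshly loaded 0.\<close>

fun ecost :: "expr \<Rightarrow> nat" where
  "ecost (V x) = 2"
| "ecost (Num k) = 1"
| "ecost (Op f a b) = ecost a + ecost b + 1"
| "ecost (Flr a) = ecost a + 1"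
| "ecost (Arr k a) = ecost a + 7"
| "ecost (Low a) = ecost a + 1"

text \<open>The surcharges mirror the jumps of \<open>ccomp\<close>. A successful
  \<open>While\<close> test pays for the conditional jump and the later jump back, a failing one for
  falling through to an unconditional exit jump. In \<open>If\<close> only the false branch has to
  jump over the other one.\<close>

inductive big :: "(nat \<Rightarrow> real) \<Rightarrow> com \<Rightarrow> state \<Rightarrow> state \<Rightarrow> bool" for t where
  big_Skip: "big t Skip s s"
| big_Assign: "defd e s \<Longrightarrow>
    big t (Assign x e) s (s\<lparr>vr := (vr s)(x := eval e s), tm := tm s + (ecost e + 2)\<rparr>)"
| big_StoreA: "defd e s \<Longrightarrow> defd e' s \<Longrightarrow> 0 \<le> eval e s \<Longrightarrow>
    big t (StoreA k e e') s
      (s\<lparr>ar := (ar s)(k mod 8 := (ar s (k mod 8))(nat \<lfloor>eval e s\<rfloor> := eval e' s)),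
         tm := tm s + (ecost e + ecost e' + 7)\<rparr>)"
| big_StoreL: "defd e s \<Longrightarrow> defd e' s \<Longrightarrow> nat \<lfloor>eval e s\<rfloor> < bnd s \<Longrightarrow>
    big t (StoreL e e') s
      (s\<lparr>lo := (lo s)(nat \<lfloor>eval e s\<rfloor> := eval e' s), tm := tm s + (ecost e + ecost e' + 1)\<rparr>)"
| big_Sample: "big t (Sample x) s
    (s\<lparr>vr := (vr s)(x := t (dr s)), dr := Suc (dr s), tm := tm s + 1\<rparr>)"
| big_Seq: "big t c s s' \<Longrightarrow> big t d s' s'' \<Longrightarrow> big t (Seq c d) s s''"
| big_If_True: "defd a s \<Longrightarrow> defd b s \<Longrightarrow> eval a s \<le> eval b s \<Longrightarrow>
    big t c (s\<lparr>tm := tm s + (ecost a + ecost b + 1)\<rparr>) s' \<Longrightarrow> big t (If a b c d) s s'"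
| big_If_False: "defd a s \<Longrightarrow> defd b s \<Longrightarrow> \<not> eval a s \<le> eval b s \<Longrightarrow>
    big t d (s\<lparr>tm := tm s + (ecost a + ecost b + 2)\<rparr>) s' \<Longrightarrow> big t (If a b c d) s s'"
| big_While_True: "defd a s \<Longrightarrow> defd b s \<Longrightarrow> eval a s \<le> eval b s \<Longrightarrow>
    big t c (s\<lparr>tm := tm s + (ecost a + ecost b + 2)\<rparr>) s' \<Longrightarrow>
    big t (While a b c) s' s'' \<Longrightarrow> big t (While a b c) s s''"
| big_While_False: "defd a s \<Longrightarrow> defd b s \<Longrightarrow> \<not> eval a s \<le> eval b s \<Longrightarrow>
    big t (While a b c) s (s\<lparr>tm := tm s + (ecost a + ecost b + 2)\<rparr>)"

text \<open>Register 0 holds the length \<open>bnd\<close> of the input, the odd registers hold the variables, and the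
  other even registers serve as an evaluation stack. Cell \<open>i\<close> of the array \<open>k < 8\<close> is stored at the
  address \<open>bnd + 8 * i + k\<close>, so that the arrays neither overlap nor need known sizes.\<close>

definition treg :: "nat \<Rightarrow> nat" where "treg d = 2 * d + 2"
definition vreg :: "nat \<Rightarrow> nat" where "vreg x = 2 * x + 1"

lemma reg_neq [simp]:
  "treg d \<noteq> vreg x" "vreg x \<noteq> treg d" "treg d \<noteq> 0" "vreg x \<noteq> 0" "0 \<noteq> treg d" "0 \<noteq> vreg x"
  "Suc 0 \<noteq> treg d"
  by (simp_all add: treg_def vreg_def) presburger+

lemma treg_eq [simp]: "treg d = treg d' \<longleftrightarrow> d = d'"
  and vreg_eq [simp]: "vreg x = vreg y \<longleftrightarrow> x = y"
  by (simp_all add: treg_def vreg_def)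

fun comp :: "expr \<Rightarrow> nat \<Rightarrow> instr list" where
  "comp (V x) d = [Const (treg d) 0, Add (treg d) (treg d) (vreg x)]"
| "comp (Num k) d = [Const (treg d) k]"
| "comp (Op f a b) d =
     comp a d @ comp b (Suc d) @ [opinstr f (treg d) (treg d) (treg (Suc d))]"
| "comp (Flr a) d = comp a d @ [Trunc (treg d) (treg d)]"
| "comp (Arr k a) d = comp a d @
     [Trunc (treg d) (treg d), Const (treg (Suc d)) 8, Mul (treg d) (treg d) (treg (Suc d)),
      Const (treg (Suc d)) (int (k mod 8)), Add (treg d) (treg d) (treg (Suc d)),
      Add (treg d) (treg d) 0, Load (treg d) (treg d)]"
| "comp (Low a) d = comp a d @ [Load (treg d) (treg d)]"

lemma length_comp [simp]: "length (comp e d) = ecost e"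
  by (induction e arbitrary: d) auto

fun straight :: "instr \<Rightarrow> bool" where
  "straight (Jump_le i j l) = False"
| "straight _ = True"

lemma straight_opinstr [simp]: "straight (opinstr f i j k)"
  by (cases f) auto

lemma straight_comp [simp]: "list_all straight (comp e d)"
  by (induction e arbitrary: d) auto

definition code :: "instr list \<Rightarrow> nat \<Rightarrow> instr list \<Rightarrow> bool" where
  "code P p is \<longleftrightarrow> (\<forall>i<length is. p + i < length P \<and> P ! (p + i) = is ! i)"

lemma code_Nil [simp]: "code P p []"
  by (simp add: code_def)

lemma code_Cons [simp]:
  "code P p (x # xs) \<longleftrightarrow> p < length P \<and> P ! p = x \<and> code P (Suc p) xs"
  by (simp add: code_def All_less_Suc2)

lemma code_append [simp]: "code P p (xs @ ys) \<longleftrightarrow> code P p xs \<and> code P (p + length xs) ys"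
  by (induction xs arbitrary: p) auto

lemma code_self: "code P 0 P"
  by (simp add: code_def)

lemma pc_exec_straight: "straight i \<Longrightarrow> pc (exec t i c) = Suc (pc c)"
  by (cases i) (auto simp: set_reg_def)

lemma step_code: "pc c < length P \<Longrightarrow> step P t c = exec t (P ! pc c) c"
  by (simp add: step_def halted_def)

lemma run_straight:
  assumes "list_all straight is" "code P (pc c) is"
  shows "(step P t ^^ length is) c = fold (exec t) is c"
    and "pc (fold (exec t) is c) = pc c + length is"
proof -
  have "(step P t ^^ length is) c = fold (exec t) is c \<and>
      pc (fold (exec t) is c) = pc c + length is"
    using assms
  proof (induction "is" arbitrary: c)
    case (Cons i xs)
    then show ?case
      using Cons.IH[of "exec t i c"]
      by (simp add: step_code pc_exec_straight funpow_swap1 del: funpow.simps)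
         (simp add: step_code pc_exec_straight funpow_Suc_right del: funpow.simps)
  qed simp
  then show "(step P t ^^ length is) c = fold (exec t) is c"
    and "pc (fold (exec t) is c) = pc c + length is" by auto
qed

definition sim :: "state \<Rightarrow> config \<Rightarrow> bool" where
  "sim s c \<longleftrightarrow> (\<forall>x. reg c (vreg x) = vr s x) \<and> reg c 0 = real (bnd s) \<and>
     (\<forall>a<bnd s. mem c a = lo s a) \<and>
     (\<forall>k<8. \<forall>i. mem c (bnd s + 8 * i + k) = ar s k i) \<and> drawn c = dr s"

lemma exec_opinstr [simp]: "exec t (opinstr f i j k) c = set_reg i (opval f (reg c j) (reg c k)) c"
  by (cases f) auto

lemma set_reg_simps [simp]:
  "reg (set_reg i x c) = (reg c)(i := x)" "mem (set_reg i x c) = mem c"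
  "drawn (set_reg i x c) = drawn c" "pc (set_reg i x c) = Suc (pc c)"
  by (simp_all add: set_reg_def)

lemma address_cell:
  assumes "0 \<le> x"
  shows "address (of_int \<lfloor>x\<rfloor> * 8 + real k + real l) = l + 8 * nat \<lfloor>x\<rfloor> + k"
proof -
  define i where "i = nat \<lfloor>x\<rfloor>"
  have "(of_int \<lfloor>x\<rfloor> :: real) = real i"
    using assms by (simp add: i_def)
  then have "of_int \<lfloor>x\<rfloor> * 8 + real k + real l = real (l + 8 * i + k)"
    by simp
  then show ?thesis
    by (simp add: address_def i_def del: of_nat_add of_nat_mult)
qed

text \<open>Evaluation at depth \<open>d\<close> may clobber only stack registers from
  \<open>d\<close> upwards. This keeps the first operand intact while the second one is computed at
  depth \<open>Suc d\<close>.\<close>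

definition agree :: "nat \<Rightarrow> config \<Rightarrow> config \<Rightarrow> bool" where
  "agree d c c' \<longleftrightarrow> (\<forall>r. (\<forall>j\<ge>d. r \<noteq> treg j) \<longrightarrow> reg c' r = reg c r) \<and>
     mem c' = mem c \<and> drawn c' = drawn c"

lemma agree_refl: "agree d c c"
  by (simp add: agree_def)

lemma agree_trans: "agree d c c' \<Longrightarrow> agree d' c' c'' \<Longrightarrow> d \<le> d' \<Longrightarrow> agree d c c''"
  by (fastforce simp: agree_def)

lemma agree_treg: "agree d c c' \<Longrightarrow> i < d \<Longrightarrow> reg c' (treg i) = reg c (treg i)"
  by (auto simp: agree_def)

lemma agree_sim: "agree d c c' \<Longrightarrow> sim s c \<Longrightarrow> sim s c'"
  by (auto simp: agree_def sim_def)

lemma agree_set_reg: "agree d c c' \<Longrightarrow> d \<le> j \<Longrightarrow> agree d c (set_reg (treg j) x c')"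
  by (auto simp: agree_def)

lemma comp_correct:
  assumes "sim s c" "defd e s"
  shows "reg (fold (exec t) (comp e d) c) (treg d) = eval e s"
    and "agree d c (fold (exec t) (comp e d) c)"
proof -
  have "reg (fold (exec t) (comp e d) c) (treg d) = eval e s \<and>
      agree d c (fold (exec t) (comp e d) c)"
    using assms
  proof (induction e arbitrary: d c)
    case (V x)
    then show ?case
      by (auto simp: sim_def agree_def)
  next
    case (Num k)
    then show ?case
      by (auto simp: agree_def)
  next
    case (Op f a b)
    define c1 where "c1 = fold (exec t) (comp a d) c"
    define c2 where "c2 = fold (exec t) (comp b (Suc d)) c1"
    have 1: "reg c1 (treg d) = eval a s" "agree d c c1"
      using Op unfolding c1_def by auto
    then have s: "sim s c1"
      using Op by (blast intro: agree_sim)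
    have 2: "reg c2 (treg (Suc d)) = eval b s" "agree (Suc d) c1 c2"
      using Op.IH(2)[OF s] Op unfolding c2_def by auto
    have 3: "reg c2 (treg d) = eval a s"
      using 1 2(2) by (simp add: agree_treg)
    show ?case
      using 1 2 3 agree_trans[of d c c1 "Suc d" c2]
      by (auto simp: c1_def[symmetric] c2_def[symmetric] intro!: agree_set_reg)
  next
    case (Flr a)
    then show ?case
      by (auto intro!: agree_set_reg)
  next
    case (Arr k a)
    define c1 where "c1 = fold (exec t) (comp a d) c"
    have 1: "reg c1 (treg d) = eval a s" "agree d c c1"
      using Arr unfolding c1_def by auto
    then have s: "sim s c1"
      using Arr by (blast intro: agree_sim)
    have 2: "reg c1 0 = real (bnd s)"
      using s by (simp add: sim_def)
    have 3: "mem c1 (bnd s + 8 * nat \<lfloor>eval a s\<rfloor> + k mod 8) = ar s (k mod 8) (nat \<lfloor>eval a s\<rfloor>)"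
      using s by (simp add: sim_def)
    have 4: "address (of_int \<lfloor>eval a s\<rfloor> * 8 + real (k mod 8) + real (bnd s)) =
        bnd s + 8 * nat \<lfloor>eval a s\<rfloor> + k mod 8"
      using Arr.prems by (intro address_cell) auto
    show ?case
      using 1 2 3 4
      by (auto simp: c1_def[symmetric] intro!: agree_set_reg)
  next
    case (Low a)
    define c1 where "c1 = fold (exec t) (comp a d) c"
    have 1: "reg c1 (treg d) = eval a s" "agree d c c1"
      using Low unfolding c1_def by auto
    then have s: "sim s c1"
      using Low by (blast intro: agree_sim)
    show ?case
      using 1 s Low.prems
      by (auto simp: c1_def[symmetric] address_def sim_def intro!: agree_set_reg)
  qed
  then show "reg (fold (exec t) (comp e d) c) (treg d) = eval e s"
    and "agree d c (fold (exec t) (comp e d) c)" by auto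
qed

definition comp2 :: "expr \<Rightarrow> expr \<Rightarrow> instr list" where
  "comp2 a b = comp a 0 @ comp b 1"

lemma comp2_correct:
  assumes "sim s c" "defd a s" "defd b s"
  shows "reg (fold (exec t) (comp2 a b) c) (treg 0) = eval a s"
    and "reg (fold (exec t) (comp2 a b) c) (treg (Suc 0)) = eval b s"
    and "agree 0 c (fold (exec t) (comp2 a b) c)"
    and "sim s (fold (exec t) (comp2 a b) c)"
proof -
  define c1 where "c1 = fold (exec t) (comp a 0) c"
  have 1: "reg c1 (treg 0) = eval a s" "agree 0 c c1"
    unfolding c1_def using assms by (auto intro: comp_correct)
  then have s: "sim s c1"
    using assms by (blast intro: agree_sim)
  define c2 where "c2 = fold (exec t) (comp b 1) c1"
  have 2: "reg c2 (treg 1) = eval b s" "agree 1 c1 c2"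
    unfolding c2_def using assms s by (auto intro: comp_correct)
  have *: "fold (exec t) (comp2 a b) c = c2"
    by (simp add: comp2_def c2_def c1_def)
  show "reg (fold (exec t) (comp2 a b) c) (treg 0) = eval a s"
    unfolding * using 1 2(2) by (simp add: agree_treg)
  show "reg (fold (exec t) (comp2 a b) c) (treg (Suc 0)) = eval b s"
    unfolding * using 2 by simp
  show "agree 0 c (fold (exec t) (comp2 a b) c)"
    unfolding * using agree_trans[OF 1(2) 2(2)] by simp
  then show "sim s (fold (exec t) (comp2 a b) c)"
    using assms by (blast intro: agree_sim)
qed

lemma comp2_straight [simp]: "list_all straight (comp2 a b)"
  and length_comp2 [simp]: "length (comp2 a b) = ecost a + ecost b"
  by (simp_all add: comp2_def)

section \<open>Compilation of commands and its correctness\<close>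

fun clen :: "com \<Rightarrow> nat" where
  "clen Skip = 0"
| "clen (Assign x e) = ecost e + 2"
| "clen (StoreA k e e') = ecost e + ecost e' + 7"
| "clen (StoreL e e') = ecost e + ecost e' + 1"
| "clen (Sample x) = 1"
| "clen (Seq c d) = clen c + clen d"
| "clen (If a b c d) = ecost a + ecost b + clen c + clen d + 2"
| "clen (While a b c) = ecost a + ecost b + clen c + 3"

text \<open>\<open>Jump_le 0 0\<close> is an unconditional jump, as it compares a register with
  itself. Targets are absolute, hence the start address \<open>p\<close>; code lengths do not depend
  on it, which makes forward targets computable.\<close>

fun ccomp :: "nat \<Rightarrow> com \<Rightarrow> instr list" where
  "ccomp p Skip = []"
| "ccomp p (Assign x e) =
     comp e 0 @ [Const (treg 1) 0, Add (vreg x) (treg 0) (treg 1)]"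
| "ccomp p (StoreA k e e') = comp2 e e' @
     [Trunc (treg 0) (treg 0), Const (treg 2) 8, Mul (treg 0) (treg 0) (treg 2),
      Const (treg 2) (int (k mod 8)), Add (treg 0) (treg 0) (treg 2),
      Add (treg 0) (treg 0) 0, Store (treg 0) (treg 1)]"
| "ccomp p (StoreL e e') = comp2 e e' @ [Store (treg 0) (treg 1)]"
| "ccomp p (Sample x) = [Rand (vreg x)]"
| "ccomp p (Seq c d) = ccomp p c @ ccomp (p + clen c) d"
| "ccomp p (If a b c d) =
     (let q = p + ecost a + ecost b in
      comp2 a b @ [Jump_le (treg 0) (treg 1) (q + clen d + 2)] @
      ccomp (q + 1) d @ [Jump_le 0 0 (q + clen d + 2 + clen c)] @ ccomp (q + clen d + 2) c)"
| "ccomp p (While a b c) =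
     (let q = p + ecost a + ecost b in
      comp2 a b @ [Jump_le (treg 0) (treg 1) (q + 2), Jump_le 0 0 (q + 3 + clen c)] @
      ccomp (q + 2) c @ [Jump_le 0 0 p])"

lemma length_ccomp [simp]: "length (ccomp p c) = clen c"
  by (induction c arbitrary: p) (auto simp: Let_def)

definition reaches :: "instr list \<Rightarrow> (nat \<Rightarrow> real) \<Rightarrow> config \<Rightarrow> nat \<Rightarrow> config \<Rightarrow> bool" where
  "reaches P t c k c' \<longleftrightarrow> (step P t ^^ k) c = c'"

lemma reaches_trans: "reaches P t c k c' \<Longrightarrow> reaches P t c' l c'' \<Longrightarrow> reaches P t c (k + l) c''"
  by (simp add: reaches_def funpow_add add.commute[of k])

lemma reaches_step: "pc c < length P \<Longrightarrow> reaches P t c 1 (exec t (P ! pc c) c)"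
  by (simp add: reaches_def step_code)

lemma reaches_straight:
  "list_all straight is \<Longrightarrow> code P (pc c) is \<Longrightarrow>
   reaches P t c (length is) (fold (exec t) is c)"
  by (simp add: reaches_def run_straight)

lemma reaches_If_test:
  assumes "sim s c" "defd a s" "defd b s" "code P (pc c) (comp2 a b @ [Jump_le (treg 0) (treg 1) l])"
  shows "\<exists>c'. reaches P t c (ecost a + ecost b + 1) c' \<and> sim s c' \<and>
    pc c' = (if eval a s \<le> eval b s then l else pc c + (ecost a + ecost b + 1))"
proof -
  define c1 where "c1 = fold (exec t) (comp2 a b) c"
  have r: "reaches P t c (ecost a + ecost b) c1"
    unfolding c1_def using reaches_straight[of "comp2 a b" P c t] assms by simp
  have p: "pc c1 = pc c + (ecost a + ecost b)"
    unfolding c1_def using assms by (subst run_straight[where P = P]) auto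
  have j: "pc c1 < length P" "P ! pc c1 = Jump_le (treg 0) (treg 1) l"
    using assms p by (simp_all add: add.assoc)
  note c = comp2_correct[OF assms(1-3), of t, folded c1_def]
  let ?c = "exec t (Jump_le (treg 0) (treg 1) l) c1"
  have "reaches P t c (ecost a + ecost b + 1) ?c"
    using reaches_trans[OF r reaches_step[OF j(1)]] unfolding j(2) .
  moreover have "sim s ?c"
    using c(4) by (simp add: sim_def)
  moreover have "pc ?c = (if eval a s \<le> eval b s then l else pc c + (ecost a + ecost b + 1))"
    using c(1,2) p by simp
  ultimately show ?thesis by blast
qed

lemma reaches_jump:
  assumes "sim s c" "code P (pc c) [Jump_le 0 0 l]"
  shows "\<exists>c'. reaches P t c 1 c' \<and> sim s c' \<and> pc c' = l"
  using assms reaches_step[of c P t]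
  by (intro exI[of _ "exec t (P ! pc c) c"]) (auto simp: sim_def)

lemma sim_tm [simp]: "sim (s\<lparr>tm := k\<rparr>) c = sim s c"
  by (simp add: sim_def)

text \<open>With stride 8 and array numbers below 8, quotient and remainder recover index and array
  from an address. A write thus changes exactly one cell and nothing in the input area.\<close>

lemma sim_Store:
  assumes "sim s c"
    and "mem c' = (mem c)(bnd s + 8 * i + k mod 8 := x)"
    and "\<And>x. reg c' (vreg x) = reg c (vreg x)" "reg c' 0 = reg c 0" "drawn c' = drawn c"
  shows "sim (s\<lparr>ar := (ar s)(k mod 8 := (ar s (k mod 8))(i := x))\<rparr>) c'"
proof -
  have *: "bnd s + 8 * i' + k' = bnd s + 8 * i + l \<longleftrightarrow> i' = i \<and> k' = l"
    if "k' < 8" "l < 8" for i' k' l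
  proof
    assume "bnd s + 8 * i' + k' = bnd s + 8 * i + l"
    then have "(8 * i' + k') div 8 = (8 * i + l) div 8" "(8 * i' + k') mod 8 = (8 * i + l) mod 8"
      by simp_all
    then show "i' = i \<and> k' = l"
      using that by simp
  qed simp
  have **: "mem c' (bnd s + 8 * i' + k') = (if i' = i \<and> k' = k mod 8 then x else ar s k' i')"
    if "k' < 8" for i' k'
    using *[OF that, of "k mod 8" i'] that assms(1,2) by (simp add: sim_def)
  have "\<forall>a<bnd s. mem c' a = lo s a"
    using assms(1,2) by (simp add: sim_def)
  with ** show ?thesis
    using assms by (auto simp: sim_def)
qed

text \<open>Simulation in one direction is enough because \<open>step\<close> is a function: the
  execution built along the big-step derivation is the only one. Its length is exactly the increase
  of \<open>tm\<close>.\<close>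

lemma ccomp_correct:
  assumes "big t c s s'" "sim s k" "pc k = p" "code P p (ccomp p c)"
  shows "\<exists>k' n. reaches P t k n k' \<and> tm s' = tm s + n \<and> sim s' k' \<and> pc k' = p + clen c"
  using assms
proof (induction arbitrary: k p)
  case (big_Skip s)
  then show ?case
    by (intro exI[of _ k] exI[of _ 0]) (auto simp: reaches_def)
next
  case (big_Assign e s x)
  have r: "reaches P t k (clen (Assign x e)) (fold (exec t) (ccomp p (Assign x e)) k)"
    using reaches_straight[of "ccomp p (Assign x e)" P k t] big_Assign by simp
  have p: "pc (fold (exec t) (ccomp p (Assign x e)) k) = p + clen (Assign x e)"
    using run_straight(2)[of "ccomp p (Assign x e)" P k t] big_Assign by simp
  note c = comp_correct[OF big_Assign(2,1), where t = t and d = 0]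
  show ?case
    by (intro exI conjI, rule r) (use c big_Assign p in \<open>auto simp: sim_def agree_def\<close>)
next
  case (big_StoreA e s e' a)
  let ?c = "StoreA a e e'"
  have st: "list_all straight (ccomp p ?c)" and cd: "code P (pc k) (ccomp p ?c)"
    using big_StoreA by simp_all
  have r: "reaches P t k (clen ?c) (fold (exec t) (ccomp p ?c) k)"
    using reaches_straight[OF st cd, of t] by (simp del: ccomp.simps)
  have p: "pc (fold (exec t) (ccomp p ?c) k) = p + clen ?c"
    using run_straight(2)[OF st cd, of t] big_StoreA(5) by (simp del: ccomp.simps)
  define k1 where "k1 = fold (exec t) (comp2 e e') k"
  note c = comp2_correct[OF big_StoreA(4,1,2), of t, folded k1_def]
  have 0: "reg k1 0 = real (bnd s)"
    using c by (simp add: sim_def)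
  define i where "i = nat \<lfloor>eval e s\<rfloor>"
  have A: "address (of_int \<lfloor>eval e s\<rfloor> * 8 + real (a mod 8) + real (bnd s)) =
      bnd s + 8 * i + a mod 8"
    unfolding i_def using big_StoreA by (intro address_cell) auto
  have "fold (exec t) (ccomp p ?c) k = exec t (Store (treg 0) (treg 1))
      (fold (exec t) (take 6 (drop (ecost e + ecost e') (ccomp p ?c))) k1)"
    by (simp add: k1_def)
  then have k: "mem (fold (exec t) (ccomp p ?c) k) =
        (mem k1)(bnd s + 8 * i + a mod 8 := eval e' s)"
      "reg (fold (exec t) (ccomp p ?c) k) (vreg x) = reg k1 (vreg x)"
      "reg (fold (exec t) (ccomp p ?c) k) 0 = reg k1 0"
      "drawn (fold (exec t) (ccomp p ?c) k) = drawn k1" for x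
    using c(1,2) 0 A by simp_all
  let ?s = "s\<lparr>ar := (ar s)(a mod 8 := (ar s (a mod 8))(nat \<lfloor>eval e s\<rfloor> := eval e' s)),
         tm := tm s + (ecost e + ecost e' + 7)\<rparr>"
  have "sim (s\<lparr>ar := (ar s)(a mod 8 := (ar s (a mod 8))(i := eval e' s))\<rparr>)
      (fold (exec t) (ccomp p ?c) k)"
    by (rule sim_Store[OF c(4) k])
  then have si: "sim ?s (fold (exec t) (ccomp p ?c) k)"
    by (simp add: i_def sim_def del: ccomp.simps)
  show ?case
    by (intro exI conjI, rule r) (use p si in \<open>simp_all del: ccomp.simps\<close>)
next
  case (big_StoreL e s e')
  let ?c = "StoreL e e'"
  have st: "list_all straight (ccomp p ?c)" and cd: "code P (pc k) (ccomp p ?c)"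
    using big_StoreL by simp_all
  have r: "reaches P t k (clen ?c) (fold (exec t) (ccomp p ?c) k)"
    using reaches_straight[OF st cd, of t] by (simp del: ccomp.simps)
  have p: "pc (fold (exec t) (ccomp p ?c) k) = p + clen ?c"
    using run_straight(2)[OF st cd, of t] big_StoreL(5) by (simp del: ccomp.simps)
  define k1 where "k1 = fold (exec t) (comp2 e e') k"
  note c = comp2_correct[OF big_StoreL(4,1,2), of t, folded k1_def]
  let ?s = "s\<lparr>lo := (lo s)(nat \<lfloor>eval e s\<rfloor> := eval e' s), tm := tm s + (ecost e + ecost e' + 1)\<rparr>"
  have si: "sim ?s (fold (exec t) (ccomp p ?c) k)"
    using c(1,2) c(4) big_StoreL(3)
    by (auto simp: sim_def k1_def[symmetric] address_def)
  show ?case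
    by (intro exI conjI, rule r) (use p si in \<open>simp_all del: ccomp.simps\<close>)
next
  case (big_Sample x s)
  have "reaches P t k 1 (exec t (P ! pc k) k)"
    using big_Sample by (intro reaches_step) auto
  then show ?case
    using big_Sample
    by (intro exI[of _ "exec t (P ! pc k) k"] exI[of _ 1]) (auto simp: sim_def)
next
  case (big_Seq c s s' d s'')
  from big_Seq.IH(1)[of k p] big_Seq.prems obtain k1 n1 where 1: "reaches P t k n1 k1"
    "tm s' = tm s + n1" "sim s' k1" "pc k1 = p + clen c" by auto
  from big_Seq.IH(2)[of k1 "p + clen c"] 1 big_Seq.prems obtain k2 n2 where
    2: "reaches P t k1 n2 k2" "tm s'' = tm s' + n2" "sim s'' k2" "pc k2 = p + clen c + clen d"
    by auto
  show ?case
    by (intro exI conjI, rule reaches_trans[OF 1(1) 2(1)]) (use 1 2 in simp_all)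
next
  case (big_If_True a s b c s' d)
  let ?q = "p + ecost a + ecost b"
  from reaches_If_test[of s k a b P "?q + clen d + 2" t] big_If_True
  obtain k1 where 1: "reaches P t k (ecost a + ecost b + 1) k1" "sim s k1"
    "pc k1 = ?q + clen d + 2"
    by (auto simp: Let_def algebra_simps)
  from big_If_True.IH[of k1 "?q + clen d + 2"] 1 big_If_True.prems obtain k2 n2 where
    2: "reaches P t k1 n2 k2" "tm s' = tm s + (ecost a + ecost b + 1) + n2" "sim s' k2"
      "pc k2 = ?q + clen d + 2 + clen c"
    by (auto simp: Let_def algebra_simps)
  show ?case
    by (intro exI conjI, rule reaches_trans[OF 1(1) 2(1)]) (use 1 2 in simp_all)
next
  case (big_If_False a s b d s' c)
  let ?q = "p + ecost a + ecost b"
  from reaches_If_test[of s k a b P "?q + clen d + 2" t] big_If_False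
  obtain k1 where 1: "reaches P t k (ecost a + ecost b + 1) k1" "sim s k1"
    "pc k1 = ?q + 1"
    by (auto simp: Let_def algebra_simps)
  from big_If_False.IH[of k1 "?q + 1"] 1 big_If_False.prems obtain k2 n2 where
    2: "reaches P t k1 n2 k2" "tm s' = tm s + (ecost a + ecost b + 2) + n2" "sim s' k2"
      "pc k2 = ?q + 1 + clen d"
    by (auto simp: Let_def algebra_simps)
  from reaches_jump[of s' k2 P "?q + clen d + 2 + clen c" t] 2 big_If_False.prems obtain k3 where
    3: "reaches P t k2 1 k3" "sim s' k3" "pc k3 = ?q + clen d + 2 + clen c"
    by (auto simp: Let_def algebra_simps)
  show ?case
    by (intro exI conjI, rule reaches_trans[OF reaches_trans[OF 1(1) 2(1)] 3(1)]) (use 1 2 3 in simp_all)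
next
  case (big_While_True a s b c s' s'')
  let ?q = "p + ecost a + ecost b"
  from reaches_If_test[of s k a b P "?q + 2" t] big_While_True
  obtain k1 where 1: "reaches P t k (ecost a + ecost b + 1) k1" "sim s k1"
    "pc k1 = ?q + 2"
    by (auto simp: Let_def algebra_simps)
  from big_While_True.IH(1)[of k1 "?q + 2"] 1 big_While_True.prems obtain k2 n2 where
    2: "reaches P t k1 n2 k2" "tm s' = tm s + (ecost a + ecost b + 2) + n2" "sim s' k2"
      "pc k2 = ?q + 2 + clen c"
    by (auto simp: Let_def algebra_simps)
  from reaches_jump[of s' k2 P p t] 2 big_While_True.prems obtain k3 where
    3: "reaches P t k2 1 k3" "sim s' k3" "pc k3 = p"
    by (auto simp: Let_def algebra_simps)
  from big_While_True.IH(2)[of k3 p] 3 big_While_True.prems obtain k4 n4 where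
    4: "reaches P t k3 n4 k4" "tm s'' = tm s' + n4" "sim s'' k4"
      "pc k4 = p + clen (While a b c)"
    by auto
  show ?case
    by (intro exI conjI, rule reaches_trans[OF reaches_trans[OF reaches_trans[OF 1(1) 2(1)] 3(1)] 4(1)])
      (use 1 2 3 4 in simp_all)
next
  case (big_While_False a s b c)
  let ?q = "p + ecost a + ecost b"
  from reaches_If_test[of s k a b P "?q + 2" t] big_While_False
  obtain k1 where 1: "reaches P t k (ecost a + ecost b + 1) k1" "sim s k1"
    "pc k1 = ?q + 1"
    by (auto simp: Let_def algebra_simps)
  from reaches_jump[of s k1 P "?q + 3 + clen c" t] 1 big_While_False.prems obtain k3 where
    3: "reaches P t k1 1 k3" "sim s k3" "pc k3 = ?q + 3 + clen c"
    by (auto simp: Let_def algebra_simps)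
  show ?case
    by (intro exI conjI, rule reaches_trans[OF 1(1) 3(1)]) (use 1 3 in simp_all)
qed

text \<open>A derivation of \<open>big\<close> exists only for terminating, well-defined runs, so
  this is total correctness. The clock \<open>tm\<close> is part of the state, so time bounds are
  ordinary postconditions.\<close>

definition wp :: "(nat \<Rightarrow> real) \<Rightarrow> com \<Rightarrow> (state \<Rightarrow> bool) \<Rightarrow> state \<Rightarrow> bool" where
  "wp t c Q s \<longleftrightarrow> (\<exists>s'. big t c s s' \<and> Q s')"

lemma wp_mono: "wp t c Q s \<Longrightarrow> (\<And>s. Q s \<Longrightarrow> Q' s) \<Longrightarrow> wp t c Q' s"
  by (auto simp: wp_def)

lemma wp_Assign:
  "defd e s \<Longrightarrow> Q (s\<lparr>vr := (vr s)(x := eval e s), tm := tm s + (ecost e + 2)\<rparr>) \<Longrightarrow>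
   wp t (Assign x e) Q s"
  by (auto simp: wp_def intro: big_Assign)

lemma wp_StoreL:
  "defd e s \<Longrightarrow> defd e' s \<Longrightarrow> nat \<lfloor>eval e s\<rfloor> < bnd s \<Longrightarrow>
   Q (s\<lparr>lo := (lo s)(nat \<lfloor>eval e s\<rfloor> := eval e' s), tm := tm s + (ecost e + ecost e' + 1)\<rparr>) \<Longrightarrow>
   wp t (StoreL e e') Q s"
  unfolding wp_def by (blast intro: big_StoreL)

lemma wp_Sample:
  "Q (s\<lparr>vr := (vr s)(x := t (dr s)), dr := Suc (dr s), tm := tm s + 1\<rparr>) \<Longrightarrow> wp t (Sample x) Q s"
  unfolding wp_def by (blast intro: big_Sample)

lemma wp_Seq: "wp t c (wp t d Q) s \<Longrightarrow> wp t (Seq c d) Q s"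
  unfolding wp_def by (blast intro: big_Seq)

lemma wp_If:
  "defd a s \<Longrightarrow> defd b s \<Longrightarrow>
   (eval a s \<le> eval b s \<Longrightarrow> wp t c Q (s\<lparr>tm := tm s + (ecost a + ecost b + 1)\<rparr>)) \<Longrightarrow>
   (\<not> eval a s \<le> eval b s \<Longrightarrow> wp t d Q (s\<lparr>tm := tm s + (ecost a + ecost b + 2)\<rparr>)) \<Longrightarrow>
   wp t (If a b c d) Q s"
  unfolding wp_def by (cases "eval a s \<le> eval b s") (blast intro: big_If_True big_If_False)+

text \<open>The variant \<open>k\<close> is a ghost parameter of the invariant rather than a
  function of the state. This permits measures that no variable stores, such as the number of
  unfinished vertices or the distance to a trial known to succeed.\<close>

lemma wp_While_index:
  assumes "Inv (k :: nat) s"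
    and "\<And>k s. Inv k s \<Longrightarrow> defd a s \<and> defd b s"
    and "\<And>k s. Inv k s \<Longrightarrow> eval a s \<le> eval b s \<Longrightarrow>
      wp t c (\<lambda>s'. \<exists>k'<k. Inv k' s') (s\<lparr>tm := tm s + (ecost a + ecost b + 2)\<rparr>)"
    and "\<And>k s. Inv k s \<Longrightarrow> \<not> eval a s \<le> eval b s \<Longrightarrow> Q (s\<lparr>tm := tm s + (ecost a + ecost b + 2)\<rparr>)"
  shows "wp t (While a b c) Q s"
  using assms(1)
proof (induction k arbitrary: s rule: less_induct)
  case (less k)
  show ?case
  proof (cases "eval a s \<le> eval b s")
    case True
    from assms(3)[OF less.prems True] obtain s' k' where
      s': "big t c (s\<lparr>tm := tm s + (ecost a + ecost b + 2)\<rparr>) s'" "k' < k" "Inv k' s'"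
      by (auto simp: wp_def)
    from less.IH[OF s'(2,3)] obtain s'' where "big t (While a b c) s' s''" "Q s''"
      by (auto simp: wp_def)
    then show ?thesis
      using s'(1) assms(2)[OF less.prems] True unfolding wp_def by (blast intro: big_While_True)
  next
    case False
    then show ?thesis
      using assms(2,4)[OF less.prems] unfolding wp_def by (blast intro: big_While_False)
  qed
qed

inductive_cases big_SkipE: "big t Skip s s'"
inductive_cases big_AssignE: "big t (Assign x e) s s'"
inductive_cases big_StoreAE: "big t (StoreA k e e') s s'"
inductive_cases big_StoreLE: "big t (StoreL e e') s s'"
inductive_cases big_SampleE: "big t (Sample x) s s'"
inductive_cases big_SeqE: "big t (Seq c d) s s'"
inductive_cases big_IfE: "big t (If a b c d) s s'"

lemma wp_Skip_iff: "wp t Skip Q s \<longleftrightarrow> Q s"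
  by (auto simp: wp_def elim: big_SkipE intro: big_Skip)

lemma wp_Assign_iff:
  "wp t (Assign x e) Q s \<longleftrightarrow>
   defd e s \<and> Q (s\<lparr>vr := (vr s)(x := eval e s), tm := tm s + (ecost e + 2)\<rparr>)"
  by (auto simp: wp_def elim!: big_AssignE intro: big_Assign)

lemma wp_StoreA_iff:
  "wp t (StoreA k e e') Q s \<longleftrightarrow> defd e s \<and> defd e' s \<and> 0 \<le> eval e s \<and>
   Q (s\<lparr>ar := (ar s)(k mod 8 := (ar s (k mod 8))(nat \<lfloor>eval e s\<rfloor> := eval e' s)),
         tm := tm s + (ecost e + ecost e' + 7)\<rparr>)"
  unfolding wp_def by (blast elim!: big_StoreAE intro: big_StoreA)

lemma wp_StoreL_iff:
  "wp t (StoreL e e') Q s \<longleftrightarrow> defd e s \<and> defd e' s \<and> nat \<lfloor>eval e s\<rfloor> < bnd s \<and>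
   Q (s\<lparr>lo := (lo s)(nat \<lfloor>eval e s\<rfloor> := eval e' s), tm := tm s + (ecost e + ecost e' + 1)\<rparr>)"
  by (rule iffI, force simp: wp_def elim: big_StoreLE) (blast intro: wp_StoreL)

lemma wp_Sample_iff:
  "wp t (Sample x) Q s \<longleftrightarrow>
   Q (s\<lparr>vr := (vr s)(x := t (dr s)), dr := Suc (dr s), tm := tm s + 1\<rparr>)"
  by (rule iffI, force simp: wp_def elim: big_SampleE) (rule wp_Sample)

lemma wp_Seq_iff: "wp t (Seq c d) Q s \<longleftrightarrow> wp t c (wp t d Q) s"
  unfolding wp_def by (blast elim!: big_SeqE intro: big_Seq)

lemma wp_If_iff:
  "wp t (If a b c d) Q s \<longleftrightarrow> defd a s \<and> defd b s \<and>
   (if eval a s \<le> eval b s then wp t c Q (s\<lparr>tm := tm s + (ecost a + ecost b + 1)\<rparr>)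
    else wp t d Q (s\<lparr>tm := tm s + (ecost a + ecost b + 2)\<rparr>))"
proof
  show "wp t (If a b c d) Q s \<Longrightarrow> defd a s \<and> defd b s \<and>
   (if eval a s \<le> eval b s then wp t c Q (s\<lparr>tm := tm s + (ecost a + ecost b + 1)\<rparr>)
    else wp t d Q (s\<lparr>tm := tm s + (ecost a + ecost b + 2)\<rparr>))"
    unfolding wp_def by (elim exE conjE, erule big_IfE) auto
qed (auto intro: wp_If)

lemmas wp_iffs = wp_Skip_iff wp_Assign_iff wp_StoreA_iff wp_StoreL_iff wp_Sample_iff wp_Seq_iff wp_If_iff

text \<open>The language only tests \<open><=\<close>; on integers \<open>x + 1 <= e\<close> is the
  strict comparison. The bound is evaluated anew before every pass.\<close>

definition For :: "nat \<Rightarrow> expr \<Rightarrow> com \<Rightarrow> com" where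
  "For x e c = Seq (Assign x (Num 0))
     (While (Op Plus (V x) (Num 1)) e (Seq c (Assign x (Op Plus (V x) (Num 1)))))"

lemma wp_For:
  fixes m :: nat
  assumes "Inv 0 (s\<lparr>vr := (vr s)(x := 0), tm := tm s + 3\<rparr>)"
    and "\<And>i s. i \<le> m \<Longrightarrow> Inv i s \<Longrightarrow> vr s x = real i \<and> defd e s \<and> eval e s = real m"
    and "\<And>i s. i < m \<Longrightarrow> Inv i s \<Longrightarrow>
      wp t c (\<lambda>s'. vr s' x = real i \<and>
          Inv (Suc i) (s'\<lparr>vr := (vr s')(x := real (Suc i)), tm := tm s' + 6\<rparr>))
        (s\<lparr>tm := tm s + (ecost e + 6)\<rparr>)"
    and "\<And>s. Inv m s \<Longrightarrow> Q (s\<lparr>tm := tm s + (ecost e + 6)\<rparr>)"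
  shows "wp t (For x e c) Q s"
  unfolding For_def
proof (rule wp_Seq, rule wp_Assign)
  let ?I = "\<lambda>k s. \<exists>i\<le>m. k + i = m \<and> Inv i s"
  show "wp t (While (Op Plus (V x) (Num 1)) e (Seq c (Assign x (Op Plus (V x) (Num 1))))) Q
     (s\<lparr>vr := (vr s)(x := eval (Num 0) s), tm := tm s + (ecost (Num 0) + 2)\<rparr>)"
  proof (rule wp_While_index[where Inv = ?I and k = m], goal_cases)
    case 1
    show ?case using assms(1) by (auto simp: numeral_3_eq_3)
  next
    case (2 k s)
    then show ?case using assms(2) by auto
  next
    case (3 k s)
    then obtain i where i: "i \<le> m" "Inv i s" "k + i = m" by auto
    have x: "vr s x = real i" "eval e s = real m"
      using assms(2)[OF i(1,2)] by auto
    then have "i < m"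
      using 3(2) by simp
    have [simp]: "ecost (Op Plus (V x) (Num 1)) + ecost e + 2 = ecost e + 6"
      by simp
    show ?case
    proof (rule wp_Seq, simp only: \<open>_ = ecost e + 6\<close>, rule wp_mono[OF assms(3)[OF \<open>i < m\<close> i(2)]],
        rule wp_Assign, goal_cases)
      case (2 s')
      then have "s'\<lparr>vr := (vr s')(x := eval (Op Plus (V x) (Num 1)) s'),
          tm := tm s' + (ecost (Op Plus (V x) (Num 1)) + 2)\<rparr> =
          s'\<lparr>vr := (vr s')(x := real (Suc i)), tm := tm s' + 6\<rparr>"
        by (simp add: add.commute)
      moreover have "m - Suc i < k \<and> Suc i \<le> m \<and> m - Suc i + Suc i = m"
        using i(3) \<open>i < m\<close> by simp
      ultimately show ?case
        using 2 by metis
    qed simp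
  next
    case (4 k s)
    then obtain i where i: "i \<le> m" "Inv i s" by auto
    with assms(2)[OF i] 4(2) have "i = m" by auto
    have "ecost (Op Plus (V x) (Num 1)) + ecost e + 2 = ecost e + 6"
      by simp
    with i \<open>i = m\<close> assms(4) show ?case by metis
  qed
qed simp

text \<open>The second input word is the number of vertices, and the last pointer, which follows the two
  leading words and the other pointers, is the length of the input.\<close>

definition prologue :: "instr list" where
  "prologue = [Const 2 1, Load 2 2, Const 4 2, Add 2 2 4, Load 0 2]"

definition assemble :: "com \<Rightarrow> instr list" where
  "assemble c = prologue @ ccomp 5 c"

definition start :: "real list \<Rightarrow> state" where
  "start inp = \<lparr>vr = (\<lambda>_. 0), ar = (\<lambda>_ _. 0), lo = (\<lambda>a. if a < length inp then inp ! a else 0),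
     bnd = length inp, dr = 0, tm = 0\<rparr>"

lemma halted_run_mono: "halted P (run P inp t k) \<Longrightarrow> k \<le> l \<Longrightarrow> run P inp t l = run P inp t k"
proof (induction l)
  case (Suc l)
  then show ?case
    by (cases "k = Suc l") (auto simp: run_def step_def)
qed (auto simp: run_def)

lemma final_memory_halted:
  assumes "halted P (run P inp t k)"
  shows "final_memory P inp t = Some (mem (run P inp t k))"
proof -
  define l where "l = (LEAST k. halted P (run P inp t k))"
  have "halted P (run P inp t l)" "l \<le> k"
    unfolding l_def using assms by (auto intro: LeastI Least_le)
  then show ?thesis
    using assms halted_run_mono[of P inp t l k] unfolding final_memory_def l_def by auto
qed

text \<open>The prologue writes only register 0 and the stack registers 2 and 4, so all variables
  still hold 0 as in \<open>start\<close>. Its five instructions are the summand 5.\<close>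

lemma assemble_correct:
  assumes big: "big t c (start inp) s'"
    and inp: "1 < length inp" "inp ! 1 = real n" "n + 2 < length inp" "inp ! (n + 2) = real (length inp)"
  shows "running_time (assemble c) inp t \<le> of_nat (5 + tm s')"
    and "\<exists>l. final_memory (assemble c) inp t = Some l \<and> (\<forall>a<bnd s'. l a = lo s' a)"
proof -
  let ?P = "assemble c"
  define k where "k = fold (exec t) prologue (initial inp)"
  have len: "length prologue = 5"
    by (simp add: prologue_def)
  have st: "list_all straight prologue" and cd: "code ?P (pc (initial inp)) prologue"
    by (simp_all add: prologue_def assemble_def initial_def)
  have r: "reaches ?P t (initial inp) 5 k"
    using reaches_straight[OF st cd, of t] unfolding k_def len .
  have "address 1 = 1" "address (real n + 2) = n + 2"
    by (simp_all add: address_def nat_add_distrib)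
  moreover have vreg: "vreg x \<noteq> 2" "vreg x \<noteq> 4" for x
    unfolding vreg_def by presburger+
  ultimately have "sim (start inp) k"
    using inp unfolding k_def
    by (auto simp: prologue_def sim_def start_def initial_def vreg_def)
  moreover have "pc k = 5"
    using run_straight(2)[OF st cd, of t] unfolding k_def len by (simp add: initial_def)
  moreover have "code ?P 5 (ccomp 5 c)"
    using code_self[of ?P] unfolding assemble_def code_append len by simp
  ultimately obtain k' m where k': "reaches ?P t k m k'" "tm s' = m" "sim s' k'" "pc k' = 5 + clen c"
    using ccomp_correct[OF big, of k 5 ?P] by (auto simp: start_def)
  then have run: "run ?P inp t (5 + tm s') = k'"
    using reaches_trans[OF r k'(1)] by (simp add: reaches_def run_def)
  have "length ?P = 5 + clen c"
    by (simp add: assemble_def prologue_def)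
  with run k'(4) have halted: "halted ?P (run ?P inp t (5 + tm s'))"
    unfolding halted_def by simp
  then show "running_time ?P inp t \<le> of_nat (5 + tm s')"
    unfolding running_time_def by (intro INF_lower) simp
  show "\<exists>l. final_memory ?P inp t = Some l \<and> (\<forall>a<bnd s'. l a = lo s' a)"
    using final_memory_halted[OF halted] k'(3) by (auto simp: run sim_def)
qed

section \<open>Measurability of the machine semantics\<close>

text \<open>Measurability is asked of each component as a function of the tape, which avoids a
  sigma-algebra on configurations.\<close>

definition mcfg :: "((nat \<Rightarrow> real) \<Rightarrow> config) \<Rightarrow> bool" where
  "mcfg f \<longleftrightarrow> (\<lambda>t. pc (f t)) \<in> random_tape \<rightarrow>\<^sub>M count_space UNIV \<and>
     (\<forall>i. (\<lambda>t. reg (f t) i) \<in> borel_measurable random_tape) \<and>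
     (\<forall>a. (\<lambda>t. mem (f t) a) \<in> borel_measurable random_tape) \<and>
     (\<lambda>t. drawn (f t)) \<in> random_tape \<rightarrow>\<^sub>M count_space UNIV"

lemma space_random_tape: "space random_tape = UNIV"
  by (simp add: random_tape_def space_PiM)

lemma measurable_tape [measurable]: "(\<lambda>t. t i) \<in> borel_measurable random_tape"
proof -
  have "(\<lambda>t. t i) \<in> random_tape \<rightarrow>\<^sub>M uniform_measure lborel {0..1}"
    unfolding random_tape_def by (rule measurable_component_singleton) simp
  then show ?thesis
    by (simp cong: measurable_cong_sets)
qed

lemma measurable_address [measurable]: "address \<in> borel \<rightarrow>\<^sub>M count_space UNIV"
  unfolding address_def by measurable

text \<open>A lookup whose location depends on the tape, be it a memory cell or the next tape entry,
  is a measurable choice among countably many measurable functions.\<close>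

lemma mcfg_exec:
  assumes "mcfg f"
  shows "mcfg (\<lambda>t. exec t i (f t))"
proof -
  have [measurable]: "(\<lambda>t. pc (f t)) \<in> random_tape \<rightarrow>\<^sub>M count_space UNIV"
    "\<And>i. (\<lambda>t. reg (f t) i) \<in> borel_measurable random_tape"
    "\<And>i. (\<lambda>t. mem (f t) i) \<in> borel_measurable random_tape"
    "(\<lambda>t. drawn (f t)) \<in> random_tape \<rightarrow>\<^sub>M count_space UNIV"
    using assms by (auto simp: mcfg_def)
  have [measurable]: "(\<lambda>t. t (drawn (f t))) \<in> borel_measurable random_tape"
    by (rule measurable_compose_countable) measurable
  have [measurable]: "(\<lambda>t. mem (f t) (address (reg (f t) j))) \<in> borel_measurable random_tape" for j
    by (rule measurable_compose_countable[where f = "\<lambda>a t. mem (f t) a"]) measurable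
  show ?thesis
    by (cases i) (auto simp: mcfg_def set_reg_def fun_upd_def space_random_tape)
qed

lemma mcfg_run: "mcfg (\<lambda>t. run P inp t k)"
proof (induction k)
  case 0
  then show ?case by (simp add: run_def mcfg_def)
next
  case (Suc k)
  let ?f = "\<lambda>t. run P inp t k"
  have [measurable]: "(\<lambda>t. pc (?f t)) \<in> random_tape \<rightarrow>\<^sub>M count_space UNIV"
    using Suc by (auto simp: mcfg_def)
  define g where "g p t = (if length P \<le> p then ?f t else exec t (P ! p) (?f t))" for p t
  have g: "mcfg (g p)" for p
    using Suc mcfg_exec[OF Suc] by (cases "length P \<le> p") (simp_all add: g_def[abs_def])
  have *: "run P inp t (Suc k) = g (pc (?f t)) t" for t
    by (simp add: run_def g_def step_def halted_def)
  have c: "(\<lambda>t. h (g (pc (?f t)) t)) \<in> random_tape \<rightarrow>\<^sub>M N"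
    if "\<And>p. (\<lambda>t. h (g p t)) \<in> random_tape \<rightarrow>\<^sub>M N" for N and h :: "config \<Rightarrow> 'b"
    by (rule measurable_compose_countable[where f = "\<lambda>p t. h (g p t)"]) (use that in measurable)
  show ?case
    unfolding * mcfg_def
    by (intro conjI allI c) (use g in \<open>simp_all add: mcfg_def\<close>)
qed

lemma measurable_halted [measurable]: "Measurable.pred random_tape (\<lambda>t. halted P (run P inp t k))"
proof -
  have "(\<lambda>t. pc (run P inp t k)) \<in> random_tape \<rightarrow>\<^sub>M count_space UNIV"
    using mcfg_run[of P inp k] by (simp add: mcfg_def)
  then show ?thesis
    unfolding halted_def by (rule measurable_compose) simp
qed

lemma measurable_running_time [measurable]: "running_time P inp \<in> borel_measurable random_tape"
proof -
  \<comment> \<open>The index set of the infimum depends on the tape. With the value infinity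
    outside of it, the infimum becomes a countable one of measurable functions.\<close>
  have "running_time P inp = (\<lambda>t. INF k. if halted P (run P inp t k) then of_nat k else \<infinity>)"
  proof
    fix t
    show "running_time P inp t = (INF k. if halted P (run P inp t k) then of_nat k else \<infinity>)"
      unfolding running_time_def
    proof (intro antisym INF_greatest)
      fix k
      show "(INF k\<in>{k. halted P (run P inp t k)}. of_nat k) \<le>
          (if halted P (run P inp t k) then of_nat k else (\<infinity> :: ennreal))"
        by (cases "halted P (run P inp t k)") (simp_all add: INF_lower)
    next
      fix k assume "k \<in> {k. halted P (run P inp t k)}"
      then show "(INF k. if halted P (run P inp t k) then of_nat k else \<infinity>) \<le> (of_nat k :: ennreal)"
        by (intro INF_lower2[of k]) auto
    qed
  qed
  also have "\<dots> \<in> borel_measurable random_tape"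
    by measurable
  finally show ?thesis .
qed

text \<open>The decoded partition depends only on which of finitely many pairs of labels
  coincide.\<close>

lemma measurable_decode_partition:
  assumes [measurable]: "\<And>a. (\<lambda>t. f t a) \<in> borel_measurable M"
  shows "(\<lambda>t. decode_partition n (f t)) \<in> M \<rightarrow>\<^sub>M count_space UNIV"
proof -
  define S where "S t = {p \<in> {..<n} \<times> {..<n}. f t (fst p) = f t (snd p)}" for t
  define g where "g T = (\<lambda>v. {u \<in> {..<n}. (u, v) \<in> T}) ` {..<n}" for T :: "(nat \<times> nat) set"
  have eq: "decode_partition n (f t) = g (S t)" for t
    unfolding decode_partition_def g_def S_def by (intro image_cong) auto
  have "S \<in> M \<rightarrow>\<^sub>M count_space (Pow ({..<n} \<times> {..<n}))"
  proof (subst measurable_count_space_eq_countable)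
    have "S -` {T} \<inter> space M \<in> sets M" if "T \<subseteq> {..<n} \<times> {..<n}" for T
    proof -
      have "S -` {T} \<inter> space M =
          {t \<in> space M. \<forall>p\<in>{..<n} \<times> {..<n}. (f t (fst p) = f t (snd p)) = (p \<in> T)}"
        using that unfolding S_def vimage_def by blast
      also have "\<dots> \<in> sets M"
        by measurable
      finally show ?thesis .
    qed
    then show "S \<in> space M \<rightarrow> Pow ({..<n} \<times> {..<n}) \<and>
        (\<forall>T\<in>Pow ({..<n} \<times> {..<n}). S -` {T} \<inter> space M \<in> sets M)"
      by (auto simp: S_def)
  qed (simp add: countable_finite)
  then have "(\<lambda>t. g (S t)) \<in> M \<rightarrow>\<^sub>M count_space UNIV"
    by (rule measurable_compose) simp
  then show ?thesis
    by (simp add: eq)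
qed

lemma measurable_final_memory:
  "(\<lambda>t. map_option (decode_partition n) (final_memory P inp t)) \<in> random_tape \<rightarrow>\<^sub>M count_space UNIV"
proof -
  let ?h = "\<lambda>t. LEAST k. halted P (run P inp t k)"
  have [measurable]: "(\<lambda>t. decode_partition n (mem (run P inp t k))) \<in> random_tape \<rightarrow>\<^sub>M count_space UNIV"
    for k
    using mcfg_run[of P inp k] by (intro measurable_decode_partition) (auto simp: mcfg_def)
  have [measurable]: "(\<lambda>t. decode_partition n (mem (run P inp t (?h t)))) \<in> random_tape \<rightarrow>\<^sub>M count_space UNIV"
    by (rule measurable_compose_countable[where g = ?h]) measurable
  have [measurable]: "(\<lambda>t. Some (decode_partition n (mem (run P inp t (?h t))))) \<in> random_tape \<rightarrow>\<^sub>M count_space UNIV"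
    by (rule measurable_compose[of _ _ "count_space UNIV"]) measurable
  have "(\<lambda>t. map_option (decode_partition n) (final_memory P inp t)) =
    (\<lambda>t. if \<exists>k. halted P (run P inp t k) then Some (decode_partition n (mem (run P inp t (?h t)))) else None)"
    by (auto simp: final_memory_def)
  then show ?thesis
    by simp
qed

section \<open>The random permutation\<close>

fun shuffled :: "(nat \<Rightarrow> nat) \<Rightarrow> nat \<Rightarrow> nat list" where
  "shuffled f 0 = []"
| "shuffled f (Suc i) =
     (let ys = shuffled f i @ [i] in ys[i := ys ! f i, f i := i])"

lemma length_shuffled [simp]: "length (shuffled f n) = n"
  by (induction n) (auto simp: Let_def)

lemma shuffled_cong: "(\<And>i. i < n \<Longrightarrow> f i = g i) \<Longrightarrow> shuffled f n = shuffled g n"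
  by (induction n) (auto simp: Let_def)

lemma mset_swap_last:
  assumes "j \<le> length xs"
  shows "mset ((xs @ [x])[length xs := (xs @ [x]) ! j, j := x]) = mset (xs @ [x])"
proof -
  have "(xs @ [x])[length xs := (xs @ [x]) ! j, j := (xs @ [x]) ! length xs] =
      (xs @ [x])[length xs := (xs @ [x]) ! j, j := x]"
    by simp
  then show ?thesis
    using mset_swap[of j "xs @ [x]" "length xs"] assms by simp
qed

lemma mset_shuffled:
  assumes "\<And>i. i < n \<Longrightarrow> f i \<le> i"
  shows "mset (shuffled f n) = mset [0..<n]"
  using assms
proof (induction n)
  case (Suc n)
  then show ?case
    using mset_swap_last[of "f n" "shuffled f n" n] by (simp add: Let_def)
qed simp

lemma shuffled_in_permutations:
  assumes "\<And>i. i < n \<Longrightarrow> f i \<le> i"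
  shows "shuffled f n \<in> permutations_of_set {..<n}"
proof -
  have "mset (shuffled f n) = mset [0..<n]"
    using assms by (rule mset_shuffled)
  then have "set (shuffled f n) = set [0..<n]" "distinct (shuffled f n)"
    using mset_eq_setD mset_eq_imp_distinct_iff by (blast, metis distinct_upt)
  then show ?thesis
    by (simp add: permutations_of_set_def atLeast0LessThan)
qed

text \<open>The last step can be undone: the largest entry sits exactly at position
  \<open>f n\<close>, and putting the last entry back there restores the previous list.\<close>

lemma shuffled_inj:
  assumes "\<And>i. i < n \<Longrightarrow> f i \<le> i" "\<And>i. i < n \<Longrightarrow> g i \<le> i" "shuffled f n = shuffled g n" "i < n"
  shows "f i = g i"
  using assms
proof (induction n)
  case (Suc n)
  define xs where "xs = shuffled f n"
  define ys where "ys = shuffled g n"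
  have f: "f n \<le> n" and g: "g n \<le> n"
    using Suc.prems by auto
  have mem: "n \<notin> set xs" "n \<notin> set ys"
    using shuffled_in_permutations[of n f] shuffled_in_permutations[of n g] Suc.prems
    by (auto simp: xs_def ys_def permutations_of_set_def)
  have len: "length xs = n" "length ys = n"
    by (simp_all add: xs_def ys_def)
  define zs where "zs = shuffled f (Suc n)"
  have zf: "zs = (xs @ [n])[n := (xs @ [n]) ! f n, f n := n]"
    and zg: "zs = (ys @ [n])[n := (ys @ [n]) ! g n, g n := n]"
    using Suc.prems(3) by (simp_all add: zs_def xs_def ys_def Let_def)
  have nthf: "zs ! k = (if k = f n then n else if k = n then (xs @ [n]) ! f n else xs ! k)" if "k \<le> n" for k
    unfolding zf using that f len by (auto simp: nth_list_update nth_append)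
  have nthg: "zs ! k = (if k = g n then n else if k = n then (ys @ [n]) ! g n else ys ! k)" if "k \<le> n" for k
    unfolding zg using that g len by (auto simp: nth_list_update nth_append)
  have eq: "f n = g n"
  proof (rule ccontr)
    assume ne: "f n \<noteq> g n"
    have "zs ! f n = n" using nthf[of "f n"] f by simp
    moreover have "zs ! f n \<noteq> n" if "f n < n"
      using nthg[of "f n"] that ne mem len by (auto simp: in_set_conv_nth)
    moreover have "zs ! f n \<noteq> n" if "f n = n" "g n < n"
      using nthg[of "f n"] that ne mem len by (auto simp: in_set_conv_nth nth_append)
    ultimately show False
      using f g ne by linarith
  qed
  have "xs = ys"
  proof (rule nth_equalityI)
    fix k assume k: "k < length xs"
    show "xs ! k = ys ! k"
    proof (cases "k = f n")
      case True
      then show ?thesis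
        using nthf[of n] nthg[of n] eq k len by (auto simp: nth_append split: if_splits)
    next
      case False
      then show ?thesis
        using nthf[of k] nthg[of k] eq k len by auto
    qed
  qed (simp add: len)
  then show ?case
    using Suc.IH Suc.prems eq by (cases "i = n") (auto simp: xs_def ys_def)
qed simp

definition digits :: "nat \<Rightarrow> (nat \<Rightarrow> nat) set" where
  "digits n = (\<Pi>\<^sub>E i\<in>{..<n}. {..i})"

lemma card_digits: "card (digits n) = fact n"
proof -
  have "card (digits n) = (\<Prod>i<n. Suc i)"
    by (simp add: digits_def card_PiE)
  then show ?thesis
    by (simp add: fact_prod_Suc atLeast0LessThan)
qed

text \<open>Injectivity together with the count n! on both sides gives surjectivity.\<close>

lemma bij_shuffled: "bij_betw (\<lambda>f. shuffled f n) (digits n) (permutations_of_set {..<n})"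
proof -
  have inj: "inj_on (\<lambda>f. shuffled f n) (digits n)"
  proof (rule inj_onI)
    fix f g assume fg: "f \<in> digits n" "g \<in> digits n" "shuffled f n = shuffled g n"
    then have "f i = g i" if "i < n" for i
      using shuffled_inj[of n f g i] that by (force simp: digits_def PiE_iff)
    with fg show "f = g"
      by (intro PiE_ext[of f "{..<n}" _ g]) (auto simp: digits_def)
  qed
  have "(\<lambda>f. shuffled f n) ` digits n \<subseteq> permutations_of_set {..<n}"
    by (auto simp: digits_def PiE_iff intro!: shuffled_in_permutations)
  moreover have "card ((\<lambda>f. shuffled f n) ` digits n) = card (permutations_of_set {..<n})"
    using card_image[OF inj] by (simp add: card_digits)
  ultimately have "(\<lambda>f. shuffled f n) ` digits n = permutations_of_set {..<n}"
    by (intro card_subset_eq) auto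
  with inj show ?thesis
    by (simp add: bij_betw_def)
qed

section \<open>The joint law of permutation and radius\<close>

definition digit :: "(nat \<Rightarrow> real) \<Rightarrow> nat \<Rightarrow> nat" where
  "digit t i = nat \<lfloor>t i * real (i + 1)\<rfloor>"

lemma digit_le: "0 \<le> t i \<Longrightarrow> t i < 1 \<Longrightarrow> digit t i \<le> i"
proof -
  assume t: "0 \<le> t i" "t i < 1"
  then have "t i * real (i + 1) < 1 * real (i + 1)"
    by (intro mult_strict_right_mono) auto
  then have "\<lfloor>t i * real (i + 1)\<rfloor> < int (i + 1)"
    by (subst floor_less_iff) simp
  then show ?thesis
    by (auto simp: digit_def)
qed

abbreviation unit :: "real measure" where
  "unit \<equiv> uniform_measure lborel {0..1}"

lemma prob_space_unit: "prob_space unit"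
  by (intro prob_space_uniform_measure) auto

lemma emeasure_unit:
  assumes "B \<in> sets borel"
  shows "emeasure unit B = emeasure lborel ({0..1} \<inter> B)"
  using assms by (simp add: divide_ennreal_def)

interpretation tape: product_prob_space "\<lambda>_. unit" "UNIV :: nat set"
  by (simp add: product_prob_space_def product_prob_space_axioms_def product_sigma_finite_def
    prob_space_unit prob_space_imp_sigma_finite)

lemma prob_space_random_tape: "prob_space random_tape"
  unfolding random_tape_def by (rule tape.P.prob_space_axioms)

lemma AE_unit: "AE x in unit. 0 \<le> x \<and> x < 1"
proof -
  have "emeasure unit {1} = 0"
    by (simp add: emeasure_unit)
  then have "AE x in unit. x \<notin> {1}"
    by (intro AE_not_in) (auto simp: null_sets_def)
  moreover have "AE x in unit. x \<in> {0..1}"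
    by (rule AE_uniform_measureI) auto
  ultimately show ?thesis
    by eventually_elim auto
qed

lemma AE_tape: "AE t in random_tape. \<forall>i. 0 \<le> t i \<and> t i < 1"
proof -
  have "AE t in random_tape. 0 \<le> t i \<and> t i < 1" for i
    unfolding random_tape_def
    by (rule tape.AE_component[of i "\<lambda>x. 0 \<le> x \<and> x < 1"]) (use AE_unit in auto)
  then show ?thesis
    by (subst AE_all_countable) blast
qed

lemma nat_floor_eq_iff:
  assumes "0 \<le> x"
  shows "nat \<lfloor>x\<rfloor> = k \<longleftrightarrow> real k \<le> x \<and> x < real k + 1"
  using assms by (auto simp: floor_eq_iff nat_eq_iff)

lemma emeasure_digit_interval:
  assumes "k \<le> i"
  shows "emeasure unit {real k / real (i + 1) ..< (real k + 1) / real (i + 1)} = ennreal (1 / real (i + 1))"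
proof -
  have "(real k + 1) / real (i + 1) \<le> 1" "0 \<le> real k / real (i + 1)"
    using assms by simp_all
  then have "{0..1} \<inter> {real k / real (i + 1) ..< (real k + 1) / real (i + 1)} =
      {real k / real (i + 1) ..< (real k + 1) / real (i + 1)}"
    unfolding set_eq_iff Int_iff atLeastLessThan_iff atLeastAtMost_iff by linarith
  then show ?thesis
    by (subst emeasure_unit)
      (auto simp: divide_right_mono diff_divide_distrib[symmetric] simp del: of_nat_Suc)
qed

text \<open>The event is a box, with intervals for the first n tape entries and \<open>B\<close> for
  the next one. Carrying \<open>B\<close> along yields independence of the radius. The condition
  \<open>0 <= t i\<close> matters because \<open>digit\<close> also sends negative entries to
  0.\<close>

lemma emeasure_digits:
  assumes f: "f \<in> digits n" and B: "B \<in> sets borel"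
  shows "emeasure random_tape {t. (\<forall>i<n. 0 \<le> t i \<and> digit t i = f i) \<and> t n \<in> B} =
    ennreal (1 / fact n) * emeasure unit B"
proof -
  define A where "A i = (if i < n then {real (f i) / real (i + 1) ..< (real (f i) + 1) / real (i + 1)}
    else B)" for i
  have A: "t i \<in> A i \<longleftrightarrow> 0 \<le> t i \<and> digit t i = f i" if "i < n" for t i
  proof -
    have "t i \<in> A i \<Longrightarrow> 0 \<le> t i"
      using that by (auto simp: A_def elim: order_trans[rotated])
    then show ?thesis
      using that nat_floor_eq_iff[of "t i * real (i + 1)" "f i"]
      by (auto simp: A_def digit_def field_simps)
  qed
  have "{t. (\<forall>i<n. 0 \<le> t i \<and> digit t i = f i) \<and> t n \<in> B} = {t. \<forall>i\<in>{..n}. t i \<in> A i}"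
    using A by (auto simp: A_def le_less)
  also have "\<dots> = prod_emb UNIV (\<lambda>_. unit) {..n} (Pi\<^sub>E {..n} A)"
    by (auto simp: prod_emb_def PiE_iff)
  also have "emeasure random_tape \<dots> = (\<Prod>i\<in>{..n}. emeasure unit (A i))"
    unfolding random_tape_def using B by (intro tape.emeasure_PiM_emb) (auto simp: A_def)
  also have "\<dots> = (\<Prod>i<n. emeasure unit (A i)) * emeasure unit B"
    by (simp add: A_def lessThan_Suc_atMost[symmetric])
  also have "(\<Prod>i<n. emeasure unit (A i)) = (\<Prod>i<n. ennreal (1 / real (i + 1)))"
  proof (intro prod.cong refl)
    fix i assume "i \<in> {..<n}"
    then show "emeasure unit (A i) = ennreal (1 / real (i + 1))"
      using f emeasure_digit_interval[of "f i" i] by (simp only: A_def) (auto simp: digits_def PiE_iff)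
  qed
  also have "\<dots> = ennreal (1 / fact n)"
    by (subst prod_ennreal)
      (auto simp: fact_prod_Suc atLeast0LessThan prod_inversef[symmetric] divide_inverse)
  finally show ?thesis .
qed

text \<open>The minimum only matters on a null set, where a tape entry lies outside \<open>[0, 1)\<close>.\<close>

definition tape_perm :: "nat \<Rightarrow> (nat \<Rightarrow> real) \<Rightarrow> nat list" where
  "tape_perm n t = shuffled (\<lambda>i. min i (digit t i)) n"

lemma tape_perm_in: "tape_perm n t \<in> permutations_of_set {..<n}"
  unfolding tape_perm_def by (intro shuffled_in_permutations) simp

lemma measurable_digit [measurable]: "(\<lambda>t. digit t i) \<in> random_tape \<rightarrow>\<^sub>M count_space UNIV"
  unfolding digit_def by measurable

lemma tape_perm_iff:
  assumes "f \<in> digits n"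
  shows "tape_perm n t = shuffled f n \<longleftrightarrow> (\<forall>i<n. min i (digit t i) = f i)"
proof
  assume "tape_perm n t = shuffled f n"
  then show "\<forall>i<n. min i (digit t i) = f i"
    using assms shuffled_inj[of n "\<lambda>i. min i (digit t i)" f]
    by (auto simp: tape_perm_def digits_def PiE_iff)
qed (auto simp: tape_perm_def intro: shuffled_cong)

lemma tape_perm_preimage:
  assumes "X \<subseteq> permutations_of_set {..<n}"
  shows "{t. tape_perm n t \<in> X} =
    (\<Union>f\<in>{f \<in> digits n. shuffled f n \<in> X}. {t. \<forall>i<n. min i (digit t i) = f i})"
proof -
  have "\<exists>f\<in>digits n. tape_perm n t = shuffled f n" for t
    using bij_shuffled[of n] tape_perm_in[of n t] unfolding bij_betw_def by auto
  then show ?thesis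
    using tape_perm_iff by auto (metis (mono_tags, lifting))+
qed

lemma finite_digits: "finite (digits n)"
  by (simp add: digits_def finite_PiE)

lemma measurable_tape_perm [measurable]:
  "tape_perm n \<in> random_tape \<rightarrow>\<^sub>M count_space (permutations_of_set {..<n})"
proof (subst measurable_count_space_eq_countable)
  have "tape_perm n -` {x} \<inter> space random_tape \<in> sets random_tape" if "x \<in> permutations_of_set {..<n}" for x
  proof -
    have "tape_perm n -` {x} \<inter> space random_tape = (\<Union>f\<in>{f \<in> digits n. shuffled f n \<in> {x}}.
        {t \<in> space random_tape. \<forall>i<n. min i (digit t i) = f i})"
      using tape_perm_preimage[of "{x}" n] that by (auto simp: space_random_tape)
    also have "\<dots> \<in> sets random_tape"
      using finite_digits by (intro sets.finite_UN) (auto, measurable)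
    finally show ?thesis .
  qed
  then show "tape_perm n \<in> space random_tape \<rightarrow> permutations_of_set {..<n} \<and>
     (\<forall>a\<in>permutations_of_set {..<n}. tape_perm n -` {a} \<inter> space random_tape \<in> sets random_tape)"
    using tape_perm_in by auto
qed (simp add: countable_finite)

lemma emeasure_tape_perm:
  assumes X: "X \<subseteq> permutations_of_set {..<n}" and B[measurable]: "B \<in> sets borel"
  shows "emeasure random_tape {t. tape_perm n t \<in> X \<and> t n \<in> B} =
    ennreal (card X / fact n) * emeasure unit B"
proof -
  define F where "F = {f \<in> digits n. shuffled f n \<in> X}"
  define G where "G f = {t. (\<forall>i<n. 0 \<le> t i \<and> digit t i = f i) \<and> t n \<in> B}" for f
  have fin: "finite F"
    using finite_digits by (simp add: F_def)
  have G: "G f \<in> sets random_tape" for f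
  proof -
    have "G f = {t \<in> space random_tape. (\<forall>i<n. 0 \<le> t i \<and> digit t i = f i) \<and> t n \<in> B}"
      by (simp add: G_def space_random_tape)
    also have "\<dots> \<in> sets random_tape" by measurable
    finally show ?thesis .
  qed
  have "{t. tape_perm n t \<in> X \<and> t n \<in> B} = {t \<in> space random_tape. tape_perm n t \<in> X \<and> t n \<in> B}"
    by (simp add: space_random_tape)
  also have "\<dots> = {t \<in> space random_tape. t n \<in> B} \<inter> (tape_perm n -` X \<inter> space random_tape)"
    by auto
  also have "\<dots> \<in> sets random_tape"
    using X by (intro sets.Int measurable_sets[OF measurable_tape_perm]) (auto, measurable)
  finally have S: "{t. tape_perm n t \<in> X \<and> t n \<in> B} \<in> sets random_tape" .
  \<comment> \<open>Off a null set all entries lie in [0, 1), where the \<open>min\<close> in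
    \<open>tape_perm\<close> and the sign conditions in \<open>G\<close> have no effect.\<close>
  have "emeasure random_tape {t. tape_perm n t \<in> X \<and> t n \<in> B} = emeasure random_tape (\<Union>f\<in>F. G f)"
  proof (rule emeasure_eq_AE)
    show "AE t in random_tape. (t \<in> {t. tape_perm n t \<in> X \<and> t n \<in> B}) = (t \<in> (\<Union>f\<in>F. G f))"
      using AE_tape
    proof eventually_elim
      fix t :: "nat \<Rightarrow> real" assume t: "\<forall>i. 0 \<le> t i \<and> t i < 1"
      then have "digit t i \<le> i" for i
        by (simp add: digit_le)
      then have "min i (digit t i) = digit t i" for i
        by (simp add: min_absorb2)
      then show "(t \<in> {t. tape_perm n t \<in> X \<and> t n \<in> B}) = (t \<in> (\<Union>f\<in>F. G f))"
        using tape_perm_preimage[OF X] t by (auto simp: F_def G_def set_eq_iff)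
    qed
  qed (use S G fin in auto)
  also have "\<dots> = (\<Sum>f\<in>F. emeasure random_tape (G f))"
  proof (rule sum_emeasure[symmetric])
    show "disjoint_family_on G F"
      unfolding disjoint_family_on_def
    proof (intro ballI impI)
      fix f g assume fg: "f \<in> F" "g \<in> F" "f \<noteq> g"
      then obtain i where "i < n" "f i \<noteq> g i"
        using PiE_ext[of f "{..<n}" atMost g] by (auto simp: F_def digits_def)
      then show "G f \<inter> G g = {}"
        by (auto simp: G_def)
    qed
  qed (use G fin in auto)
  also have "\<dots> = (\<Sum>f\<in>F. ennreal (1 / fact n) * emeasure unit B)"
    unfolding G_def using B by (intro sum.cong refl emeasure_digits) (auto simp: F_def)
  also have "\<dots> = of_nat (card F) * (ennreal (1 / fact n) * emeasure unit B)"
    by simp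
  also have "card F = card X"
  proof -
    have "bij_betw (\<lambda>f. shuffled f n) F X"
      using bij_shuffled[of n] X unfolding bij_betw_def F_def by (auto simp: inj_on_def)
    then show ?thesis
      by (rule bij_betw_same_card)
  qed
  finally show ?thesis
    by (simp add: mult.assoc[symmetric] ennreal_of_nat_eq_real_of_nat ennreal_mult'[symmetric])
qed

text \<open>Independence in the form needed for the running time: the cost of a trial is a function
  of the permutation, while tape entry n decides whether the trial can take place.\<close>

lemma nn_integral_tape_perm:
  fixes f :: "nat list \<Rightarrow> ennreal"
  assumes B[measurable]: "B \<in> sets borel"
  shows "(\<integral>\<^sup>+t. f (tape_perm n t) * indicator B (t n) \<partial>random_tape) =
    (\<Sum>\<sigma>\<in>permutations_of_set {..<n}. f \<sigma>) * ennreal (1 / fact n) * emeasure unit B"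
proof -
  let ?P = "permutations_of_set {..<n}"
  have S: "{t. tape_perm n t = \<sigma> \<and> t n \<in> B} \<in> sets random_tape" if "\<sigma> \<in> ?P" for \<sigma>
  proof -
    have "{t. tape_perm n t = \<sigma> \<and> t n \<in> B} =
        {t \<in> space random_tape. t n \<in> B} \<inter> (tape_perm n -` {\<sigma>} \<inter> space random_tape)"
      by (auto simp: space_random_tape)
    also have "\<dots> \<in> sets random_tape"
      using that by (intro sets.Int measurable_sets[OF measurable_tape_perm]) (auto, measurable)
    finally show ?thesis .
  qed
  have eq: "f (tape_perm n t) * indicator B (t n) =
      (\<Sum>\<sigma>\<in>?P. f \<sigma> * indicator {t. tape_perm n t = \<sigma> \<and> t n \<in> B} t)" for t
  proof -
    have "(\<Sum>\<sigma>\<in>?P. f \<sigma> * indicator {t. tape_perm n t = \<sigma> \<and> t n \<in> B} t) =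
        (\<Sum>\<sigma>\<in>?P. if \<sigma> = tape_perm n t then f \<sigma> * indicator B (t n) else 0)"
      by (intro sum.cong refl) (auto simp: indicator_def)
    then show ?thesis
      using tape_perm_in[of n t] by simp
  qed
  have "(\<integral>\<^sup>+t. f (tape_perm n t) * indicator B (t n) \<partial>random_tape) =
      (\<Sum>\<sigma>\<in>?P. f \<sigma> * emeasure random_tape {t. tape_perm n t = \<sigma> \<and> t n \<in> B})"
    unfolding eq using S by (subst nn_integral_sum) (auto simp: nn_integral_cmult_indicator intro!: borel_measurable_times_ennreal)
  also have "\<dots> = (\<Sum>\<sigma>\<in>?P. f \<sigma> * (ennreal (1 / fact n) * emeasure unit B))"
    using emeasure_tape_perm[of "{_}" n B] by (intro sum.cong refl) auto
  finally show ?thesis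
    by (simp add: sum_distrib_right mult.assoc)
qed

text \<open>Used with a = \<Delta> / 4, when the target interval is the range of the CKR
  radius.\<close>

lemma emeasure_unit_affine:
  assumes a: "0 < a" and B[measurable]: "B \<in> sets borel"
  shows "emeasure unit {u. a * (1 + u) \<in> B} = emeasure (uniform_measure lborel {a..2 * a}) B"
proof -
  have [measurable]: "{u. a * (1 + u) \<in> B} \<in> sets borel"
    by measurable
  have "emeasure lborel ({a..2 * a} \<inter> B) =
      emeasure (density (distr lborel borel (\<lambda>x. a + a * x)) (\<lambda>_. ennreal \<bar>a\<bar>)) ({a..2 * a} \<inter> B)"
    using lborel_real_affine[of a a] a by simp
  also have "\<dots> = ennreal a * emeasure lborel ((\<lambda>x. a + a * x) -` ({a..2 * a} \<inter> B))"
    using a by (subst emeasure_density_const) (auto simp: emeasure_distr)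
  also have "(\<lambda>x. a + a * x) -` ({a..2 * a} \<inter> B) = {0..1} \<inter> {u. a * (1 + u) \<in> B}"
    using a zero_le_mult_iff[of a] by (auto simp: algebra_simps)
  finally have *: "emeasure lborel ({a..2 * a} \<inter> B) =
      ennreal a * emeasure lborel ({0..1} \<inter> {u. a * (1 + u) \<in> B})" .
  have "emeasure (uniform_measure lborel {a..2 * a}) B =
      emeasure lborel ({a..2 * a} \<inter> B) / ennreal a"
    using a by simp
  also have "\<dots> = emeasure lborel ({0..1} \<inter> {u. a * (1 + u) \<in> B})"
    unfolding * using a by (subst mult.commute) (simp add: ennreal_mult_divide_eq)
  finally show ?thesis
    by (subst emeasure_unit) auto
qed

text \<open>A product measure is determined by its values on rectangles, and
  \<open>emeasure_tape_perm\<close> supplies these for the shuffled permutation and the rescaled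
  tape entry. The random partition thereby becomes an explicit function of the tape.\<close>

lemma ckr_partition_tape:
  assumes "0 < \<Delta>"
  shows "ckr_partition \<Delta> {..<n} \<rho> = distr random_tape (count_space UNIV)
    (\<lambda>t. ckr_clusters {..<n} \<rho> (\<Delta> / 4 * (1 + t n)) (tape_perm n t))"
proof -
  let ?A = "uniform_count_measure (permutations_of_set {..<n})"
  let ?B = "uniform_measure lborel {\<Delta> / 4 .. \<Delta> / 2}"
  let ?h = "\<lambda>t. (tape_perm n t, \<Delta> / 4 * (1 + t n))"
  have sets: "sets (?A \<Otimes>\<^sub>M ?B) = sets (count_space (permutations_of_set {..<n}) \<Otimes>\<^sub>M borel)"
    by (intro sets_pair_measure_cong) (simp_all add: sets_uniform_count_measure)
  have h: "?h \<in> random_tape \<rightarrow>\<^sub>M ?A \<Otimes>\<^sub>M ?B"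
    unfolding measurable_cong_sets[OF refl sets] by measurable
  have "?A \<Otimes>\<^sub>M ?B = distr random_tape (?A \<Otimes>\<^sub>M ?B) ?h"
  proof (rule pair_measure_eqI)
    show "sigma_finite_measure ?A" "sigma_finite_measure ?B"
      using assms by (auto intro!: prob_space_imp_sigma_finite prob_space_uniform_count_measure
          prob_space_uniform_measure)
    fix X Y assume XY: "X \<in> sets ?A" "Y \<in> sets ?B"
    then have X: "X \<subseteq> permutations_of_set {..<n}" and Y: "Y \<in> sets borel"
      by (auto simp: sets_uniform_count_measure)
    have "emeasure (distr random_tape (?A \<Otimes>\<^sub>M ?B) ?h) (X \<times> Y) =
        emeasure random_tape {t. tape_perm n t \<in> X \<and> t n \<in> {u. \<Delta> / 4 * (1 + u) \<in> Y}}"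
      using XY h by (subst emeasure_distr) (auto simp: space_random_tape intro!: arg_cong[where f = "emeasure _"])
    also have "\<dots> = ennreal (card X / fact n) * emeasure unit {u. \<Delta> / 4 * (1 + u) \<in> Y}"
    proof (rule emeasure_tape_perm[OF X])
      have "(\<lambda>u. \<Delta> / 4 * (1 + u)) -` Y \<inter> space borel \<in> sets borel"
        by (rule measurable_sets[OF _ Y]) measurable
      then show "{u. \<Delta> / 4 * (1 + u) \<in> Y} \<in> sets borel"
        by (simp add: vimage_def)
    qed
    also have "emeasure unit {u. \<Delta> / 4 * (1 + u) \<in> Y} = emeasure ?B Y"
      using emeasure_unit_affine[of "\<Delta> / 4" Y] assms Y by simp
    also have "ennreal (card X / fact n) = emeasure ?A X"
      using X by (subst emeasure_uniform_count_measure) auto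
    finally show "emeasure ?A X * emeasure ?B Y = emeasure (distr random_tape (?A \<Otimes>\<^sub>M ?B) ?h) (X \<times> Y)"
      by simp
  qed simp
  then have "ckr_partition \<Delta> {..<n} \<rho> = distr (distr random_tape (?A \<Otimes>\<^sub>M ?B) ?h)
      (count_space UNIV) (\<lambda>(xs, R). ckr_clusters {..<n} \<rho> R xs)"
    unfolding ckr_partition_def by simp
  also have "\<dots> = distr random_tape (count_space UNIV)
      (\<lambda>t. ckr_clusters {..<n} \<rho> (\<Delta> / 4 * (1 + t n)) (tape_perm n t))"
    using h measurable_ckr_clusters[of "{..<n}" \<rho>]
    by (subst distr_distr) (auto simp: comp_def measurable_cong_sets[OF sets refl])
  finally show ?thesis .
qed

section \<open>Integer approximation of the shortest-path metric\<close>

text \<open>Floor plus one, as the machine truncates downwards. For a nonnegative weight it exceeds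
  s * w by at most 1. It is always at least 1, which makes keys strictly increase along
  edges.\<close>

definition scaled :: "real \<Rightarrow> real \<Rightarrow> nat" where
  "scaled s w = nat \<lfloor>s * w\<rfloor> + 1"

text \<open>End points and rounded length of a walk from the center \<open>c\<close>. A lower bound
  on the distance is a statement about all lengths \<open>d\<close>, which covers unreachable
  vertices without an infinite value.\<close>

inductive iwalk :: "(nat \<times> real) list list \<Rightarrow> real \<Rightarrow> nat \<Rightarrow> nat \<Rightarrow> nat \<Rightarrow> bool" for adj s c where
  iwalk_refl: "c < length adj \<Longrightarrow> iwalk adj s c c 0"
| iwalk_step: "iwalk adj s c u d \<Longrightarrow> (x, w) \<in> set (adj ! u) \<Longrightarrow> iwalk adj s c x (d + scaled s w)"

lemma adjacency_listsD:
  assumes "weighted_graph n E \<omega>" "adjacency_lists n E \<omega> adj" "u < n" "(x, w) \<in> set (adj ! u)"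
  shows "x < n" "x \<noteq> u" "{x, u} \<in> E" "w = \<omega> {x, u}" "0 < w"
proof -
  show *: "{x, u} \<in> E" "w = \<omega> {x, u}"
    using assms by (auto simp: adjacency_lists_def)
  then show "x < n" "x \<noteq> u" "0 < w"
    using assms(1) by (force simp: weighted_graph_def card_2_iff doubleton_eq_iff)+
qed

lemma iwalk_less:
  assumes "weighted_graph n E \<omega>" "adjacency_lists n E \<omega> adj" "iwalk adj s c v d"
  shows "v < n"
  using assms(3)
proof induction
  case iwalk_refl
  then show ?case using assms(2) by (simp add: adjacency_lists_def)
qed (use adjacency_listsD[OF assms(1,2)] in blast)

lemma iwalk_0: "iwalk adj s c v 0 \<Longrightarrow> v = c"
  by (cases rule: iwalk.cases) (auto simp: scaled_def)

lemma symmetric_digraph_sel: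
  "pverts (symmetric_digraph n E) = {..<n}" "(u, v) \<in> parcs (symmetric_digraph n E) \<longleftrightarrow> {u, v} \<in> E"
  by (simp_all add: symmetric_digraph_def)

text \<open>Since weights are rounded upwards, the real weight of a walk is at most d / s. The walk
  is built in reverse, from \<open>v\<close> to \<open>c\<close>, so that a further step is a
  \<open>Cons\<close>.\<close>

lemma iwalk_imp_metric_le:
  assumes G: "weighted_graph n E \<omega>" "adjacency_lists n E \<omega> adj" and s: "0 < s"
    and w: "iwalk adj s c v d"
  shows "shortest_path_metric n E \<omega> v c \<le> ereal (real d / s)"
proof -
  interpret pair_graph "symmetric_digraph n E"
    by (rule pair_graph_symmetric_digraph[OF G(1)])
  let ?\<omega> = "\<lambda>(u, v). \<omega> {u, v}"
  have "\<exists>p. awalk v p c \<and> awalk_cost ?\<omega> p \<le> real d / s"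
    using w
  proof induction
    case iwalk_refl
    then have "awalk c [] c \<and> awalk_cost ?\<omega> [] \<le> real 0 / s"
      using G by (simp add: awalk_Nil_iff symmetric_digraph_sel adjacency_lists_def)
    then show ?case by blast
  next
    case (iwalk_step u d x w)
    then obtain p where p: "awalk u p c" "awalk_cost ?\<omega> p \<le> real d / s" by blast
    have u: "u < n"
      using iwalk_less[OF G iwalk_step(1)] .
    note e = adjacency_listsD[OF G u iwalk_step(2)]
    have "awalk x ((x, u) # p) c"
      using p e by (simp add: awalk_Cons_iff symmetric_digraph_sel)
    moreover have "w \<le> real (scaled s w) / s"
    proof -
      have "s * w \<le> real (scaled s w)"
        unfolding scaled_def by linarith
      then show ?thesis
        using s by (simp add: field_simps)
    qed
    then have "awalk_cost ?\<omega> ((x, u) # p) \<le> real (d + scaled s w) / s"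
      using p e by (simp add: add_divide_distrib)
    ultimately show ?case by blast
  qed
  then obtain p where p: "awalk v p c" "awalk_cost ?\<omega> p \<le> real d / s" by blast
  then show ?thesis
    unfolding shortest_path_metric_def
    by (intro order_trans[OF min_cost_le_walk_cost[OF p(1)]]) simp
qed

text \<open>For nonnegative weights the infimum is attained by a path without repeated vertices. It
  has at most n edges, each of which gains at most 1 by rounding. This is the origin of the window
  of width n above the radius.\<close>

lemma metric_le_imp_iwalk:
  assumes G: "weighted_graph n E \<omega>" "adjacency_lists n E \<omega> adj" and s: "0 < s"
    and c: "c < n" and le: "shortest_path_metric n E \<omega> v c \<le> ereal R"
  shows "\<exists>d. iwalk adj s c v d \<and> real d \<le> s * R + real n"
proof -
  interpret pair_graph "symmetric_digraph n E"
    by (rule pair_graph_symmetric_digraph[OF G(1)])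
  let ?\<omega> = "\<lambda>(u, v). \<omega> {u, v}"
  have le': "\<mu> ?\<omega> v c \<le> ereal R"
    using le by (simp add: shortest_path_metric_def)
  then have reach: "v \<rightarrow>\<^sup>*\<^bsub>with_proj (symmetric_digraph n E)\<^esub> c"
    using shortest_path_inf[of v c ?\<omega>] by force
  have pos: "0 \<le> ?\<omega> e" if "e \<in> parcs (symmetric_digraph n E)" for e
    using that G(1) by (auto simp: symmetric_digraph_def weighted_graph_def less_imp_le)
  obtain p where p: "apath v p c" "\<mu> ?\<omega> v c = awalk_cost ?\<omega> p"
    using min_cost_awalk[OF reach, of ?\<omega>] pos by blast
  have "length p \<le> n"
    using length_apath[OF p(1)] by (simp add: symmetric_digraph_sel)
  moreover have "awalk_cost ?\<omega> p \<le> R"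
    using p le' by simp
  moreover have "awalk v p c \<Longrightarrow> \<exists>d. iwalk adj s c v d \<and> real d \<le> s * awalk_cost ?\<omega> p + real (length p)"
  proof (induction p arbitrary: v)
    case Nil
    then show ?case
      using c G(2) iwalk_refl[of c adj s] by (force simp: awalk_Nil_iff adjacency_lists_def)
  next
    case (Cons e p)
    obtain u where e: "e = (v, u)" "{v, u} \<in> E" "awalk u p c"
      using Cons.prems by (cases e) (auto simp: awalk_Cons_iff symmetric_digraph_sel)
    from Cons.IH[OF e(3)] obtain d where
      d: "iwalk adj s c u d" "real d \<le> s * awalk_cost ?\<omega> p + real (length p)" by blast
    have "u < n"
      using iwalk_less[OF G d(1)] .
    then have "(v, \<omega> {v, u}) \<in> set (adj ! u)"
      using G(2) e by (auto simp: adjacency_lists_def)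
    then have "iwalk adj s c v (d + scaled s (\<omega> {v, u}))"
      using d by (blast intro: iwalk_step)
    moreover have "real (scaled s (\<omega> {v, u})) \<le> s * \<omega> {v, u} + 1"
    proof -
      have "0 \<le> s * \<omega> {v, u}"
        using s e G(1) by (auto simp: weighted_graph_def less_imp_le)
      then show ?thesis
        unfolding scaled_def by linarith
    qed
    then have "real (d + scaled s (\<omega> {v, u})) \<le> s * awalk_cost ?\<omega> (e # p) + real (length (e # p))"
      using d e by (simp add: algebra_simps)
    ultimately show ?case by blast
  qed
  moreover have "awalk v p c"
    using p by (auto simp: apath_def)
  ultimately obtain d where "iwalk adj s c v d" "real d \<le> s * awalk_cost ?\<omega> p + real n"
    by (meson add_left_mono of_nat_mono order_trans)
  moreover have "s * awalk_cost ?\<omega> p \<le> s * R"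
    using \<open>awalk_cost ?\<omega> p \<le> R\<close> s by simp
  ultimately show ?thesis
    by (intro exI[of _ d]) auto
qed

section \<open>Pruned runs of Dijkstra's algorithm\<close>

locale weighted_input =
  fixes n :: nat and E :: "nat set set" and \<omega> :: "nat set \<Rightarrow> real" and adj :: "(nat \<times> real) list list"
  assumes G: "weighted_graph n E \<omega>" "adjacency_lists n E \<omega> adj"
begin

abbreviation deg :: "nat \<Rightarrow> nat" where "deg u \<equiv> length (adj ! u)"
abbreviation nbr :: "nat \<Rightarrow> nat \<Rightarrow> nat" where "nbr u l \<equiv> fst (adj ! u ! l)"
abbreviation wgt :: "real \<Rightarrow> nat \<Rightarrow> nat \<Rightarrow> nat" where "wgt s u l \<equiv> scaled s (snd (adj ! u ! l))"

lemma nbr_less: "u < n \<Longrightarrow> l < deg u \<Longrightarrow> nbr u l < n"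
  using adjacency_listsD(1)[OF G, of u "nbr u l" "snd (adj ! u ! l)"] by simp

lemma iwalk_nbr: "iwalk adj s c u d \<Longrightarrow> l < deg u \<Longrightarrow> iwalk adj s c (nbr u l) (d + wgt s u l)"
  using iwalk_step[of adj s c u d "nbr u l" "snd (adj ! u ! l)"] by simp

lemma wgt_pos: "0 < wgt s u l"
  by (simp add: scaled_def)

text \<open>Keys encode a distance \<open>d\<close> at a vertex \<open>v\<close> as \<open>n * d + v\<close>.\<close>

definition relaxed :: "real \<Rightarrow> (nat \<Rightarrow> nat) \<Rightarrow> nat \<Rightarrow> nat \<Rightarrow> bool" where
  "relaxed s K u l \<longleftrightarrow> K (nbr u l) + u \<le> K u + n * wgt s u l + nbr u l"

definition consistent :: "real \<Rightarrow> (nat \<Rightarrow> nat) \<Rightarrow> bool" where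
  "consistent s K \<longleftrightarrow> (\<forall>u<n. \<forall>l<deg u. relaxed s K u l)"

text \<open>\<open>Q\<close> is the queue, \<open>F\<close> the set of finished vertices, and the first \<open>j\<close> edges of \<open>v\<close> have
  been relaxed; no vertex is being processed if \<open>v = n\<close>.\<close>

definition dijkstra_inv where
  "dijkstra_inv s K0 c K Q F v j \<longleftrightarrow>
     Q \<subseteq> {..<n} \<and> F \<subseteq> {..<n} \<and> Q \<inter> F = {} \<and>
     (\<forall>u<n. u \<notin> Q \<union> F \<longrightarrow> K u = K0 u) \<and>
     (\<forall>u\<in>Q \<union> F. K u < K0 u \<and> (\<exists>d. iwalk adj s c u d \<and> K u = n * d + u)) \<and>
     (\<forall>u\<in>F. \<forall>x\<in>Q. K u \<le> K x) \<and>
     (v < n \<longrightarrow> v \<in> F \<and> (\<forall>u\<in>F. K u \<le> K v)) \<and>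
     (\<forall>u<n. u \<notin> Q \<longrightarrow> (\<forall>l<(if u = v then j else deg u). relaxed s K u l)) \<and>
     K c \<le> c"

text \<open>The earlier runs leave all edges relaxed, and lowering the key of \<open>c\<close> can
  violate only edges that leave \<open>c\<close>. So a vertex needs to be visited only if its key
  drops, which is why pruning is sound.\<close>

lemma dijkstra_inv_init:
  assumes "c < n" "consistent s K0" "c < K0 c"
  shows "dijkstra_inv s K0 c (K0(c := c)) {c} {} n 0"
proof -
  have "relaxed s (K0(c := c)) u l" if "u < n" "u \<noteq> c" "l < deg u" for u l
  proof -
    have "K0 (nbr u l) + u \<le> K0 u + n * wgt s u l + nbr u l"
      using assms(2) that by (auto simp: consistent_def relaxed_def)
    then show ?thesis
      using assms(3) that by (auto simp: relaxed_def)
  qed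
  moreover
  have "iwalk adj s c c 0"
    using assms(1) G(2) by (intro iwalk_refl) (simp add: adjacency_lists_def)
  then have "\<forall>u\<in>{c} \<union> {}. (K0(c := c)) u < K0 u \<and> (\<exists>d. iwalk adj s c u d \<and> (K0(c := c)) u = n * d + u)"
    using assms(3) by (auto intro!: exI[of _ 0])
  ultimately show ?thesis
    using assms(1) unfolding dijkstra_inv_def by (intro conjI) simp_all
qed

lemma dijkstra_inv_pop:
  assumes "dijkstra_inv s K0 c K Q F n 0" "v \<in> Q" "\<forall>x\<in>Q. K v \<le> K x"
  shows "dijkstra_inv s K0 c K (Q - {v}) (insert v F) v 0"
  using assms unfolding dijkstra_inv_def
  by (intro conjI) (auto simp: subset_eq)

lemma dijkstra_inv_finish:
  assumes "dijkstra_inv s K0 c K Q F v (deg v)" "v < n"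
  shows "dijkstra_inv s K0 c K Q F n 0"
  using assms unfolding dijkstra_inv_def by (auto split: if_splits)

lemma dijkstra_inv_skip:
  assumes "dijkstra_inv s K0 c K Q F v j" "v < n" "relaxed s K v j"
  shows "dijkstra_inv s K0 c K Q F v (Suc j)"
proof -
  have "\<forall>u<n. u \<notin> Q \<longrightarrow> (\<forall>l<(if u = v then j else deg u). relaxed s K u l)"
    using assms(1) unfolding dijkstra_inv_def by (elim conjE)
  then have "\<forall>u<n. u \<notin> Q \<longrightarrow> (\<forall>l<(if u = v then Suc j else deg u). relaxed s K u l)"
    using assms(3) by (simp add: less_Suc_eq)
  then show ?thesis
    using assms(1) unfolding dijkstra_inv_def by (elim conjE) (intro conjI)
qed

lemma dijkstra_inv_ge: "dijkstra_inv s K0 c K Q F v j \<Longrightarrow> u \<in> Q \<union> F \<Longrightarrow> u \<le> K u"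
  unfolding dijkstra_inv_def by (metis le_add2)

text \<open>A rounded weight of at least 1 raises the key by at least n, which outweighs the change
  in its vertex part. Hence \<open>k\<close> exceeds \<open>K v\<close>, the largest key in
  \<open>F\<close>, and a finished vertex is never improved.\<close>

lemma dijkstra_inv_relax:
  assumes inv: "dijkstra_inv s K0 c K Q F v j" and v: "v < n" and j: "j < deg v"
    and nr: "\<not> relaxed s K v j"
  defines "x \<equiv> nbr v j" and "k \<equiv> K v + n * wgt s v j + nbr v j - v"
  shows "dijkstra_inv s K0 c (K(x := k)) (insert x Q) F v (Suc j)" and "x \<notin> F" and "x \<noteq> v"
    and "k < K x" and "x < n"
proof -
  have vF: "v \<in> F" and max: "\<forall>u\<in>F. K u \<le> K v"
    using inv v by (auto simp: dijkstra_inv_def)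
  have vK: "v \<le> K v"
    using dijkstra_inv_ge[OF inv] vF by auto
  show x: "x < n"
    unfolding x_def using v j by (rule nbr_less)
  have less: "k < K x"
    using nr vK by (auto simp: relaxed_def x_def k_def)
  then show "k < K x" .
  have "n \<le> n * wgt s v j"
    using wgt_pos[of s v j] by simp
  then have k: "K v < k"
    using v unfolding k_def by linarith
  show xF: "x \<notin> F"
    using less k max by force
  then show xv: "x \<noteq> v"
    using vF by auto
  obtain d where d: "iwalk adj s c v d" "K v = n * d + v"
    using inv vF unfolding dijkstra_inv_def by blast
  have w: "iwalk adj s c x (d + wgt s v j)" "k = n * (d + wgt s v j) + x"
    using iwalk_nbr[OF d(1) j] d(2) by (auto simp: x_def k_def algebra_simps)
  have K0: "K x \<le> K0 x"
  proof (cases "x \<in> Q \<union> F")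
    case True
    then show ?thesis
      using inv by (auto simp: dijkstra_inv_def less_imp_le)
  next
    case False
    then show ?thesis
      using inv x by (auto simp: dijkstra_inv_def)
  qed
  have rel: "relaxed s (K(x := k)) u l"
    if "u < n" "u \<noteq> x" "u \<notin> Q" "l < (if u = v then Suc j else deg u)" for u l
  proof (cases "u = v \<and> l = j")
    case True
    then show ?thesis
      using vK xv by (simp add: relaxed_def x_def k_def)
  next
    case False
    then have "relaxed s K u l"
      using inv that by (auto simp: dijkstra_inv_def less_Suc_eq split: if_splits)
    then show ?thesis
      using less that by (auto simp: relaxed_def)
  qed
  have "K u \<le> k" if "u \<in> F" for u
    using max that k by (meson less_imp_le order_trans)
  moreover have "(K(x := k)) c \<le> c"
    using inv less by (auto simp: dijkstra_inv_def)
  moreover have "\<forall>u\<in>insert x Q \<union> F. (K(x := k)) u < K0 u \<and> (\<exists>d. iwalk adj s c u d \<and> (K(x := k)) u = n * d + u)"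
    using inv less K0 w unfolding dijkstra_inv_def by (metis Un_iff fun_upd_apply insert_iff order_less_le_trans)
  moreover have "\<forall>u<n. u \<notin> insert x Q \<union> F \<longrightarrow> (K(x := k)) u = K0 u"
    using inv unfolding dijkstra_inv_def by simp
  moreover have "\<forall>u<n. u \<notin> insert x Q \<longrightarrow>
      (\<forall>l<(if u = v then Suc j else deg u). relaxed s (K(x := k)) u l)"
    using rel by blast
  moreover have "Q \<subseteq> {..<n}" "F \<subseteq> {..<n}" "Q \<inter> F = {}" "\<forall>u\<in>F. \<forall>x\<in>Q. K u \<le> K x"
    using inv by (simp_all add: dijkstra_inv_def)
  moreover have "u \<noteq> x" if "u \<in> F" for u
    using that xF by blast
  ultimately show "dijkstra_inv s K0 c (K(x := k)) (insert x Q) F v (Suc j)"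
    using x xF xv vF max unfolding dijkstra_inv_def by (intro conjI) simp_all
qed

lemma consistent_iwalk:
  assumes "consistent s K" "K c \<le> c" "iwalk adj s c v d"
  shows "K v \<le> n * d + v"
  using assms(3)
proof induction
  case iwalk_refl
  then show ?case using assms by simp
next
  case (iwalk_step u d x w)
  then obtain l where l: "l < deg u" "adj ! u ! l = (x, w)"
    by (auto simp: in_set_conv_nth)
  have "relaxed s K u l"
    using assms(1) iwalk_less[OF G iwalk_step(1)] l by (auto simp: consistent_def)
  then show ?case
    using iwalk_step l by (auto simp: relaxed_def algebra_simps)
qed

lemma dijkstra_inv_end:
  assumes inv: "dijkstra_inv s K0 c K {} F n 0"
  shows "consistent s K" and "\<And>v d. iwalk adj s c v d \<Longrightarrow> K v \<le> n * d + v"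
    and "F = {v. v < n \<and> K v < K0 v}"
    and "\<And>v. v < n \<Longrightarrow> v \<notin> F \<Longrightarrow> K v = K0 v"
    and "\<And>v. v \<in> F \<Longrightarrow> \<exists>d. iwalk adj s c v d \<and> K v = n * d + v"
proof -
  show c: "consistent s K"
    using inv by (auto simp: dijkstra_inv_def consistent_def)
  show "\<And>v d. iwalk adj s c v d \<Longrightarrow> K v \<le> n * d + v"
    using consistent_iwalk[OF c] inv by (auto simp: dijkstra_inv_def)
qed (use inv in \<open>auto simp: dijkstra_inv_def\<close>)

text \<open>Says, without naming a distance, that \<open>K v\<close> is the minimum of
  \<open>cap\<close> and of all \<open>n * d + v\<close> for rounded walks from the first
  \<open>i\<close> centers. A key equal to \<open>cap\<close> stands for a vertex not reached so
  far.\<close>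

definition outer_inv where
  "outer_inv s cap \<pi> i K \<longleftrightarrow>
     (\<forall>v<n. K v \<le> cap) \<and> consistent s K \<and>
     (\<forall>j<i. \<forall>v d. iwalk adj s (\<pi> ! j) v d \<longrightarrow> K v \<le> n * d + v) \<and>
     (\<forall>v<n. K v < cap \<longrightarrow> (\<exists>j<i. \<exists>d. iwalk adj s (\<pi> ! j) v d \<and> K v = n * d + v))"

lemma outer_inv_init: "outer_inv s cap \<pi> 0 (\<lambda>_. cap)"
proof -
  have "u \<le> n * wgt s u l" if "u < n" for u l
  proof -
    have "n \<le> n * wgt s u l"
      using wgt_pos[of s u l] by simp
    then show ?thesis using that by linarith
  qed
  then show ?thesis
    by (auto simp: outer_inv_def consistent_def relaxed_def trans_le_add1)
qed

definition records :: "real \<Rightarrow> nat list \<Rightarrow> nat \<Rightarrow> nat set" where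
  "records s \<pi> i = {v. v < n \<and> (\<exists>d. iwalk adj s (\<pi> ! i) v d \<and>
     (\<forall>j<i. \<forall>d'. iwalk adj s (\<pi> ! j) v d' \<longrightarrow> d < d'))}"

text \<open>Rounded distance 0 occurs only from a vertex to itself, and the centers are distinct, so
  a new center always improves its own key.\<close>

lemma outer_inv_less:
  assumes "outer_inv s cap \<pi> i K" "\<pi> \<in> permutations_of_set {..<n}" "i < n" "n \<le> cap"
  shows "\<pi> ! i < n" "\<pi> ! i < K (\<pi> ! i)"
proof -
  have len: "length \<pi> = n" and dist: "distinct \<pi>" and set: "set \<pi> = {..<n}"
    using length_finite_permutations_of_set[OF assms(2)] permutations_of_setD[OF assms(2)] by simp_all
  show c: "\<pi> ! i < n"
    using set len assms(3) nth_mem[of i \<pi>] by auto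
  show "\<pi> ! i < K (\<pi> ! i)"
  proof (cases "K (\<pi> ! i) < cap")
    case True
    then obtain j d where j: "j < i" "iwalk adj s (\<pi> ! j) (\<pi> ! i) d" "K (\<pi> ! i) = n * d + \<pi> ! i"
      using assms(1) c unfolding outer_inv_def by metis
    have "d \<noteq> 0"
    proof
      assume "d = 0"
      then have "\<pi> ! i = \<pi> ! j"
        using iwalk_0 j(2) by blast
      then show False
        using nth_eq_iff_index_eq[OF dist, of i j] j(1) len assms(3) by simp
    qed
    then show ?thesis
      using j c by simp
  next
    case False
    moreover have "K (\<pi> ! i) \<le> cap"
      using assms(1) c by (simp add: outer_inv_def)
    ultimately show ?thesis
      using assms(4) c by simp
  qed
qed

text \<open>Two keys of the same vertex differ by n times the difference of the distances. A vertex
  whose key dropped is therefore strictly closer to the new center than to every earlier one, which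
  makes it a strict prefix minimum.\<close>

lemma outer_inv_step:
  assumes out: "outer_inv s cap \<pi> i K0" and inv: "dijkstra_inv s K0 (\<pi> ! i) K {} F n 0"
  shows "outer_inv s cap \<pi> (Suc i) K" and "F \<subseteq> records s \<pi> i"
proof -
  note e = dijkstra_inv_end[OF inv]
  note o = out[unfolded outer_inv_def]
  have out_walk: "K0 v \<le> n * d + v" if "j < i" "iwalk adj s (\<pi> ! j) v d" for j v d
    using o[THEN conjunct2, THEN conjunct2, THEN conjunct1] that by simp
  have le: "K v \<le> K0 v" if "v < n" for v
  proof (cases "v \<in> F")
    case True
    then have "v \<in> {v. v < n \<and> K v < K0 v}"
      by (rule equalityD1[OF e(3), THEN subsetD])
    then show ?thesis by simp
  next
    case False
    then show ?thesis
      using e(4)[OF that] by simp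
  qed
  show "outer_inv s cap \<pi> (Suc i) K"
    unfolding outer_inv_def
  proof (intro conjI allI impI)
    show "K v \<le> cap" if "v < n" for v
    proof -
      have "K0 v \<le> cap"
        using o[THEN conjunct1] that by simp
      with le[OF that] show ?thesis by simp
    qed
    show "K v \<le> n * d + v" if "j < Suc i" "iwalk adj s (\<pi> ! j) v d" for j v d
    proof (cases "j = i")
      case True
      then show ?thesis using e(2) that by simp
    next
      case False
      then have "j < i"
        using that by simp
      then have "K0 v \<le> n * d + v"
        using that(2) by (rule out_walk)
      then show ?thesis
        using le[OF iwalk_less[OF G that(2)]] by simp
    qed
    show "\<exists>j<Suc i. \<exists>d. iwalk adj s (\<pi> ! j) v d \<and> K v = n * d + v" if "v < n" "K v < cap" for v
    proof (cases "v \<in> F")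
      case True
      then have "i < Suc i \<and> (\<exists>d. iwalk adj s (\<pi> ! i) v d \<and> K v = n * d + v)"
        using e(5)[OF True] by simp
      then show ?thesis by (rule exI)
    next
      case False
      then have "K0 v < cap" "K0 v = K v"
        using e(4)[OF that(1)] that(2) by simp_all
      then have "\<exists>j<i. \<exists>d. iwalk adj s (\<pi> ! j) v d \<and> K v = n * d + v"
        using o[THEN conjunct2, THEN conjunct2, THEN conjunct2, THEN spec, of v] that(1) by simp
      then obtain j where j: "j < i" "\<exists>d. iwalk adj s (\<pi> ! j) v d \<and> K v = n * d + v"
        by meson
      show ?thesis
        by (rule exI[of _ j], rule conjI[OF less_SucI[OF j(1)] j(2)])
    qed
  qed (rule e(1))
  show "F \<subseteq> records s \<pi> i"
  proof
    fix v assume v: "v \<in> F"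
    then obtain d where d: "iwalk adj s (\<pi> ! i) v d" "K v = n * d + v"
      using e(5)[OF v] by auto
    have "v \<in> {v. v < n \<and> K v < K0 v}"
      using v by (rule equalityD1[OF e(3), THEN subsetD])
    then have "v < n" "K v < K0 v"
      by simp_all
    moreover have "d < d'" if "j < i" "iwalk adj s (\<pi> ! j) v d'" for j d'
    proof -
      have "K0 v \<le> n * d' + v"
        using that by (rule out_walk)
      then have "n * d < n * d'"
        using \<open>K v < K0 v\<close> d(2) by linarith
      then show ?thesis by simp
    qed
    ultimately have "iwalk adj s (\<pi> ! i) v d \<and> (\<forall>j<i. \<forall>d'. iwalk adj s (\<pi> ! j) v d' \<longrightarrow> d < d')"
      using d(1) by simp
    then show "v \<in> records s \<pi> i"
      unfolding records_def mem_Collect_eq by (intro conjI[OF \<open>v < n\<close>]) (rule exI)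
  qed
qed

end

section \<open>Prefix minima of a random permutation\<close>

lemma permutation_swap_in:
  assumes "xs \<in> permutations_of_set A" "i < length xs" "j < length xs"
  shows "xs[i := xs ! j, j := xs ! i] \<in> permutations_of_set A"
  using assms mset_swap[of j xs i] 
  by (metis list_update_swap list_update_id mset_eq_setD mset_eq_imp_distinct_iff permutations_of_set_def
      mem_Collect_eq permutations_of_setD permutations_of_setI)

text \<open>By symmetry each of the first \<open>i + 1\<close> positions is equally likely to carry the strict
  minimum.\<close>

lemma card_prefix_minimum:
  fixes f :: "'a \<Rightarrow> 'b :: linorder"
  assumes "finite A" "i < card A"
  shows "(i + 1) * card {xs \<in> permutations_of_set A. \<forall>j<i. f (xs ! i) < f (xs ! j)} \<le> fact (card A)"
proof -
  let ?P = "permutations_of_set A"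
  define S where "S r = {xs \<in> ?P. \<forall>j\<le>i. j \<noteq> r \<longrightarrow> f (xs ! r) < f (xs ! j)}" for r
  have len: "length xs = card A" if "xs \<in> ?P" for xs
    using that by (simp add: length_finite_permutations_of_set)
  have fin: "finite (S r)" for r
    using assms by (simp add: S_def)
  have "card (S i) \<le> card (S r)" if "r \<le> i" for r
  proof (rule card_inj_on_le)
    let ?h = "\<lambda>xs. xs[r := xs ! i, i := xs ! r]"
    have nth: "?h xs ! k = (if k = i then xs ! r else if k = r then xs ! i else xs ! k)"
      if "xs \<in> ?P" "k \<le> i" for xs k
      using that \<open>r \<le> i\<close> assms len[of xs] by (auto simp: nth_list_update)
    show "inj_on ?h (S i)"
    proof (rule inj_on_inverseI[where g = ?h])
      fix xs assume "xs \<in> S i"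
      then have "length xs = card A" using len by (simp add: S_def)
      then show "?h (?h xs) = xs"
        using assms \<open>r \<le> i\<close> by (intro nth_equalityI) (auto simp: nth_list_update)
    qed
    show "?h ` S i \<subseteq> S r"
    proof
      fix ys assume "ys \<in> ?h ` S i"
      then obtain xs where xs: "xs \<in> S i" "ys = ?h xs" by blast
      then have P: "xs \<in> ?P" by (simp add: S_def)
      have "ys \<in> ?P"
        unfolding xs(2) using permutation_swap_in[OF P, of r i] assms len[OF P] \<open>r \<le> i\<close> by simp
      moreover have "f (ys ! r) < f (ys ! j)" if "j \<le> i" "j \<noteq> r" for j
        using xs that nth[OF P that(1)] nth[OF P \<open>r \<le> i\<close>] \<open>r \<le> i\<close> by (auto simp: S_def)
      ultimately show "ys \<in> S r"
        by (simp add: S_def)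
    qed
  qed (rule fin)
  then have "(\<Sum>r\<le>i. card (S i)) \<le> (\<Sum>r\<le>i. card (S r))"
    by (intro sum_mono) auto
  also have "\<dots> = card (\<Union>r\<in>{..i}. S r)"
    using fin by (intro card_UN_disjoint[symmetric]) (auto simp: S_def, metis less_asym atMost_iff)
  also have "\<dots> \<le> card ?P"
    using assms by (intro card_mono) (auto simp: S_def)
  finally have "(i + 1) * card (S i) \<le> fact (card A)"
    using assms by simp
  moreover have "S i = {xs \<in> ?P. \<forall>j<i. f (xs ! i) < f (xs ! j)}"
    by (auto simp: S_def le_less)
  ultimately show ?thesis by simp
qed

text \<open>After exchanging the sums, position \<open>i\<close> is a strict prefix minimum for
  \<open>v\<close> in at most the fraction 1 / (i + 1) of the permutations, and these fractions add
  up to \<open>harm n\<close>. The weights \<open>c v\<close> allow a visit to be charged by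
  degree.\<close>

lemma sum_prefix_minima_le:
  fixes W :: "nat \<Rightarrow> nat \<Rightarrow> nat \<Rightarrow> bool" and c :: "nat \<Rightarrow> real"
  assumes c: "\<And>v. 0 \<le> c v"
  shows "(\<Sum>xs\<in>permutations_of_set {..<n}. \<Sum>i<n. \<Sum>v\<in>{v. v < n \<and>
      (\<exists>d. W (xs ! i) v d \<and> (\<forall>j<i. \<forall>d'. W (xs ! j) v d' \<longrightarrow> d < d'))}. c v)
    \<le> fact n * ((\<Sum>v<n. c v) * harm n)"
proof -
  let ?P = "permutations_of_set {..<n}"
  define r where "r xs i v \<longleftrightarrow> (\<exists>d. W (xs ! i) v d \<and> (\<forall>j<i. \<forall>d'. W (xs ! j) v d' \<longrightarrow> d < d'))" for xs i v
  have "real (card {xs \<in> ?P. r xs i v}) \<le> fact n / real (i + 1)" if "i < n" for i v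
  proof -
    \<comment> \<open>The least length, infinite if there is none, turns the relation
      \<open>W\<close> into a function with values in a linear order, to which the count of prefix
      minima applies.\<close>
    define f where "f x = (if \<exists>d. W x v d then enat (LEAST d. W x v d) else \<infinity>)" for x
    have "f (xs ! i) < f (xs ! j)" if r: "r xs i v" and "j < i" for xs j
    proof -
      from r obtain d where d: "W (xs ! i) v d" "\<And>d'. W (xs ! j) v d' \<Longrightarrow> d < d'"
        unfolding r_def using \<open>j < i\<close> by blast
      have "f (xs ! i) \<le> enat d"
        using d(1) by (auto simp: f_def Least_le)
      also have "enat d < f (xs ! j)"
        using d(2) LeastI_ex[of "W (xs ! j) v"] by (auto simp: f_def)
      finally show ?thesis .
    qed
    then have "card {xs \<in> ?P. r xs i v} \<le> card {xs \<in> ?P. \<forall>j<i. f (xs ! i) < f (xs ! j)}"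
      by (intro card_mono) auto
    then have "(i + 1) * card {xs \<in> ?P. r xs i v} \<le>
        (i + 1) * card {xs \<in> ?P. \<forall>j<i. f (xs ! i) < f (xs ! j)}"
      by (intro mult_le_mono2)
    also have "\<dots> \<le> fact n"
      using card_prefix_minimum[of "{..<n}" i f] that by simp
    finally have "real ((i + 1) * card {xs \<in> ?P. r xs i v}) \<le> real (fact n)"
      by (rule of_nat_mono)
    then show ?thesis
      by (simp add: field_simps)
  qed
  note * = this
  have "(\<Sum>xs\<in>?P. \<Sum>i<n. \<Sum>v\<in>{v. v < n \<and> r xs i v}. c v) =
      (\<Sum>xs\<in>?P. \<Sum>i<n. \<Sum>v<n. if r xs i v then c v else 0)"
  proof (intro sum.cong[OF refl])
    fix xs i
    have "{v. v < n \<and> r xs i v} = {v \<in> {..<n}. r xs i v}"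
      by auto
    then show "(\<Sum>v\<in>{v. v < n \<and> r xs i v}. c v) = (\<Sum>v<n. if r xs i v then c v else 0)"
      by (simp only: sum.inter_filter[OF finite_lessThan])
  qed
  also have "\<dots> = (\<Sum>i<n. \<Sum>v<n. \<Sum>xs\<in>?P. if r xs i v then c v else 0)"
    by (subst sum.swap, rule sum.cong[OF refl], subst sum.swap) simp
  also have "\<dots> = (\<Sum>i<n. \<Sum>v<n. c v * real (card {xs \<in> ?P. r xs i v}))"
  proof (intro sum.cong[OF refl])
    fix i v
    show "(\<Sum>xs\<in>?P. if r xs i v then c v else 0) = c v * real (card {xs \<in> ?P. r xs i v})"
      by (subst sum.inter_filter[symmetric]) simp_all
  qed
  also have "\<dots> \<le> (\<Sum>i<n. \<Sum>v<n. c v * (fact n / real (i + 1)))"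
    using c * by (intro sum_mono mult_left_mono) auto
  also have "\<dots> = fact n * ((\<Sum>v<n. c v) * (\<Sum>i<n. 1 / real (i + 1)))"
  proof -
    have "(\<Sum>i<n. \<Sum>v<n. c v * (fact n / real (i + 1))) = (\<Sum>i<n. (\<Sum>v<n. c v) * (fact n / real (i + 1)))"
      by (simp only: sum_distrib_right)
    also have "\<dots> = (\<Sum>i<n. (\<Sum>v<n. c v) * (fact n * (1 / real (i + 1))))"
      by simp
    also have "\<dots> = (\<Sum>v<n. c v) * (fact n * (\<Sum>i<n. 1 / real (i + 1)))"
      by (simp only: sum_distrib_left)
    finally show ?thesis
      by (simp only: mult.left_commute)
  qed
  also have "(\<Sum>i<n. 1 / real (i + 1)) = harm n"
    unfolding harm_def by (rule sum.reindex_bij_witness[of _ "\<lambda>i. i - 1" Suc]) (auto simp: inverse_eq_divide)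
  finally show ?thesis
    by (simp add: r_def)
qed

section \<open>The program\<close>

abbreviation seq (infixr ";;" 55) where "c ;; d \<equiv> Seq c d"
abbreviation (input) plus_e (infixl "\<oplus>" 65) where "a \<oplus> b \<equiv> Op Plus a b"
abbreviation (input) minus_e (infixl "\<ominus>" 65) where "a \<ominus> b \<equiv> Op Minus a b"
abbreviation (input) times_e (infixl "\<otimes>" 70) where "a \<otimes> b \<equiv> Op Times a b"
abbreviation (input) over_e (infixl "\<oslash>" 70) where "a \<oslash> b \<equiv> Op Over a b"

text \<open>The variables are named after what they hold: \<open>S\<close> is the radius in rounded units, \<open>z\<close> is \<open>2\<^sup>J\<close>,
  where all relevant keys are below \<open>2\<^sup>J\<close>, \<open>M\<close> is the queue, and \<open>k\<close> and \<open>q\<close> are a key and its power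
  \<open>2\<^sup>-\<^sup>k\<close>. For every vertex, \<open>aBest\<close> holds the power of the best key found so far, \<open>aQueue\<close> its
  contribution to \<open>M\<close> (0 if it is not queued), \<open>aLab\<close> the index of its center or \<open>-1\<close>, and \<open>aTag\<close>
  the power \<open>2\<^sup>-\<^sup>v\<close>. \<open>aEdge\<close> holds the factors by which edges multiply powers of keys, and \<open>aTab\<close> the
  powers \<open>2\<^sup>-\<^sup>1, 2\<^sup>-\<^sup>2, 2\<^sup>-\<^sup>4, ...\<close> for the binary search.\<close>

abbreviation (input) "rn \<equiv> 0 :: nat"
abbreviation (input) "rD \<equiv> 1 :: nat"
abbreviation (input) "rU \<equiv> 2 :: nat"
abbreviation (input) "rN \<equiv> 3 :: nat"
abbreviation (input) "rS \<equiv> 4 :: nat"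
abbreviation (input) "rJ \<equiv> 5 :: nat"
abbreviation (input) "rz \<equiv> 6 :: nat"
abbreviation (input) "ri \<equiv> 7 :: nat"
abbreviation (input) "rj \<equiv> 8 :: nat"
abbreviation (input) "rv \<equiv> 9 :: nat"
abbreviation (input) "ra \<equiv> 10 :: nat"
abbreviation (input) "re \<equiv> 11 :: nat"
abbreviation (input) "ry \<equiv> 12 :: nat"
abbreviation (input) "rq \<equiv> 13 :: nat"
abbreviation (input) "rk \<equiv> 14 :: nat"
abbreviation (input) "rM \<equiv> 15 :: nat"
abbreviation (input) "rok \<equiv> 16 :: nat"
abbreviation (input) "rzz \<equiv> 17 :: nat"
abbreviation (input) "rd \<equiv> 18 :: nat"
abbreviation (input) "rx \<equiv> 19 :: nat"
abbreviation (input) "rtg \<equiv> 20 :: nat"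
abbreviation (input) "rB \<equiv> 21 :: nat"
abbreviation (input) "rw \<equiv> 22 :: nat"
abbreviation (input) "aPerm \<equiv> 0 :: nat"
abbreviation (input) "aBest \<equiv> 1 :: nat"
abbreviation (input) "aQueue \<equiv> 2 :: nat"
abbreviation (input) "aLab \<equiv> 3 :: nat"
abbreviation (input) "aEdge \<equiv> 4 :: nat"
abbreviation (input) "aTab \<equiv> 5 :: nat"
abbreviation (input) "aTag \<equiv> 6 :: nat"

text \<open>Finds the largest number \<open>k\<close> with some monotone property by binary search, together with
  \<open>2\<^sup>-\<^sup>k\<close>. The bit \<open>2\<^sup>j\<close> is rejected if \<open>a \<le> b\<close>.\<close>

definition greedy :: "expr \<Rightarrow> expr \<Rightarrow> com" where
  "greedy a b =
     Assign rq (Num 1) ;; Assign rk (Num 0) ;; Assign rzz (V rz) ;; Assign rj (V rJ) ;;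
     While (Num 0) (V rj)
       (If a b Skip (Assign rq (V rq \<otimes> Arr aTab (V rj)) ;; Assign rk (V rk \<oplus> V rzz)) ;;
        Assign rzz (V rzz \<oslash> Num 2) ;; Assign rj (V rj \<ominus> Num 1))"

definition same_vars :: "nat set \<Rightarrow> (nat \<Rightarrow> real) \<Rightarrow> (nat \<Rightarrow> real) \<Rightarrow> bool" where
  "same_vars A f g \<longleftrightarrow> (\<forall>r. r \<notin> A \<longrightarrow> f r = g r)"

lemma same_vars_refl [simp]: "same_vars A f f"
  by (simp add: same_vars_def)

lemma same_vars_upd: "same_vars A f g \<Longrightarrow> x \<in> A \<Longrightarrow> same_vars A (f(x := y)) g"
  by (auto simp: same_vars_def)

lemma same_varsD: "same_vars A f g \<Longrightarrow> r \<notin> A \<Longrightarrow> f r = g r"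
  by (simp add: same_vars_def)

text \<open>While \<open>r\<close> bits are undecided, the sought exponent lies between k and k +
  2^r - 1. The property \<open>Pr\<close> is abstract because the search serves two purposes:
  clipping the exponent of an edge and finding the leading power of the queue.\<close>

lemma wp_greedy:
  assumes tab: "\<And>j. j \<le> J \<Longrightarrow> ar s 5 j = (1 / 2) ^ 2 ^ j" "vr s rJ = real J" "vr s rz = 2 ^ J"
    and test: "\<And>vr' tm' j k. j \<le> J \<Longrightarrow> same_vars {8, 13, 14, 17} vr' (vr s) \<Longrightarrow> vr' 8 = real j \<Longrightarrow>
      vr' 13 = (1 / 2) ^ k \<Longrightarrow> vr' 14 = real k \<Longrightarrow> vr' 17 = 2 ^ j \<Longrightarrow>
      defd a (s\<lparr>vr := vr', tm := tm'\<rparr>) \<and> defd b (s\<lparr>vr := vr', tm := tm'\<rparr>) \<and>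
      (eval a (s\<lparr>vr := vr', tm := tm'\<rparr>) \<le> eval b (s\<lparr>vr := vr', tm := tm'\<rparr>) \<longleftrightarrow> \<not> Pr (k + 2 ^ j))"
    and Pr: "Pr 0" "\<And>k k'. Pr k \<Longrightarrow> k' \<le> k \<Longrightarrow> Pr k'"
    and Q: "\<And>vr' tm' k. same_vars {8, 13, 14, 17} vr' (vr s) \<Longrightarrow> vr' 13 = (1 / 2) ^ k \<Longrightarrow>
      vr' 14 = real k \<Longrightarrow> Pr k \<Longrightarrow> k < 2 ^ Suc J \<Longrightarrow> (\<And>k'. k' < 2 ^ Suc J \<Longrightarrow> Pr k' \<Longrightarrow> k' \<le> k) \<Longrightarrow>
      tm' \<le> tm s + (60 + ecost a + ecost b) * Suc J \<Longrightarrow> Q (s\<lparr>vr := vr', tm := tm'\<rparr>)"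
  shows "wp t (greedy a b) Q s"
proof -
  define C where "C = 40 + ecost a + ecost b"
  \<comment> \<open>The registers hold the number r - 1 of the next bit and its weight; at the end,
    for r = 0, they contain -1 and 1/2.\<close>
  define I where "I r s' \<longleftrightarrow> (\<exists>vr' tm' k. s' = s\<lparr>vr := vr', tm := tm'\<rparr> \<and> r \<le> Suc J \<and>
      same_vars {8, 13, 14, 17} vr' (vr s) \<and> vr' 8 = real r - 1 \<and> vr' 17 = 2 ^ r / 2 \<and>
      vr' 13 = (1 / 2) ^ k \<and> vr' 14 = real k \<and> Pr k \<and> k + 2 ^ r \<le> 2 ^ Suc J \<and>
      (\<forall>k'<2 ^ Suc J. Pr k' \<longrightarrow> k' < k + 2 ^ r) \<and> tm' + C * r \<le> tm s + C * Suc J + 14)" for r s'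
  have loop: "wp t (While (Num 0) (V rj)
       (If a b Skip (Assign rq (V rq \<otimes> Arr aTab (V rj)) ;; Assign rk (V rk \<oplus> V rzz)) ;;
        Assign rzz (V rzz \<oslash> Num 2) ;; Assign rj (V rj \<ominus> Num 1))) Q s0"
    if "I (Suc J) s0" for s0
    using that
  proof (rule wp_While_index[where Inv = I], goal_cases)
    case (2 r s')
    from 2(1) obtain vr' tm' k where s': "s' = s\<lparr>vr := vr', tm := tm'\<rparr>" "r \<le> Suc J"
      "same_vars {8, 13, 14, 17} vr' (vr s)" "vr' 8 = real r - 1" "vr' 17 = 2 ^ r / 2"
      "vr' 13 = (1 / 2) ^ k" "vr' 14 = real k" "Pr k" "k + 2 ^ r \<le> 2 ^ Suc J"
      "\<forall>k'<2 ^ Suc J. Pr k' \<longrightarrow> k' < k + 2 ^ r" "tm' + C * r \<le> tm s + C * Suc J + 14"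
      unfolding I_def by blast
    from 2(2) s' have "1 \<le> real r" by simp
    then obtain j where j: "r = Suc j" by (cases r) auto
    have 17: "vr' 17 = 2 ^ j" and 8: "vr' 8 = real j" and jJ: "j \<le> J"
      using s' j by simp_all
    note T = test[OF jJ s'(3) 8 s'(6,7) 17]
    show ?case
    proof (cases "Pr (k + 2 ^ j)")
      case True
      let ?vr = "vr'(13 := (1 / 2) ^ k * (1 / 2) ^ 2 ^ j, 14 := real k + 2 ^ j,
        17 := 2 ^ j / 2, 8 := real j - 1)"
      have "I j (s\<lparr>vr := ?vr, tm := T\<rparr>)" if "T \<le> tm' + C" for T
        unfolding I_def
        by (intro exI[of _ ?vr] exI[of _ T] exI[of _ "k + 2 ^ j"] conjI)
          (use that s' j True in \<open>auto intro!: same_vars_upd simp: power_add\<close>)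
      then show ?thesis
        using T True s' 8 17 tab(1)[OF jJ] j
        by (simp add: wp_iffs C_def) (intro exI[of _ j], simp)
    next
      case False
      let ?vr = "vr'(17 := 2 ^ j / 2, 8 := real j - 1)"
      have less: "k' < k + 2 ^ j" if "Pr k'" for k'
        using Pr(2)[OF that, of "k + 2 ^ j"] False by (meson not_le)
      have "I j (s\<lparr>vr := ?vr, tm := T\<rparr>)" if "T \<le> tm' + C" for T
        unfolding I_def
        by (intro exI[of _ ?vr] exI[of _ T] exI[of _ k] conjI)
          (use that s' j less in \<open>auto intro!: same_vars_upd\<close>)
      then show ?thesis
        using T False s' 8 17 tab(1)[OF jJ] j
        by (simp add: wp_iffs C_def) (intro exI[of _ j], simp)
    qed
  next
    case (3 r s')
    from 3(1) obtain vr' tm' k where s': "s' = s\<lparr>vr := vr', tm := tm'\<rparr>" "r \<le> Suc J"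
      "same_vars {8, 13, 14, 17} vr' (vr s)" "vr' 8 = real r - 1" "vr' 17 = 2 ^ r / 2"
      "vr' 13 = (1 / 2) ^ k" "vr' 14 = real k" "Pr k" "k + 2 ^ r \<le> 2 ^ Suc J"
      "\<forall>k'<2 ^ Suc J. Pr k' \<longrightarrow> k' < k + 2 ^ r" "tm' + C * r \<le> tm s + C * Suc J + 14"
      unfolding I_def by blast
    have "r = 0"
      using 3(2) s' by (cases r) auto
    have "Q (s\<lparr>vr := vr', tm := tm' + 5\<rparr>)"
    proof (rule Q[OF s'(3,6,7,8)])
      show "k < 2 ^ Suc J"
        using s' \<open>r = 0\<close> by simp
      show "k' \<le> k" if "k' < 2 ^ Suc J" "Pr k'" for k'
        using s'(10) that \<open>r = 0\<close> by force
      show "tm' + 5 \<le> tm s + (60 + ecost a + ecost b) * Suc J"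
        using s'(11) \<open>r = 0\<close> by (simp add: C_def algebra_simps)
    qed
    then show ?case
      using s' by (simp add: numeral_eq_Suc)
  qed (auto simp: I_def)
  show ?thesis
    unfolding greedy_def
    by (simp add: wp_iffs, rule loop, unfold I_def,
        rule exI[of _ "(vr s)(13 := 1, 14 := 0, 17 := 2 ^ J, 8 := real J)"],
        rule exI[of _ "tm s + 14"], rule exI[of _ 0])
      (use tab(2,3) Pr(1) in \<open>auto intro!: same_vars_upd simp: numeral_eq_Suc\<close>)
qed

definition each_edge :: "com \<Rightarrow> com" where
  "each_edge c =
     Assign ra (Low (V rv \<oplus> Num 2)) ;; Assign re (Low (V rv \<oplus> Num 3)) ;;
     While (V ra \<oplus> Num 1) (V re) (c ;; Assign ra (V ra \<oplus> Num 2))"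

text \<open>In units of \<Delta> / (4 * N) the radius \<Delta> / 4 * (1 + U) is N * (1 + U). The
  bound in \<open>rB\<close> exceeds the key of every distance up to S + n, so all distances that
  matter get keys below 2^J.\<close>

definition table_com :: com where
  "table_com =
     Assign rN (V rN \<oplus> V rN) ;; Assign rS (V rN \<otimes> (Num 1 \<oplus> V rU)) ;;
     Assign rB (V rn \<otimes> (V rS \<oplus> V rn \<oplus> Num 2)) ;;
     StoreA aTab (Num 0) (Num 1 \<oslash> Num 2) ;; Assign rJ (Num 0) ;; Assign rz (Num 1) ;;
     While (V rz) (V rB)
       (StoreA aTab (V rJ \<oplus> Num 1) (Arr aTab (V rJ) \<otimes> Arr aTab (V rJ)) ;;
        Assign rJ (V rJ \<oplus> Num 1) ;; Assign rz (V rz \<oplus> V rz))"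

definition init_com :: com where
  "init_com =
     Assign rtg (Num 1) ;;
     For rv (V rn)
       (StoreA aTag (V rv) (V rtg) ;; Assign rtg (V rtg \<oslash> Num 2) ;;
        StoreA aBest (V rv) (Arr aTab (V rJ)) ;; StoreA aQueue (V rv) (Num 0) ;;
        StoreA aLab (V rv) (Num (-1)))"

text \<open>Relaxing the edge from v to x shifts a key by n * w + x - v, with w the rounded weight.
  The stored factor is 1/2 to this power, up to clipping.\<close>

definition weight_com :: com where
  "weight_com =
     Assign ry (V rn \<otimes> (Flr (Num 4 \<otimes> V rN \<otimes> Low (V ra \<oplus> Num 1) \<oslash> V rD) \<oplus> Num 1)) ;;
     greedy (V ry \<oplus> Num 1) (V rk \<oplus> V rzz) ;;
     StoreA aEdge (V ra) (V rq \<otimes> Arr aTag (Low (V ra)) \<oslash> Arr aTag (V rv))"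

definition weights_com :: com where
  "weights_com = For rv (V rn) (each_edge weight_com)"

text \<open>Smaller keys have larger powers, so \<open>rw\<close> at most \<open>aBest\<close> means
  no improvement. Subtracting \<open>aQueue\<close>, which is 0 outside the queue, treats insertion
  and decrease-key alike. \<open>rq\<close> still holds the power that the binary search in
  \<open>pop_com\<close> found.\<close>

definition relax_com :: com where
  "relax_com =
     Assign rx (Low (V ra)) ;; Assign rw (V rq \<otimes> Arr aEdge (V ra)) ;;
     If (V rw) (Arr aBest (V rx)) Skip
       (Assign rM (V rM \<ominus> Arr aQueue (V rx) \<oplus> V rw) ;; StoreA aQueue (V rx) (V rw) ;;
        StoreA aBest (V rx) (V rw))"

definition label_com :: com where
  "label_com =
     If (V rd) (V rS)
       (If (Num 0) (Arr aLab (V rv)) Skip (StoreA aLab (V rv) (V ri)))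
       (If (V rd) (V rS \<oplus> V rn) (Assign rok (Num 0)) Skip)"

definition pop_com :: com where
  "pop_com =
     greedy (V rq \<otimes> Arr aTab (V rj)) (V rM \<oslash> Num 2) ;;
     Assign rd (Flr (V rk \<oslash> V rn)) ;; Assign rv (V rk \<ominus> V rn \<otimes> V rd) ;;
     Assign rM (V rM \<ominus> Arr aQueue (V rv)) ;; StoreA aQueue (V rv) (Num 0) ;;
     label_com ;; each_edge relax_com"

text \<open>Queued keys are at most 2^J, so the queue is nonempty exactly if its value reaches the
  last table entry. This replaces the strict comparison with 0, which a loop test cannot
  express.\<close>

definition center_com :: com where
  "center_com =
     Assign rv (Arr aPerm (V ri)) ;; Assign rM (Arr aTag (V rv)) ;;
     StoreA aBest (V rv) (V rM) ;; StoreA aQueue (V rv) (V rM) ;;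
     While (Arr aTab (V rJ)) (V rM) pop_com"

definition attempt_com :: com where
  "attempt_com =
     table_com ;; init_com ;; weights_com ;; Assign rok (Num 1) ;; For ri (V rn) center_com"

definition shuffle_com :: com where
  "shuffle_com =
     For ri (V rn)
       (Sample rU ;; Assign rj (Flr (V rU \<otimes> (V ri \<oplus> Num 1))) ;;
        StoreA aPerm (V ri) (Arr aPerm (V rj)) ;; StoreA aPerm (V rj) (V ri))"

text \<open>Permutation and radius are drawn once and kept; a repetition changes only the precision,
  so it cannot bias the output. The radius comes after n shuffle samples and is tape entry n. The
  labels finally overwrite the beginning of the input, which has more than n words.\<close>

definition ckr_com :: com where
  "ckr_com =
     Assign rn (Low (Num 1)) ;; Assign rD (Low (Num 0)) ;; shuffle_com ;; Sample rU ;;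
     Assign rN ((V rn \<oplus> Num 1) \<otimes> (V rn \<oplus> Num 1) \<otimes> (V rn \<oplus> Num 1)) ;;
     Assign rok (Num 0) ;; While (V rok) (Num 0) attempt_com ;;
     For rv (V rn) (StoreL (V rv) (Arr aLab (V rv)))"

section \<open>Frames and the table of powers\<close>

definition frame :: "nat set \<Rightarrow> nat set \<Rightarrow> state \<Rightarrow> state \<Rightarrow> bool" where
  "frame A B s' s \<longleftrightarrow> same_vars A (vr s') (vr s) \<and> (\<forall>a. a \<notin> B \<longrightarrow> ar s' a = ar s a) \<and>
     lo s' = lo s \<and> bnd s' = bnd s \<and> dr s' = dr s"

lemma frame_refl [simp]: "frame A B s s"
  by (simp add: frame_def)

lemma frame_tm [simp]: "frame A B (s'\<lparr>tm := k\<rparr>) s = frame A B s' s"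
  and frame_tm' [simp]: "frame A B s' (s\<lparr>tm := k\<rparr>) = frame A B s' s"
  by (simp_all add: frame_def)

lemma frame_trans: "frame A B s2 s1 \<Longrightarrow> frame A' B' s1 s \<Longrightarrow> A \<subseteq> C \<Longrightarrow> A' \<subseteq> C \<Longrightarrow> B \<subseteq> D \<Longrightarrow> B' \<subseteq> D \<Longrightarrow> frame C D s2 s"
  by (simp add: frame_def same_vars_def subset_eq) metis

lemma frame_mono: "frame A B s' s \<Longrightarrow> A \<subseteq> A' \<Longrightarrow> B \<subseteq> B' \<Longrightarrow> frame A' B' s' s"
  by (auto simp: frame_def same_vars_def)

lemma frame_vr: "frame A B s' s \<Longrightarrow> r \<notin> A \<Longrightarrow> vr s' r = vr s r"
  and frame_ar: "frame A B s' s \<Longrightarrow> a \<notin> B \<Longrightarrow> ar s' a = ar s a"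
  by (simp_all add: frame_def same_vars_def)

text \<open>Doubling stops at the first power of two above the bound. Unless that is 1, its
  predecessor was at most the bound, so 2^J is at most twice the bound; this controls the length of
  all binary searches.\<close>

lemma wp_table:
  assumes s: "vr s rn = real n" "vr s rU = U" "vr s rN = N"
    and Q: "\<And>s' J. frame {3, 4, 5, 6, 21} {5} s' s \<Longrightarrow> vr s' rN = 2 * N \<Longrightarrow>
      vr s' rS = 2 * N * (1 + U) \<Longrightarrow> vr s' rJ = real J \<Longrightarrow> vr s' rz = 2 ^ J \<Longrightarrow>
      real n * (2 * N * (1 + U) + real n + 2) < 2 ^ J \<Longrightarrow>
      J = 0 \<or> 2 ^ J \<le> 2 * (real n * (2 * N * (1 + U) + real n + 2)) \<Longrightarrow>
      (\<And>j. j \<le> J \<Longrightarrow> ar s' aTab j = (1 / 2) ^ 2 ^ j) \<Longrightarrow> tm s' \<le> tm s + 100 * Suc J \<Longrightarrow> Q s'"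
  shows "wp t table_com Q s"
proof -
  define B where "B = real n * (2 * N * (1 + U) + real n + 2)"
  obtain L where L: "B < 2 ^ L"
    using real_arch_pow[of 2 B] by auto
  define I where "I k s' \<longleftrightarrow> frame {3, 4, 5, 6, 21} {5} s' s \<and> vr s' rN = 2 * N \<and>
      vr s' rS = 2 * N * (1 + U) \<and> vr s' rB = B \<and> (\<exists>J. vr s' rJ = real J \<and> vr s' rz = 2 ^ J \<and>
      (J = 0 \<or> 2 ^ J \<le> 2 * B) \<and> (\<forall>j\<le>J. ar s' 5 j = (1 / 2) ^ 2 ^ j) \<and>
      tm s' \<le> tm s + 60 + 100 * J \<and> k + J = L)" for k s'
  have loop: "wp t (While (V rz) (V rB)
       (StoreA aTab (V rJ \<oplus> Num 1) (Arr aTab (V rJ) \<otimes> Arr aTab (V rJ)) ;;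
        Assign rJ (V rJ \<oplus> Num 1) ;; Assign rz (V rz \<oplus> V rz))) Q s0"
    if "I L s0" for s0
    using that
  proof (rule wp_While_index[where Inv = I], goal_cases)
    case (2 k s')
    from 2(1) obtain J where f: "frame {3, 4, 5, 6, 21} {5} s' s" and s': "vr s' rN = 2 * N"
      "vr s' rS = 2 * N * (1 + U)" "vr s' rB = B" "vr s' rJ = real J" "vr s' rz = 2 ^ J"
      "\<forall>j\<le>J. ar s' 5 j = (1 / 2) ^ 2 ^ j" and t: "tm s' \<le> tm s + 60 + 100 * J" and L': "k + J = L"
      unfolding I_def by blast
    have le: "2 ^ J \<le> B"
      using 2(2) s' by simp
    have "J < L"
    proof (rule ccontr)
      assume "\<not> J < L"
      then have "(2::real) ^ L \<le> 2 ^ J" by (intro power_increasing) auto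
      with le L show False by simp
    qed
    then obtain k' where k': "k = Suc k'"
      using L' by (cases k) auto
    have sq: "(1 / 2 :: real) ^ 2 ^ J * (1 / 2) ^ 2 ^ J = (1 / 2) ^ (2 * 2 ^ J)"
      by (metis mult_2 power_add)
    have I: "I k' s''" if "frame {3, 4, 5, 6, 21} {5} s'' s'" "vr s'' = (vr s')(5 := real J + 1, 6 := 2 * 2 ^ J)"
      "ar s'' 5 = (ar s' 5)(Suc J := (1 / 2) ^ 2 ^ J * (1 / 2) ^ 2 ^ J)" "tm s'' \<le> tm s' + 90" for s''
      unfolding I_def
    proof (intro conjI exI[of _ "Suc J"])
      show "frame {3, 4, 5, 6, 21} {5} s'' s"
        by (rule frame_trans[OF that(1) f]) auto
      show "\<forall>j\<le>Suc J. ar s'' 5 j = (1 / 2) ^ 2 ^ j"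
        using s'(6) sq unfolding that(3) by (simp add: le_Suc_eq)
    qed (use that s' t L' k' le in simp_all)
    show ?case
      using s' k' le
      by (simp add: wp_iffs nat_add_distrib) (rule exI[of _ k'], simp, rule I, auto simp: frame_def same_vars_def)
  next
    case (3 k s')
    from 3(1) obtain J where f: "frame {3, 4, 5, 6, 21} {5} s' s" and s': "vr s' rN = 2 * N"
      "vr s' rS = 2 * N * (1 + U)" "vr s' rB = B" "vr s' rJ = real J" "vr s' rz = 2 ^ J"
      "\<forall>j\<le>J. ar s' 5 j = (1 / 2) ^ 2 ^ j" "J = 0 \<or> 2 ^ J \<le> 2 * B" and t: "tm s' \<le> tm s + 60 + 100 * J"
      unfolding I_def by blast
    show ?case
      by (rule Q[of _ J, folded B_def]) (use f s' 3(2) t in simp_all)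
  qed (auto simp: I_def)
  show ?thesis
    unfolding table_com_def
    by (simp add: wp_iffs, rule loop, unfold I_def, intro conjI exI[of _ 0])
      (use s in \<open>simp_all add: frame_def same_vars_def B_def algebra_simps\<close>)
qed

section \<open>Layout of the input, initial values and edge factors\<close>

lemma length_concat_take: "v \<le> length xss \<Longrightarrow> length (concat (take v xss)) = (\<Sum>u<v. length (xss ! u))"
  by (induction v) (auto simp: take_Suc_conv_app_nth)

lemma nth_concat_sum:
  assumes "v < length xss" "l < length (xss ! v)"
  shows "(\<Sum>u<v. length (xss ! u)) + l < length (concat xss)"
    and "concat xss ! ((\<Sum>u<v. length (xss ! u)) + l) = xss ! v ! l"
proof -
  have "concat xss = concat (take v xss) @ xss ! v @ concat (drop (Suc v) xss)"
    using id_take_nth_drop[OF assms(1)] by (metis concat.simps(2) concat_append)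
  moreover have "length (concat (take v xss)) = (\<Sum>u<v. length (xss ! u))"
    using assms by (intro length_concat_take) simp
  ultimately show "(\<Sum>u<v. length (xss ! u)) + l < length (concat xss)"
    and "concat xss ! ((\<Sum>u<v. length (xss ! u)) + l) = xss ! v ! l"
    using assms(2) by (simp_all add: nth_append)
qed

lemma length_concat_pairs: "length (concat (map (\<lambda>(u, x). [f u, x]) ys)) = 2 * length ys"
  by (induction ys) auto

lemma nth_concat_pairs:
  assumes "i < length ys"
  shows "concat (map (\<lambda>(u, x). [f u, x]) ys) ! (2 * i) = f (fst (ys ! i))"
    and "concat (map (\<lambda>(u, x). [f u, x]) ys) ! Suc (2 * i) = snd (ys ! i)"
  using assms
proof (induction ys arbitrary: i)
  case (Cons y ys)
  {
    case 1
    then show ?case using Cons.IH(1)[of "i - 1"] by (cases y; cases i) auto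
  next
    case 2
    then show ?case using Cons.IH(2)[of "i - 1"] by (cases y; cases i) auto
  }
qed auto

locale ckr_input = weighted_input +
  fixes \<Delta> :: real
  assumes \<Delta>: "0 < \<Delta>"
begin

definition ptr :: "nat \<Rightarrow> nat" where
  "ptr v = n + 3 + 2 * (\<Sum>u<v. deg u)"

definition inp :: "real list" where
  "inp = encode_input \<Delta> adj"

lemma length_adj: "length adj = n"
  using G(2) by (simp add: adjacency_lists_def)

lemma ptr_Suc [simp]: "ptr (Suc v) = ptr v + 2 * deg v"
  by (simp add: ptr_def)

lemma length_inp: "length inp = ptr n"
proof -
  have "length (concat adj) = (\<Sum>u<n. deg u)"
    using length_concat_take[of n adj] length_adj by simp
  then show ?thesis
    by (simp add: inp_def encode_input_def length_concat_pairs ptr_def length_adj)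
qed

lemma inp_0: "inp ! 0 = \<Delta>" and inp_1: "inp ! Suc 0 = real n"
  by (simp_all add: inp_def encode_input_def length_adj)

lemma inp_ptr: "v \<le> n \<Longrightarrow> inp ! (v + 2) = real (ptr v)"
  by (simp add: inp_def encode_input_def nth_append length_adj ptr_def del: upt_Suc)

lemma inp_edge:
  assumes "v < n" "l < deg v"
  shows "inp ! (ptr v + 2 * l) = real (nbr v l)" "inp ! Suc (ptr v + 2 * l) = snd (adj ! v ! l)"
    "Suc (ptr v + 2 * l) < length inp"
proof -
  let ?i = "(\<Sum>u<v. deg u) + l"
  define p where "p = [\<Delta>, real (length adj)] @
    map (\<lambda>v. real (length adj + 3 + 2 * (\<Sum>u<v. length (adj ! u)))) [0..<length adj + 1]"
  define e where "e = concat (map (\<lambda>(u, x). [real u, x]) (concat adj))"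
  note c = nth_concat_sum[of v adj l, unfolded length_adj, OF assms]
  have p: "length p = n + 3"
    by (simp add: length_adj p_def)
  have inp: "inp = p @ e"
    by (simp add: inp_def encode_input_def p_def e_def del: upt_Suc)
  have i: "ptr v + 2 * l = length p + 2 * ?i" "Suc (ptr v + 2 * l) = length p + Suc (2 * ?i)"
    unfolding p ptr_def by simp_all
  note n = nth_concat_pairs[OF c(1), of real, folded e_def, unfolded c(2)]
  show "inp ! (ptr v + 2 * l) = real (nbr v l)"
    unfolding i(1) inp nth_append_length_plus by (fact n(1))
  show "inp ! Suc (ptr v + 2 * l) = snd (adj ! v ! l)"
    unfolding i(2) inp nth_append_length_plus by (fact n(2))
  have "length e = 2 * length (concat adj)"
    unfolding e_def by (rule length_concat_pairs)
  then show "Suc (ptr v + 2 * l) < length inp"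
    unfolding i(2) inp using c(1) by simp
qed

definition base :: "state \<Rightarrow> bool" where
  "base s \<longleftrightarrow> bnd s = length inp \<and> (\<forall>a<length inp. lo s a = inp ! a) \<and> vr s rn = real n \<and> vr s rD = \<Delta>"

lemma base_frame: "base s \<Longrightarrow> frame A B s' s \<Longrightarrow> 0 \<notin> A \<Longrightarrow> 1 \<notin> A \<Longrightarrow> base s'"
  by (simp add: base_def frame_def same_vars_def)

lemma base_low:
  assumes "base s"
  shows "v \<le> n \<Longrightarrow> lo s (v + 2) = real (ptr v)" "v \<le> n \<Longrightarrow> v + 2 < bnd s"
    "v < n \<Longrightarrow> l < deg v \<Longrightarrow> lo s (ptr v + 2 * l) = real (nbr v l)"
    "v < n \<Longrightarrow> l < deg v \<Longrightarrow> lo s (Suc (ptr v + 2 * l)) = snd (adj ! v ! l)"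
    "v < n \<Longrightarrow> l < deg v \<Longrightarrow> Suc (ptr v + 2 * l) < bnd s"
proof -
  have len: "v \<le> n \<Longrightarrow> v + 2 < length inp"
    by (simp add: length_inp ptr_def)
  then show "v \<le> n \<Longrightarrow> v + 2 < bnd s"
    using assms by (simp add: base_def)
  show "v \<le> n \<Longrightarrow> lo s (v + 2) = real (ptr v)"
    using assms len inp_ptr[of v] by (simp add: base_def)
  assume vl: "v < n" "l < deg v"
  note e = inp_edge[OF vl]
  show "lo s (ptr v + 2 * l) = real (nbr v l)" "lo s (Suc (ptr v + 2 * l)) = snd (adj ! v ! l)"
    "Suc (ptr v + 2 * l) < bnd s"
    using assms e by (simp_all add: base_def)
qed

lemma base_vr: "base s \<Longrightarrow> vr s 0 = real n" "base s \<Longrightarrow> vr s 1 = \<Delta>"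
  by (simp_all add: base_def)

lemma wp_each_edge:
  assumes s: "base s" "v < n" "vr s rv = real v"
    and I0: "\<And>s'. frame {10, 11} {} s' s \<Longrightarrow> vr s' ra = real (ptr v) \<Longrightarrow>
       vr s' re = real (ptr v + 2 * deg v) \<Longrightarrow> tm s' = tm s + 14 \<Longrightarrow> Inv 0 s'"
    and I: "\<And>l s'. Inv l s' \<Longrightarrow> vr s' ra = real (ptr v + 2 * l) \<and> vr s' re = real (ptr v + 2 * deg v)"
    and step: "\<And>l s'. l < deg v \<Longrightarrow> Inv l s' \<Longrightarrow>
      wp t c (\<lambda>s''. vr s'' ra = real (ptr v + 2 * l) \<and>
         Inv (Suc l) (s''\<lparr>vr := (vr s'')(ra := real (ptr v + 2 * Suc l)), tm := tm s'' + 6\<rparr>))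
        (s'\<lparr>tm := tm s' + 8\<rparr>)"
    and Q: "\<And>s'. Inv (deg v) s' \<Longrightarrow> Q (s'\<lparr>tm := tm s' + 8\<rparr>)"
  shows "wp t (each_edge c) Q s"
proof -
  have loop: "wp t (While (V ra \<oplus> Num 1) (V re) (c ;; Assign ra (V ra \<oplus> Num 2))) Q s0" if "Inv 0 s0" for s0
  proof (rule wp_While_index[where Inv = "\<lambda>k s. \<exists>l\<le>deg v. k + l = deg v \<and> Inv l s" and k = "deg v"], goal_cases)
    case 1
    show ?case using that by auto
  next
    case (3 k s')
    then obtain l where l: "l \<le> deg v" "k + l = deg v" "Inv l s'" by blast
    note I = I[OF l(3)]
    have "real (ptr v + 2 * l + 1) \<le> real (ptr v + 2 * deg v)"
      using 3(2) I by simp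
    then have l': "l < deg v"
      unfolding of_nat_le_iff by simp
    have c: "ecost (V ra \<oplus> Num 1) + ecost (V re) + 2 = 8"
      by simp
    show ?case
      unfolding c wp_Seq_iff
    proof (rule wp_mono[OF step[OF l' l(3)]], goal_cases)
      case (1 s'')
      then have eq: "s''\<lparr>vr := (vr s'')(10 := eval (V ra \<oplus> Num 2) s''), tm := tm s'' + (ecost (V ra \<oplus> Num 2) + 2)\<rparr> =
          s''\<lparr>vr := (vr s'')(10 := real (ptr v + 2 * Suc l)), tm := tm s'' + 6\<rparr>"
        by (simp add: add.commute)
      have "k - 1 < k \<and> (\<exists>l'\<le>deg v. k - 1 + l' = deg v \<and> Inv l' (s''\<lparr>vr := (vr s'')(10 := real (ptr v + 2 * Suc l)), tm := tm s'' + 6\<rparr>))"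
        using 1 l l' by (intro conjI exI[of _ "Suc l"]) auto
      then show ?case
        unfolding wp_Assign_iff eq by (intro conjI, simp) (rule exI)
    qed
  next
    case (4 k s')
    then obtain l where l: "l \<le> deg v" "k + l = deg v" "Inv l s'" by blast
    note I = I[OF l(3)]
    have "\<not> real (ptr v + 2 * l + 1) \<le> real (ptr v + 2 * deg v)"
      using 4(2) I by simp
    then have "\<not> l < deg v"
      unfolding of_nat_le_iff by simp
    then have "l = deg v" using l by simp
    have c: "ecost (V ra \<oplus> Num 1) + ecost (V re) + 2 = 8"
      by simp
    show ?case
      unfolding c using Q l \<open>l = deg v\<close> by simp
  qed simp
  note low = base_low[OF s(1)]
  have l: "lo s (nat (int v + 2)) = real (ptr v)" "nat (int v + 2) < bnd s"
    "lo s (nat (int v + 3)) = real (ptr v + 2 * deg v)" "nat (int v + 3) < bnd s"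
    using low(1,2)[of v] low(1,2)[of "Suc v"] s(2) by (simp_all add: nat_add_distrib numeral_eq_Suc)
  show ?thesis
    unfolding each_edge_def
    by (simp add: wp_iffs s(3) l, rule loop, rule I0) (simp_all add: frame_def same_vars_def)
qed

declare One_nat_def [simp del]

lemma wp_init:
  assumes s: "base s" "vr s rJ = real J" "ar s aTab J = c"
    and Q: "\<And>s'. frame {9, 20} {1, 2, 3, 6} s' s \<Longrightarrow>
      (\<And>v. v < n \<Longrightarrow> ar s' aTag v = (1 / 2) ^ v \<and> ar s' aBest v = c \<and> ar s' aQueue v = 0 \<and> ar s' aLab v = - 1) \<Longrightarrow>
      tm s' \<le> tm s + 100 * Suc n \<Longrightarrow> Q s'"
  shows "wp t init_com Q s"
proof -
  define I where "I i s' \<longleftrightarrow> frame {9, 20} {1, 2, 3, 6} s' s \<and> vr s' rv = real i \<and> vr s' rtg = (1 / 2) ^ i \<and>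
    (\<forall>v<i. ar s' aTag v = (1 / 2) ^ v \<and> ar s' aBest v = c \<and> ar s' aQueue v = 0 \<and> ar s' aLab v = - 1) \<and>
    tm s' \<le> tm s + 10 + 100 * i" for i s'
  have loop: "wp t (For rv (V rn)
       (StoreA aTag (V rv) (V rtg) ;; Assign rtg (V rtg \<oslash> Num 2) ;;
        StoreA aBest (V rv) (Arr aTab (V rJ)) ;; StoreA aQueue (V rv) (Num 0) ;;
        StoreA aLab (V rv) (Num (-1)))) Q s0"
    if "I 0 (s0\<lparr>vr := (vr s0)(rv := 0), tm := tm s0 + 3\<rparr>)" for s0
    using that
  proof (rule wp_For[where Inv = I and m = n], goal_cases)
    case (1 i s')
    then show ?case
      using base_vr(1)[OF base_frame[OF s(1)]] by (auto simp: I_def)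
  next
    case (2 i s')
    then have f: "frame {9, 20} {1, 2, 3, 6} s' s" by (simp add: I_def)
    have 5: "vr s' 5 = real J" "ar s' 5 J = c"
      using frame_vr[OF f, of 5] frame_ar[OF f, of 5] s by simp_all
    have I: "I (Suc i) s''" if "frame {9, 20} {1, 2, 3, 6} s'' s'"
      "vr s'' = (vr s')(20 := (1 / 2) ^ i / 2, 9 := real (Suc i))"
      "ar s'' 6 = (ar s' 6)(i := (1 / 2) ^ i)" "ar s'' 1 = (ar s' 1)(i := c)"
      "ar s'' 2 = (ar s' 2)(i := 0)" "ar s'' 3 = (ar s' 3)(i := -1)"
      "tm s'' \<le> tm s' + 100" for s''
      using 2(2) frame_trans[OF that(1) f order_refl order_refl order_refl order_refl] that(2-)
      unfolding I_def by (simp add: less_Suc_eq)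
    have "vr s' 9 = real i" "vr s' 20 = (1 / 2) ^ i"
      using 2(2) by (simp_all add: I_def)
    then show ?case
      using 5 by (simp add: wp_iffs) (rule I, auto simp: frame_def same_vars_def)
  next
    case (3 s')
    then show ?case
      by (intro Q) (simp_all add: I_def)
  qed
  show ?thesis
    unfolding init_com_def
    by (simp add: wp_iffs, rule loop) (simp add: I_def frame_def same_vars_def)
qed

text \<open>Binary search clips the exponent. A clipped edge is never used, as no key exceeds \<open>2\<^sup>J\<close>.\<close>

definition hval :: "nat \<Rightarrow> real \<Rightarrow> nat \<Rightarrow> nat \<Rightarrow> real" where
  "hval J r v l = (1 / 2) ^ min (n * wgt r v l) (2 ^ Suc J - 1) * (1 / 2) ^ nbr v l / (1 / 2) ^ v"

lemma wp_weight:
  assumes s: "base s" "v < n" "l < deg v" "vr s rv = real v" "vr s ra = real (ptr v + 2 * l)"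
      "vr s rN = N" "0 < N"
    and tab: "\<And>j. j \<le> J \<Longrightarrow> ar s 5 j = (1 / 2) ^ 2 ^ j" "vr s rJ = real J" "vr s rz = 2 ^ J"
    and tag: "\<And>u. u < n \<Longrightarrow> ar s aTag u = (1 / 2) ^ u"
    and Q: "\<And>s'. frame {8, 12, 13, 14, 17} {4} s' s \<Longrightarrow>
      ar s' aEdge = (ar s aEdge)(ptr v + 2 * l := hval J (4 * N / \<Delta>) v l) \<Longrightarrow> tm s' \<le> tm s + 200 * Suc J \<Longrightarrow> Q s'"
  shows "wp t weight_com Q s"
proof -
  define y where "y = n * wgt (4 * N / \<Delta>) v l"
  have "0 < snd (adj ! v ! l)"
    using adjacency_listsD(5)[OF G s(2), of "nbr v l" "snd (adj ! v ! l)"] s(3) by simp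
  then have "0 \<le> 4 * N * snd (adj ! v ! l) / \<Delta>"
    using s(7) \<Delta> by simp
  then have y: "real n * (of_int \<lfloor>4 * N * snd (adj ! v ! l) / \<Delta>\<rfloor> + 1) = real y"
    by (simp add: y_def scaled_def distrib_left add.commute)
  define a where "a = ptr v + 2 * l"
  have low': "lo s (Suc a) = snd (adj ! v ! l)" "Suc a < bnd s" "lo s a = real (nbr v l)" "a < bnd s"
    "nat (int a + 1) = Suc a" "vr s ra = real a"
    using base_low(3-5)[OF s(1) s(2,3)] s(5) by (simp_all add: a_def)
  note base = base_vr[OF s(1)]
  define s1 where "s1 = s\<lparr>vr := (vr s)(12 := real y), tm := tm s + 21\<rparr>"
  have "wp t (greedy (V ry \<oplus> Num 1) (V rk \<oplus> V rzz)) (\<lambda>s'. wp t (StoreA aEdge (V ra) (V rq \<otimes> Arr aTag (Low (V ra)) \<oslash> Arr aTag (V rv))) Q s') s1"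
  proof (rule wp_greedy[where J = J and Pr = "\<lambda>k. k \<le> y"], goal_cases)
    case (4 vr' tm' j k)
    have "vr' 12 = real y"
      using same_varsD[OF 4(2), of 12] by (simp add: s1_def)
    moreover have "(1 + real y \<le> real k + 2 ^ j) = (\<not> k + 2 ^ j \<le> y)"
    proof -
      have "(1 + real y \<le> real k + 2 ^ j) = (real (1 + y) \<le> real (k + 2 ^ j))"
        by simp
      then show ?thesis
        unfolding of_nat_le_iff by linarith
    qed
    ultimately show ?case
      using 4 by (simp add: add.commute)
  next
    case (7 vr' tm' k)
    have k: "k = min y (2 ^ Suc J - 1)"
    proof (rule antisym)
      show "k \<le> min y (2 ^ Suc J - 1)"
        using 7(4,5) by linarith
      show "min y (2 ^ Suc J - 1) \<le> k"
      proof (rule 7(6))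
        have "0 < (2::nat) ^ Suc J" by simp
        then show "min y (2 ^ Suc J - 1) < 2 ^ Suc J" by linarith
      qed simp
    qed
    have v: "vr' 9 = real v" "vr' 10 = real a"
      using same_varsD[OF 7(1), of 9] same_varsD[OF 7(1), of 10] s low' by (simp_all add: s1_def)
    have *: "hval J (4 * N / \<Delta>) v l = (1 / 2) ^ k * (1 / 2) ^ nbr v l / (1 / 2) ^ v"
      by (simp only: hval_def k y_def)
    show ?case
      using v low' 7(2,7) tag[OF nbr_less[OF s(2,3)]] tag[OF s(2)]
      by (simp add: wp_iffs s1_def)
        (rule Q, use same_varsD[OF 7(1)] in \<open>auto simp: frame_def same_vars_def s1_def a_def[symmetric] *\<close>)
  qed (use tab in \<open>simp_all add: s1_def\<close>)
  note w = this[unfolded s1_def]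
  show ?thesis
    unfolding weight_com_def using low' y base s(6)
    by (simp add: wp_iffs) (rule w)
qed

text \<open>The edge lists of different vertices occupy disjoint ranges, so writing one edge factor
  leaves those of earlier vertices intact.\<close>

lemma ptr_mono: "v < v' \<Longrightarrow> ptr v + 2 * deg v \<le> ptr v'"
proof -
  assume "v < v'"
  then have "(\<Sum>u<Suc v. deg u) \<le> (\<Sum>u<v'. deg u)"
    by (intro sum_mono2) auto
  then show ?thesis by (simp add: ptr_def)
qed

lemma wp_weights:
  assumes s: "base s" "vr s rN = N" "0 < N"
    and tab: "\<And>j. j \<le> J \<Longrightarrow> ar s 5 j = (1 / 2) ^ 2 ^ j" "vr s rJ = real J" "vr s rz = 2 ^ J"
    and tag: "\<And>u. u < n \<Longrightarrow> ar s aTag u = (1 / 2) ^ u"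
    and Q: "\<And>s'. frame {8, 9, 10, 11, 12, 13, 14, 17} {4} s' s \<Longrightarrow>
      (\<And>v l. v < n \<Longrightarrow> l < deg v \<Longrightarrow> ar s' aEdge (ptr v + 2 * l) = hval J (4 * N / \<Delta>) v l) \<Longrightarrow>
      tm s' \<le> tm s + 20 + (\<Sum>v<n. 50 + 220 * Suc J * deg v) \<Longrightarrow> Q s'"
  shows "wp t weights_com Q s"
proof -
  let ?A = "{8, 9, 10, 11, 12, 13, 14, 17} :: nat set" and ?h = "hval J (4 * N / \<Delta>)"
  define I where "I i s' \<longleftrightarrow> frame ?A {4} s' s \<and> vr s' rv = real i \<and>
      (\<forall>v<i. \<forall>l<deg v. ar s' 4 (ptr v + 2 * l) = ?h v l) \<and>
      tm s' \<le> tm s + 3 + (\<Sum>v<i. 50 + 220 * Suc J * deg v)" for i s'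
  show ?thesis
    unfolding weights_com_def
  proof (rule wp_For[where Inv = I and m = n], goal_cases)
    case 1
    show ?case by (simp add: I_def frame_def same_vars_def)
  next
    case (2 i s')
    then show ?case
      using base_vr(1)[OF base_frame[OF s(1)]] by (auto simp: I_def)
  next
    case (3 i s1)
    then have f: "frame ?A {4} s1 s" by (simp add: I_def)
    have b: "base s1"
      using base_frame[OF s(1) f] by simp
    have i: "vr s1 rv = real i" using 3 by (simp add: I_def)
    define K where "K l s' \<longleftrightarrow> frame (?A - {9}) {4} s' s1 \<and> vr s' ra = real (ptr i + 2 * l) \<and>
        vr s' re = real (ptr i + 2 * deg i) \<and>
        (\<forall>v<i. \<forall>l<deg v. ar s' 4 (ptr v + 2 * l) = ?h v l) \<and>
        (\<forall>l'<l. ar s' 4 (ptr i + 2 * l') = ?h i l') \<and> tm s' \<le> tm s1 + 22 + 220 * Suc J * l" for l s'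
    show ?case
    proof (rule wp_each_edge[where Inv = K and v = i], goal_cases)
      case 1
      show ?case using b by (simp add: base_def)
    next
      case 2
      show ?case by (rule 3(1))
    next
      case 3
      show ?case using i by simp
    next
      case (4 s')
      have "ar s' 4 = ar s1 4"
        using frame_ar[OF 4(1), of 4] by simp
      then show ?case
        using 4 3(2) frame_mono[OF 4(1), of "?A - {9}" "{4}"] by (auto simp: K_def I_def)
    next
      case (5 l s')
      then show ?case by (simp add: K_def)
    next
      case (6 l s')
      then have g: "frame (?A - {9}) {4} s' s1" by (simp add: K_def)
      have gs: "frame ?A {4} s' s"
        by (rule frame_trans[OF g f]) auto
      show ?case
      proof (rule wp_weight[where v = i and l = l and N = N and J = J], goal_cases)
        case 1
        show ?case using base_frame[OF s(1) gs] by (simp add: base_def)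
      next
        case (11 u)
        then show ?case
          using frame_ar[OF gs, of 6] tag by simp
      next
        case (8 j)
        then show ?case
          using frame_ar[OF gs, of 5] tab by simp
      next
        case (12 s2)
        have eq: "ar s2 4 = (ar s' 4)(ptr i + 2 * l := ?h i l)"
          using 12(2) by simp
        have f2: "frame (?A - {9}) {4} s2 s1"
          using frame_trans[OF 12(1)[simplified frame_tm'] g, of "?A - {9}" "{4}"] by auto
        have 10: "vr s2 10 = real (ptr i + 2 * l)" "vr s2 11 = real (ptr i + 2 * deg i)"
          using frame_vr[OF 12(1), of 10] frame_vr[OF 12(1), of 11] 6(2) by (simp_all add: K_def)
        have "ptr v + 2 * l' \<noteq> ptr i + 2 * l" if "v < i" "l' < deg v" for v l'
          using ptr_mono[OF that(1)] that by linarith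
        then have A: "\<forall>v<i. \<forall>l'<deg v. ar s2 4 (ptr v + 2 * l') = ?h v l'"
          using 6(2) by (simp add: K_def eq)
        have B: "\<forall>l'<Suc l. ar s2 4 (ptr i + 2 * l') = ?h i l'"
          using 6(2) by (simp add: K_def eq less_Suc_eq)
        have "frame (?A - {9}) {4} (s2\<lparr>vr := (vr s2)(10 := real (ptr i + 2 * Suc l)), tm := tm s2 + 6\<rparr>) s1"
          using f2 by (simp add: frame_def same_vars_def)
        then show ?case
          using 10 A B 12(3) 6(2) by (simp add: K_def)
      qed (use 6 3(1) i s tab frame_vr[OF gs] frame_vr[OF g, of 9] in \<open>simp_all add: K_def\<close>)
    next
      case (7 s')
      then have g: "frame (?A - {9}) {4} s' s1" by (simp add: K_def)
      have gs: "frame ?A {4} s' s"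
        by (rule frame_trans[OF g f]) auto
      have 9: "vr s' 9 = real i"
        using frame_vr[OF g, of 9] i by simp
      have "frame ?A {4} (s'\<lparr>vr := (vr s')(9 := real (Suc i)), tm := tm s' + 14\<rparr>) s"
        using gs by (simp add: frame_def same_vars_def)
      then show ?case
        using 7 9 3(2) by (simp add: K_def I_def less_Suc_eq)
    qed
  next
    case (4 s')
    then show ?case
      by (intro Q) (simp_all add: I_def)
  qed
qed

end

section \<open>The queue as a binary expansion\<close>

lemma sum_half_powers_less:
  fixes A :: "nat set"
  assumes "finite A" "\<And>a. a \<in> A \<Longrightarrow> k \<le> a"
  shows "(\<Sum>a\<in>A. (1 / 2 :: real) ^ a) < 2 * (1 / 2) ^ k"
proof -
  define m where "m = k + Max (insert 0 A)"
  have *: "(\<Sum>a=k..m. (1 / 2 :: real) ^ a) = 2 * (1 / 2) ^ k - (1 / 2) ^ m" if "k \<le> m" for m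
    using that
  proof (induction m rule: dec_induct)
    case (step n)
    then have "(\<Sum>a=k..Suc n. (1 / 2 :: real) ^ a) = 2 * (1 / 2) ^ k - (1 / 2) ^ n + (1 / 2) ^ Suc n"
      by simp
    then show ?case
      by simp
  qed simp
  have "A \<subseteq> {k..m}"
    using assms Max_ge[of "insert 0 A"] by (fastforce simp: m_def intro: trans_le_add2)
  then have "(\<Sum>a\<in>A. (1 / 2 :: real) ^ a) \<le> (\<Sum>a=k..m. (1 / 2) ^ a)"
    by (intro sum_mono2) auto
  also have "\<dots> < 2 * (1 / 2) ^ k"
    using *[of m] by (simp add: m_def)
  finally show ?thesis .
qed

lemma half_power_le_iff: "(1 / 2 :: real) ^ a \<le> (1 / 2) ^ b \<longleftrightarrow> b \<le> a"
  by (rule power_decreasing_iff) auto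

text \<open>Keys are distinct, so the sum is a binary expansion. Its leading digit belongs to the
  least key, and the other digits together contribute less than one more such power.\<close>

lemma leading_power:
  fixes K :: "nat \<Rightarrow> nat"
  assumes "finite Q" "inj_on K Q" "v \<in> Q" "\<forall>x\<in>Q. K v \<le> K x"
  shows "(1 / 2) ^ k \<le> (\<Sum>x\<in>Q. (1 / 2 :: real) ^ K x) / 2 \<longleftrightarrow> \<not> k \<le> K v"
proof -
  let ?M = "\<Sum>x\<in>Q. (1 / 2 :: real) ^ K x"
  have "?M = (\<Sum>a\<in>K ` Q. (1 / 2) ^ a)"
    using assms(2) by (simp add: sum.reindex)
  also have "\<dots> < 2 * (1 / 2) ^ K v"
    using assms by (intro sum_half_powers_less) auto
  finally have u: "?M < 2 * (1 / 2) ^ K v" .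
  have l: "(1 / 2) ^ K v \<le> ?M"
    using assms by (intro member_le_sum) auto
  show ?thesis
  proof (cases "k \<le> K v")
    case True
    then have "(1 / 2 :: real) ^ K v \<le> (1 / 2) ^ k"
      by (simp only: half_power_le_iff)
    with u True show ?thesis by linarith
  next
    case False
    then have "(1 / 2 :: real) ^ k \<le> (1 / 2) ^ Suc (K v)"
      by (simp only: half_power_le_iff)
    with l False show ?thesis by simp
  qed
qed

context ckr_input
begin

definition static :: "real \<Rightarrow> nat \<Rightarrow> real \<Rightarrow> nat \<Rightarrow> state \<Rightarrow> bool" where
  "static r J S i s \<longleftrightarrow> base s \<and> (\<forall>j\<le>J. ar s aTab j = (1 / 2) ^ 2 ^ j) \<and> vr s rJ = real J \<and>
     vr s rz = 2 ^ J \<and> vr s rS = S \<and> vr s ri = real i \<and>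
     (\<forall>v<n. \<forall>l<deg v. ar s aEdge (ptr v + 2 * l) = hval J r v l)"

lemma static_frame:
  "static r J S i s \<Longrightarrow> frame A B s' s \<Longrightarrow> A \<inter> {0, 1, 4, 5, 6, 7} = {} \<Longrightarrow> B \<inter> {4, 5} = {} \<Longrightarrow> static r J S i s'"
proof -
  assume s: "static r J S i s" and f: "frame A B s' s"
    and AB: "A \<inter> {0, 1, 4, 5, 6, 7} = {}" "B \<inter> {4, 5} = {}"
  from AB have n: "0 \<notin> A" "1 \<notin> A" "4 \<notin> A" "5 \<notin> A" "6 \<notin> A" "7 \<notin> A" "4 \<notin> B" "5 \<notin> B"
    by auto
  show ?thesis
    using s base_frame[OF _ f n(1,2)] n frame_vr[OF f] frame_ar[OF f] by (simp add: static_def)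
qed

definition rep :: "(nat \<Rightarrow> nat) \<Rightarrow> nat set \<Rightarrow> state \<Rightarrow> bool" where
  "rep K Q s \<longleftrightarrow> (\<forall>v<n. ar s aBest v = (1 / 2) ^ K v) \<and>
     (\<forall>v<n. ar s aQueue v = (if v \<in> Q then (1 / 2) ^ K v else 0)) \<and>
     vr s rM = (\<Sum>v\<in>Q. (1 / 2) ^ K v)"

lemma dijkstra_inv_le: "dijkstra_inv r K0 c K Q F v j \<Longrightarrow> u < n \<Longrightarrow> K u \<le> K0 u"
  unfolding dijkstra_inv_def by (metis less_imp_le order_refl)

lemma dijkstra_inv_finite: "dijkstra_inv r K0 c K Q F v j \<Longrightarrow> finite Q"
  unfolding dijkstra_inv_def by (auto intro: finite_subset)

lemma dijkstra_inv_mod: "dijkstra_inv r K0 c K Q F v j \<Longrightarrow> u \<in> Q \<union> F \<Longrightarrow> K u mod n = u"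
proof -
  assume inv: "dijkstra_inv r K0 c K Q F v j" and u: "u \<in> Q \<union> F"
  then obtain d where "K u = n * d + u"
    unfolding dijkstra_inv_def by blast
  moreover have "u < n"
    using inv u unfolding dijkstra_inv_def by auto
  ultimately show ?thesis by simp
qed

lemma hval_times:
  assumes "v \<le> k"
  shows "(1 / 2) ^ k * hval J r v l =
    (1 / 2) ^ (k + min (n * wgt r v l) (2 ^ Suc J - 1) + nbr v l - v)"
proof -
  define e where "e = k + min (n * wgt r v l) (2 ^ Suc J - 1) + nbr v l"
  have "(1 / 2 :: real) ^ (e - v) * (1 / 2) ^ v = (1 / 2) ^ e"
    using assms by (simp add: power_add[symmetric] e_def)
  then have "(1 / 2 :: real) ^ e / (1 / 2) ^ v = (1 / 2) ^ (e - v)"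
    by (simp add: field_simps)
  moreover have "(1 / 2) ^ k * hval J r v l = (1 / 2) ^ e / (1 / 2) ^ v"
    by (simp add: hval_def e_def power_add)
  ultimately show ?thesis
    by (simp add: e_def)
qed

text \<open>At the clip 2^(J+1) - 1 the candidate key is at least 2^J and so not below the
  neighbour's key: the test comes out as for the true weight. Conversely, an edge that is not
  relaxed has an unclipped factor.\<close>

lemma relax_test:
  assumes "v \<le> K v" "K (nbr v l) \<le> 2 ^ J"
  shows "(1 / 2) ^ K v * hval J r v l \<le> (1 / 2) ^ K (nbr v l) \<longleftrightarrow> relaxed r K v l"
    and "\<not> relaxed r K v l \<Longrightarrow>
      (1 / 2) ^ K v * hval J r v l = (1 / 2) ^ (K v + n * wgt r v l + nbr v l - v)"
proof -
  let ?x = "nbr v l" and ?g = "n * wgt r v l" and ?m = "2 ^ Suc J - 1 :: nat"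
  have J: "K ?x \<le> ?m"
  proof -
    have "(1::nat) \<le> 2 ^ J" by simp
    then show ?thesis using assms(2) by (simp add: One_nat_def)
  qed
  have iff: "K ?x \<le> K v + min ?g ?m + ?x - v \<longleftrightarrow> relaxed r K v l"
    using J assms(1) unfolding relaxed_def by linarith
  show "(1 / 2) ^ K v * hval J r v l \<le> (1 / 2) ^ K ?x \<longleftrightarrow> relaxed r K v l"
    unfolding hval_times[OF assms(1)] half_power_le_iff iff ..
  assume "\<not> relaxed r K v l"
  then have "?g < ?m"
    using J assms(1) unfolding relaxed_def by linarith
  then show "(1 / 2) ^ K v * hval J r v l = (1 / 2) ^ (K v + n * wgt r v l + nbr v l - v)"
    unfolding hval_times[OF assms(1)] by simp
qed

lemma wp_relax:
  assumes s: "static r J S i s" "v < n" "l < deg v" "vr s rv = real v" "vr s ra = real (ptr v + 2 * l)"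
      "vr s rq = (1 / 2) ^ K v"
    and inv: "dijkstra_inv r K0 c K Q F v l" and cap: "\<And>u. u < n \<Longrightarrow> K0 u \<le> 2 ^ J"
    and rep: "rep K Q s"
    and post: "\<And>s' K' Q'. frame {15, 19, 22} {1, 2} s' s \<Longrightarrow> dijkstra_inv r K0 c K' Q' F v (Suc l) \<Longrightarrow>
      (\<And>u. u \<in> F \<Longrightarrow> K' u = K u) \<Longrightarrow> rep K' Q' s' \<Longrightarrow> tm s' \<le> tm s + 100 \<Longrightarrow> P s'"
  shows "wp t relax_com P s"
proof -
  define a where "a = ptr v + 2 * l"
  define x where "x = nbr v l"
  have base: "base s" using s(1) by (simp add: static_def)
  have x: "x < n" unfolding x_def by (rule nbr_less[OF s(2,3)])
  have low: "lo s a = real x" "a < bnd s" "vr s ra = real a"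
    using base_low(3,5)[OF base s(2,3)] s(5) by (simp_all add: a_def x_def)
  have h: "ar s aEdge a = hval J r v l"
    using s by (simp add: static_def a_def)
  have vF: "v \<in> F"
    using inv s(2) by (simp add: dijkstra_inv_def)
  then have vK: "v \<le> K v"
    using dijkstra_inv_ge[OF inv] by simp
  have Kx: "K (nbr v l) \<le> 2 ^ J"
    using dijkstra_inv_le[OF inv x] cap[OF x] by (simp add: x_def)
  note T = relax_test[of v K l J r, OF vK Kx, folded x_def]
  have Px: "ar s aBest x = (1 / 2) ^ K x" "ar s aQueue x = (if x \<in> Q then (1 / 2) ^ K x else 0)"
    "vr s rM = (\<Sum>v\<in>Q. (1 / 2) ^ K v)"
    using rep x by (simp_all add: rep_def)
  show ?thesis
  proof (cases "relaxed r K v l")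
    case True
    have "P s'" if "frame {15, 19, 22} {} s' s" "vr s' 15 = vr s 15" "tm s' \<le> tm s + 100" for s'
    proof (rule post[of s' K Q])
      show "frame {15, 19, 22} {1, 2} s' s"
        by (rule frame_mono[OF that(1)]) auto
      show "rep K Q s'"
        using rep frame_ar[OF that(1)] that(2) by (simp add: rep_def)
    qed (use dijkstra_inv_skip[OF inv s(2) True] that in simp_all)
    note P = this
    show ?thesis
      unfolding relax_com_def using low h T(1) True s(6) Px
      by (simp add: wp_iffs) (rule P, auto simp: frame_def same_vars_def)
  next
    case False
    define k where "k = K v + n * wgt r v l + nbr v l - v"
    note R = dijkstra_inv_relax[OF inv s(2,3) False, folded x_def, folded k_def[unfolded x_def[symmetric]]]
    have w: "(1 / 2) ^ K v * hval J r v l = (1 / 2) ^ k"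
      using T(2)[OF False] by (simp add: k_def x_def)
    have fin: "finite Q"
      using dijkstra_inv_finite[OF inv] .
    have sum: "(\<Sum>v\<in>insert x Q. (1 / 2 :: real) ^ (K(x := k)) v) =
        (\<Sum>v\<in>Q. (1 / 2) ^ K v) - (if x \<in> Q then (1 / 2) ^ K x else 0) + (1 / 2) ^ k"
    proof -
      have "(\<Sum>v\<in>insert x Q. (1 / 2 :: real) ^ (K(x := k)) v) = (1 / 2) ^ k + (\<Sum>v\<in>Q - {x}. (1 / 2) ^ (K(x := k)) v)"
        using fin by (simp add: sum.insert_remove)
      also have "(\<Sum>v\<in>Q - {x}. (1 / 2 :: real) ^ (K(x := k)) v) = (\<Sum>v\<in>Q - {x}. (1 / 2) ^ K v)"
        by (intro sum.cong) auto
      also have "\<dots> = (\<Sum>v\<in>Q. (1 / 2) ^ K v) - (if x \<in> Q then (1 / 2) ^ K x else 0)"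
        using fin by (simp add: sum_diff1)
      finally show ?thesis by simp
    qed
    have "P s'" if "frame {15, 19, 22} {1, 2} s' s"
      "vr s' 15 = (\<Sum>v\<in>Q. (1 / 2) ^ K v) - (if x \<in> Q then (1 / 2) ^ K x else 0) + (1 / 2) ^ k"
      "ar s' 1 = (ar s 1)(x := (1 / 2) ^ k)" "ar s' 2 = (ar s 2)(x := (1 / 2) ^ k)"
      "tm s' \<le> tm s + 100" for s'
    proof (rule post[OF that(1) R(1) _ _ that(5)])
      show "rep (K(x := k)) (insert x Q) s'"
        using rep that(2-4) sum by (simp add: rep_def)
    qed (use R(2) in auto)
    note P = this
    show ?thesis
      unfolding relax_com_def using low h T(1) False s(6) Px w
      by (simp add: wp_iffs) (intro conjI impI P, auto simp: frame_def same_vars_def)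
  qed
qed

section \<open>Labels, uncertain distances and one full trial\<close>

definition uncertain :: "real \<Rightarrow> nat set \<Rightarrow> (nat \<Rightarrow> nat) \<Rightarrow> bool" where
  "uncertain S F K \<longleftrightarrow> (\<exists>v\<in>F. S < real (K v div n) \<and> real (K v div n) \<le> S + real n)"

text \<open>\<open>lab0\<close> and \<open>ok0\<close> are the values when the current center
  started: labels given by earlier centers are kept, and an uncertain distance among the finished
  vertices clears the flag.\<close>

definition labels :: "nat \<Rightarrow> real \<Rightarrow> (nat \<Rightarrow> real) \<Rightarrow> real \<Rightarrow> nat set \<Rightarrow> (nat \<Rightarrow> nat) \<Rightarrow> state \<Rightarrow> bool" where
  "labels i S lab0 ok0 F K s \<longleftrightarrow>
     (\<forall>v<n. ar s aLab v = (if v \<in> F \<and> real (K v div n) \<le> S \<and> lab0 v < 0 then real i else lab0 v)) \<and>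
     vr s rok = (if uncertain S F K then 0 else ok0)"

lemma labels_frame:
  assumes "labels i S lab0 ok0 F K s" "ar s' 3 = ar s 3" "vr s' 16 = vr s 16" "\<And>u. u \<in> F \<Longrightarrow> K' u = K u"
  shows "labels i S lab0 ok0 F K' s'"
proof -
  have "uncertain S F K' = uncertain S F K"
    using assms(4) by (simp add: uncertain_def)
  moreover have "(v \<in> F \<and> real (K' v div n) \<le> S \<and> lab0 v < 0) = (v \<in> F \<and> real (K v div n) \<le> S \<and> lab0 v < 0)" for v
    using assms(4)[of v] by auto
  ultimately show ?thesis
    using assms(1-3) unfolding labels_def by simp
qed

lemma wp_label:
  assumes s: "static r J S i s" "vr s rv = real v" "v < n" "v \<notin> F" "vr s rd = real (K v div n)"
    and lab: "labels i S lab0 ok0 F K s"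
    and post: "\<And>s'. frame {16} {3} s' s \<Longrightarrow> labels i S lab0 ok0 (insert v F) K s' \<Longrightarrow> tm s' \<le> tm s + 50 \<Longrightarrow> P s'"
  shows "wp t label_com P s"
proof -
  have b: "vr s 0 = real n" "vr s 4 = S" "vr s 7 = real i"
    using s(1) base_vr(1) by (auto simp: static_def)
  have l: "ar s 3 v = lab0 v"
    using lab s(3,4) by (simp add: labels_def)
  have unc: "uncertain S (insert v F) K \<longleftrightarrow>
      uncertain S F K \<or> S < real (K v div n) \<and> real (K v div n) \<le> S + real n"
    by (auto simp: uncertain_def)
  have P: "P s'" if "frame {16} {3} s' s"
    "vr s' 16 = (if S < real (K v div n) \<and> real (K v div n) \<le> S + real n then 0 else vr s 16)"
    "ar s' 3 = (if real (K v div n) \<le> S \<and> lab0 v < 0 then (ar s 3)(v := real i) else ar s 3)"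
    "tm s' \<le> tm s + 50" for s'
  proof (rule post[OF that(1) _ that(4)])
    show "labels i S lab0 ok0 (insert v F) K s'"
      using lab that(2,3) l s(3,4) unfolding labels_def unc by auto
  qed
  show ?thesis
    unfolding label_com_def using s(2,5) b l
    by (simp add: wp_iffs) (intro conjI impI P, auto simp: frame_def same_vars_def)
qed

definition work_vars :: "nat set" where
  "work_vars = {8, 9, 10, 11, 13, 14, 15, 16, 17, 18, 19, 22}"

lemma wp_pop:
  assumes st: "static r J S i s"
    and inv: "dijkstra_inv r K0 c K Q F n 0" and cap: "\<And>u. u < n \<Longrightarrow> K0 u \<le> 2 ^ J"
    and rep: "rep K Q s" and Q: "Q \<noteq> {}" and lab: "labels i S lab0 ok0 F K s"
    and post: "\<And>s' K' Q' v. frame work_vars {1, 2, 3} s' s \<Longrightarrow>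
      dijkstra_inv r K0 c K' Q' (insert v F) n 0 \<Longrightarrow> v \<notin> F \<Longrightarrow> v < n \<Longrightarrow> rep K' Q' s' \<Longrightarrow>
      labels i S lab0 ok0 (insert v F) K' s' \<Longrightarrow> tm s' \<le> tm s + 300 * Suc J + 200 * deg v \<Longrightarrow> P s'"
  shows "wp t pop_com P s"
proof -
  note fin = dijkstra_inv_finite[OF inv]
  have base: "base s" and b: "vr s 0 = real n" "vr s 5 = real J" "vr s 6 = 2 ^ J"
      "\<And>j. j \<le> J \<Longrightarrow> ar s 5 j = (1 / 2) ^ 2 ^ j"
    using st base_vr(1) by (auto simp: static_def)
  have "Min (K ` Q) \<in> K ` Q"
    using fin Q by (intro Min_in) auto
  then obtain v where v: "v \<in> Q" "K v = Min (K ` Q)"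
    by force
  have min: "\<forall>x\<in>Q. K v \<le> K x"
    using fin by (auto simp: v(2))
  have vn: "v < n" and vF: "v \<notin> F" and less: "K v < K0 v"
    using inv v(1) unfolding dijkstra_inv_def by auto
  have modn: "K v mod n = v"
    using dijkstra_inv_mod[OF inv] v(1) by simp
  \<comment> \<open>A key determines its vertex as the remainder modulo n, so queued keys are
    distinct.\<close>
  have inj: "inj_on K Q"
    by (rule inj_on_inverseI[where g = "\<lambda>k. k mod n"]) (use dijkstra_inv_mod[OF inv] in simp)
  note lead = leading_power[OF fin inj v(1) min]
  have M: "vr s 15 = (\<Sum>x\<in>Q. (1 / 2) ^ K x)"
    using rep by (simp add: rep_def)
  have Kv: "K v < 2 ^ Suc J"
    using less cap[OF vn] by simp
  have rest: "wp t label_com (wp t (each_edge relax_com) P) s3"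
    if f3: "frame {8, 9, 13, 14, 15, 17, 18} {2} s3 s" and v3: "vr s3 9 = real v" "vr s3 13 = (1 / 2) ^ K v"
      "vr s3 18 = real (K v div n)" and rep3: "rep K (Q - {v}) s3"
      and t3: "tm s3 \<le> tm s + 76 * Suc J + 70" for s3
  proof (rule wp_label[where i = i and v = v and K = K and F = F and S = S and ?ok0.0 = ok0 and ?lab0.0 = lab0 and r = r and J = J], goal_cases)
    case 1
    show ?case by (rule static_frame[OF st f3]) auto
  next
    case 6
    show ?case
      by (rule labels_frame[OF lab]) (use frame_ar[OF f3, of 3] frame_vr[OF f3, of 16] in simp_all)
  next
    case (7 s4)
    have f4: "frame work_vars {1, 2, 3} s4 s"
      by (rule frame_trans[OF 7(1) f3]) (auto simp: work_vars_def)
    have v4: "vr s4 9 = real v" "vr s4 13 = (1 / 2) ^ K v"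
      using v3 frame_vr[OF 7(1)] by simp_all
    have rep4: "rep K (Q - {v}) s4"
      using rep3 frame_vr[OF 7(1)] frame_ar[OF 7(1)] by (simp add: rep_def)
    have st4: "static r J S i s4"
      by (rule static_frame[OF st f4]) (auto simp: work_vars_def)
    define I where "I l s' \<longleftrightarrow> frame {10, 11, 15, 19, 22} {1, 2} s' s4 \<and> vr s' 10 = real (ptr v + 2 * l) \<and>
      vr s' 11 = real (ptr v + 2 * deg v) \<and> (\<exists>K' Q'. dijkstra_inv r K0 c K' Q' (insert v F) v l \<and>
        (\<forall>u\<in>insert v F. K' u = K u) \<and> rep K' Q' s') \<and> tm s' \<le> tm s4 + 14 + 114 * l" for l s'
    show ?case
    proof (rule wp_each_edge[where Inv = I and v = v], goal_cases)
      case 1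
      show ?case using st4 by (simp add: static_def)
    next
      case (4 s')
      have "rep K (Q - {v}) s'"
        using rep4 frame_vr[OF 4(1)] frame_ar[OF 4(1)] by (simp add: rep_def)
      moreover have "frame {10, 11, 15, 19, 22} {1, 2} s' s4"
        by (rule frame_mono[OF 4(1)]) auto
      ultimately show ?case
        using 4 dijkstra_inv_pop[OF inv v(1) min] unfolding I_def by auto
    next
      case (5 l s')
      then show ?case by (simp add: I_def)
    next
      case (6 l s')
      then obtain K' Q' where i6: "dijkstra_inv r K0 c K' Q' (insert v F) v l"
        "\<forall>u\<in>insert v F. K' u = K u" "rep K' Q' s'" and f6: "frame {10, 11, 15, 19, 22} {1, 2} s' s4"
        unfolding I_def by blast
      show ?case
      proof (rule wp_relax[where v = v and l = l and K = K' and Q = Q' and F = "insert v F" and ?K0.0 = K0 and c = c and r = r and J = J and S = S and i = i], goal_cases)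
        case 1
        show ?case by (rule static_frame[OF st4, of "{10, 11, 15, 19, 22}" "{1, 2}"]) (use f6 in auto)
      next
        case 7
        show ?case by (rule i6)
      next
        case (8 u)
        then show ?case by (rule cap)
      next
        case 9
        show ?case using i6(3) by (simp add: rep_def)
      next
        case (10 s5 K'' Q'')
        have f: "frame {10, 11, 15, 19, 22} {1, 2} s5 s4"
          using frame_trans[OF 10(1)[unfolded frame_tm'] f6, of "{10, 11, 15, 19, 22}" "{1, 2}"] by auto
        have "I (Suc l) (s5\<lparr>vr := (vr s5)(10 := real (ptr v + 2 * Suc l)), tm := tm s5 + 6\<rparr>)"
          unfolding I_def
        proof (intro conjI exI)
          show "frame {10, 11, 15, 19, 22} {1, 2} (s5\<lparr>vr := (vr s5)(10 := real (ptr v + 2 * Suc l)), tm := tm s5 + 6\<rparr>) s4"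
            using f by (simp add: frame_def same_vars_def)
          show "dijkstra_inv r K0 c K'' Q'' (insert v F) v (Suc l)" by (rule 10(2))
          show "\<forall>u\<in>insert v F. K'' u = K u" using 10(3) i6(2) by simp
          show "rep K'' Q'' (s5\<lparr>vr := (vr s5)(10 := real (ptr v + 2 * Suc l)), tm := tm s5 + 6\<rparr>)"
            using 10(4) by (simp add: rep_def)
        qed (use 6(2) frame_vr[OF 10(1), of 11] 10(5) in \<open>simp_all add: I_def\<close>)
        moreover have "vr s5 10 = real (ptr v + 2 * l)"
          using 6(2) frame_vr[OF 10(1), of 10] by (simp add: I_def)
        ultimately show ?case by simp
      qed (use 6 vn i6(2) v4 frame_vr[OF f6] in \<open>simp_all add: I_def\<close>)
    next
      case (7 s')
      then obtain K' Q' where i7: "dijkstra_inv r K0 c K' Q' (insert v F) v (deg v)"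
        "\<forall>u\<in>insert v F. K' u = K u" "rep K' Q' s'" and f7: "frame {10, 11, 15, 19, 22} {1, 2} s' s4"
        unfolding I_def by blast
      show ?case
      proof (rule post[of _ K' Q' v], goal_cases)
        case 1
        show ?case
          unfolding frame_tm by (rule frame_trans[OF f7 f4]) (auto simp: work_vars_def)
      next
        case 2
        show ?case by (rule dijkstra_inv_finish[OF i7(1) vn])
      next
        case 5
        show ?case using i7(3) by (simp add: rep_def)
      next
        case 6
        show ?case
          by (rule labels_frame[OF \<open>labels i S lab0 ok0 (insert v F) K s4\<close>])
            (use i7(2) frame_ar[OF f7] frame_vr[OF f7] in auto)
      next
        case 7
        show ?case
          using \<open>I (deg v) s'\<close> \<open>tm s4 \<le> tm s3 + 50\<close> t3 by (simp add: I_def)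
      qed (rule vF, rule vn)
    qed (rule vn, rule v4)
  qed (use v3 vn vF in simp_all)
  have n: "real n \<noteq> 0"
    using vn by simp
  have dm: "real (K v) - real n * real (K v div n) = real v"
  proof -
    have "real (n * (K v div n) + K v mod n) = real (K v)"
      by (simp only: mult_div_mod_eq)
    then show ?thesis
      using modn by simp
  qed
  have fl: "of_int \<lfloor>real (K v) / real n\<rfloor> = real (K v div n)"
    by (simp add: floor_divide_of_nat_eq)
  have Qv: "ar s 2 v = (1 / 2) ^ K v"
    using rep v(1) vn by (simp add: rep_def)
  show ?thesis
    unfolding pop_com_def wp_Seq_iff
  proof (rule wp_greedy[where J = J and Pr = "\<lambda>k. k \<le> K v"], goal_cases)
    case (4 vr' tm' j k)
    have "vr' 15 = (\<Sum>x\<in>Q. (1 / 2) ^ K x)"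
      using same_varsD[OF 4(2), of 15] M by simp
    then show ?case
      using 4 b(4) lead[of "k + 2 ^ j"] by (simp add: power_add)
  next
    case (7 vr' tm' k)
    have k: "k = K v"
      using 7(4) 7(6)[OF Kv] by simp
    have v': "vr' 0 = real n" "vr' 15 = vr s 15"
      using same_varsD[OF 7(1), of 0] same_varsD[OF 7(1), of 15] b by simp_all
    show ?case
      using 7(2,3) v' fl dm Qv n unfolding k
    proof (simp add: wp_iffs, intro rest, goal_cases)
      case 1
      then show ?case
        using 7(1) by (simp add: frame_def same_vars_def)
    next
      case 5
      then show ?case
        using rep fin v(1) by (simp add: rep_def sum_diff1 M)
    next
      case 6
      then show ?case
        using 7(7) by simp
    qed simp_all
  qed (use b in simp_all)
qed

lemma wp_center:
  assumes st: "static r J S i s" and i: "ar s aPerm i = real c" "c < n"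
    and K0: "consistent r K0" "c < K0 c" and cap: "\<And>u. u < n \<Longrightarrow> K0 u \<le> 2 ^ J"
    and arrs: "\<And>v. v < n \<Longrightarrow> ar s aTag v = (1 / 2) ^ v \<and> ar s aBest v = (1 / 2) ^ K0 v \<and> ar s aQueue v = 0"
    and post: "\<And>s' K F. frame work_vars {1, 2, 3} s' s \<Longrightarrow> dijkstra_inv r K0 c K {} F n 0 \<Longrightarrow>
      (\<And>v. v < n \<Longrightarrow> ar s' aBest v = (1 / 2) ^ K v \<and> ar s' aQueue v = 0) \<Longrightarrow>
      labels i S (ar s aLab) (vr s rok) F K s' \<Longrightarrow>
      tm s' \<le> tm s + 100 + (\<Sum>v\<in>F. 350 * Suc J + 200 * deg v) \<Longrightarrow> P s'"
  shows "wp t center_com P s"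
proof -
  \<comment> \<open>Every extraction finishes a new vertex, so the number of unfinished vertices is
    the loop variant.\<close>
  define I where "I k s' \<longleftrightarrow> frame work_vars {1, 2, 3} s' s \<and> (\<exists>K Q F. dijkstra_inv r K0 c K Q F n 0 \<and>
    rep K Q s' \<and> labels i S (ar s aLab) (vr s rok) F K s' \<and> k + card F = n \<and>
    tm s' \<le> tm s + 60 + (\<Sum>v\<in>F. 350 * Suc J + 200 * deg v))" for k s'
  have loop: "wp t (While (Arr aTab (V rJ)) (V rM) pop_com) P s0" if "I n s0" for s0
    using that
  proof (rule wp_While_index[where Inv = I and k = n], goal_cases)
    case (1 k s')
    then have "frame work_vars {1, 2, 3} s' s" by (simp add: I_def)
    from frame_vr[OF this, of 5] show ?case
      using st by (simp add: static_def work_vars_def)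
  next
    case (2 k s')
    then obtain K Q F where inv: "dijkstra_inv r K0 c K Q F n 0" and rep: "rep K Q s'"
      and lab: "labels i S (ar s aLab) (vr s rok) F K s'" and kF: "k + card F = n"
      and t: "tm s' \<le> tm s + 60 + (\<Sum>v\<in>F. 350 * Suc J + 200 * deg v)"
      and f: "frame work_vars {1, 2, 3} s' s"
      unfolding I_def by blast
    have st': "static r J S i s'"
      by (rule static_frame[OF st f]) (auto simp: work_vars_def)
    have Q: "Q \<noteq> {}"
    proof
      assume "Q = {}"
      then have "(1 / 2 :: real) ^ 2 ^ J \<le> 0"
        using 2(2) rep st' by (simp add: rep_def static_def)
      moreover have "(0 :: real) < (1 / 2) ^ 2 ^ J"
        by simp
      ultimately show False by linarith
    qed
    have finF: "finite F"
      using inv by (auto simp: dijkstra_inv_def intro: finite_subset)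
    show ?case
    proof (rule wp_pop[where r = r and J = J and S = S and i = i and K = K and Q = Q and F = F and ?K0.0 = K0 and c = c and ?lab0.0 = "ar s aLab" and ?ok0.0 = "vr s rok"], goal_cases)
      case 1
      show ?case by (rule static_frame[OF st', of "{}" "{}"]) auto
    next
      case 2
      show ?case by (rule inv)
    next
      case (3 u)
      then show ?case by (rule cap)
    next
      case 4
      show ?case using rep by (simp add: rep_def)
    next
      case 5
      show ?case by (rule Q)
    next
      case 6
      show ?case using lab by (simp add: labels_def)
    next
      case (7 s'' K' Q' v)
      have "card (insert v F) = Suc (card F)"
        using finF 7(3) by simp
      moreover have "card (insert v F) \<le> n"
        using card_mono[of "{..<n}" "insert v F"] 7(2) by (auto simp: dijkstra_inv_def)
      ultimately have k: "k - 1 < k" "k - 1 + card (insert v F) = n"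
        using kF by (simp_all add: One_nat_def)
      have "I (k - 1) s''"
        unfolding I_def
      proof (intro conjI exI)
        show "frame work_vars {1, 2, 3} s'' s"
          using frame_trans[OF 7(1)[unfolded frame_tm'] f] by auto
        show "tm s'' \<le> tm s + 60 + (\<Sum>v\<in>insert v F. 350 * Suc J + 200 * deg v)"
          using 7(7) t finF 7(3) by simp
      qed (use 7 k in simp_all)
      with k(1) show ?case by blast
    qed
  next
    case (3 k s')
    then obtain K Q F where inv: "dijkstra_inv r K0 c K Q F n 0" and rep: "rep K Q s'"
      and lab: "labels i S (ar s aLab) (vr s rok) F K s'"
      and t: "tm s' \<le> tm s + 60 + (\<Sum>v\<in>F. 350 * Suc J + 200 * deg v)"
      and f: "frame work_vars {1, 2, 3} s' s"
      unfolding I_def by blast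
    have st': "static r J S i s'"
      by (rule static_frame[OF st f]) (auto simp: work_vars_def)
    have "Q = {}"
    proof (rule ccontr)
      assume "Q \<noteq> {}"
      then obtain v where v: "v \<in> Q" by blast
      then have "v < n" "K v < K0 v"
        using inv unfolding dijkstra_inv_def by auto
      then have "K v \<le> 2 ^ J"
        using cap[of v] by simp
      then have "(1 / 2 :: real) ^ 2 ^ J \<le> (1 / 2) ^ K v"
        by (simp only: half_power_le_iff)
      also have "\<dots> \<le> (\<Sum>v\<in>Q. (1 / 2) ^ K v)"
        using dijkstra_inv_finite[OF inv] v by (intro member_le_sum) auto
      finally show False
        using 3(2) rep st' by (simp add: rep_def static_def)
    qed
    show ?case
    proof (rule post[of _ K F], goal_cases)
      case (3 v)
      then show ?case using rep \<open>Q = {}\<close> by (simp add: rep_def)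
    next
      case 4
      show ?case using lab by (simp add: labels_def)
    qed (use inv f t \<open>Q = {}\<close> in simp_all)
  qed
  have b: "vr s 7 = real i"
    using st by (simp add: static_def)
  have I0: "I n s0" if f: "frame {9, 15} {1, 2} s0 s" and "vr s0 15 = (1 / 2) ^ c"
    "ar s0 1 = (ar s 1)(c := (1 / 2) ^ c)" "ar s0 2 = (ar s 2)(c := (1 / 2) ^ c)" "tm s0 \<le> tm s + 60" for s0
    unfolding I_def
  proof (intro conjI exI)
    show "frame work_vars {1, 2, 3} s0 s"
      by (rule frame_mono[OF f]) (auto simp: work_vars_def)
    show "dijkstra_inv r K0 c (K0(c := c)) {c} {} n 0"
      by (rule dijkstra_inv_init[OF i(2) K0])
    show "rep (K0(c := c)) {c} s0"
      using that(2-4) arrs by (simp add: rep_def)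
    show "labels i S (ar s 3) (vr s 16) {} (K0(c := c)) s0"
      using frame_vr[OF f, of 16] frame_ar[OF f, of 3] by (simp add: labels_def uncertain_def)
  qed (use that in simp_all)
  show ?thesis
    unfolding center_com_def using i b arrs[OF i(2)]
    by (simp add: wp_iffs) (intro loop I0, auto simp: frame_def same_vars_def)
qed

text \<open>A distance in this range may belong to a true distance on either side of the radius.\<close>

definition bad :: "real \<Rightarrow> real \<Rightarrow> bool" where
  "bad r S \<longleftrightarrow> (\<exists>u<n. \<exists>v<n. \<exists>d. iwalk adj r u v d \<and> (\<forall>d'. iwalk adj r u v d' \<longrightarrow> d \<le> d') \<and>
     S < real d \<and> real d \<le> S + real n)"

text \<open>The gap between S and S + n absorbs the rounding: center \<open>j\<close> is certainly
  within the radius, and all earlier centers certainly are not.\<close>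

definition labelled :: "real \<Rightarrow> real \<Rightarrow> nat list \<Rightarrow> nat \<Rightarrow> nat \<Rightarrow> nat \<Rightarrow> bool" where
  "labelled r S \<pi> i v j \<longleftrightarrow> j < i \<and> (\<exists>d. iwalk adj r (\<pi> ! j) v d \<and> real d \<le> S) \<and>
     (\<forall>j'<j. \<forall>d. iwalk adj r (\<pi> ! j') v d \<longrightarrow> S + real n < real d)"

definition status :: "real \<Rightarrow> real \<Rightarrow> nat list \<Rightarrow> nat \<Rightarrow> (nat \<Rightarrow> real) \<Rightarrow> real \<Rightarrow> bool" where
  "status r S \<pi> i lab ok \<longleftrightarrow> ok = 0 \<and> bad r S \<or>
     ok = 1 \<and> (\<forall>v<n. lab v = - 1 \<and> (\<forall>j<i. \<forall>d. iwalk adj r (\<pi> ! j) v d \<longrightarrow> S + real n < real d) \<or>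
       (\<exists>j. lab v = real j \<and> labelled r S \<pi> i v j))"

text \<open>The delicate case is a vertex that is pruned in this run and still unlabelled. A walk of
  length at most S + n from the new center would have a key below the cap, so the old key would stem
  from an earlier center at most as far, although all of these lie beyond S + n. Conversely, a
  cleared flag always implies \<open>bad\<close>, an event that does not mention the
  permutation.\<close>

lemma status_step:
  assumes st: "status r S \<pi> i lab0 ok0" and out: "outer_inv r (2 ^ J) \<pi> i K0" and c: "\<pi> ! i < n"
    and inv: "dijkstra_inv r K0 (\<pi> ! i) K {} F n 0" and lab: "labels i S lab0 ok0 F K s"
    and B: "real n * (S + real n + 2) < 2 ^ J"
  shows "status r S \<pi> (Suc i) (ar s aLab) (vr s rok)"
proof -
  note e = dijkstra_inv_end[OF inv]
  have n: "0 < n" using c by simp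
  have F: "iwalk adj r (\<pi> ! i) v (K v div n) \<and> (\<forall>d'. iwalk adj r (\<pi> ! i) v d' \<longrightarrow> K v div n \<le> d') \<and> v < n"
    if vF: "v \<in> F" for v
  proof -
    obtain d where d: "iwalk adj r (\<pi> ! i) v d" "K v = n * d + v"
      using e(5)[OF vF] by blast
    have v: "v < n"
      using vF inv by (auto simp: dijkstra_inv_def)
    then have kd: "K v div n = d"
      using d(2) by simp
    have "d \<le> d'" if "iwalk adj r (\<pi> ! i) v d'" for d'
    proof -
      have "n * d \<le> n * d'"
        using e(2)[OF that] d(2) by simp
      then show ?thesis using n by simp
    qed
    then show ?thesis
      using d(1) v by (simp add: kd)
  qed
  have lab': "ar s 3 v = (if v \<in> F \<and> real (K v div n) \<le> S \<and> lab0 v < 0 then real i else lab0 v)" if "v < n" for v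
    using lab that by (simp add: labels_def)
  have ok': "vr s 16 = (if uncertain S F K then 0 else ok0)"
    using lab by (simp add: labels_def)
  show ?thesis
  proof (cases "ok0 = 0 \<or> uncertain S F K")
    case True
    have "bad r S"
    proof (cases "ok0 = 0")
      case True
      then show ?thesis using st by (simp add: status_def)
    next
      case False
      then obtain v where v: "v \<in> F" "S < real (K v div n)" "real (K v div n) \<le> S + real n"
        using \<open>ok0 = 0 \<or> uncertain S F K\<close> by (auto simp: uncertain_def)
      show ?thesis
        unfolding bad_def using F[OF v(1)] v c by blast
    qed
    then show ?thesis
      using True ok' by (auto simp: status_def)
  next
    case False
    then have ok: "vr s 16 = 1" and st': "\<And>v. v < n \<Longrightarrow> lab0 v = - 1 \<and>
        (\<forall>j<i. \<forall>d. iwalk adj r (\<pi> ! j) v d \<longrightarrow> S + real n < real d) \<or>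
       (\<exists>j. lab0 v = real j \<and> labelled r S \<pi> i v j)"
      using st ok' by (auto simp: status_def)
    have "ar s 3 v = - 1 \<and> (\<forall>j<Suc i. \<forall>d. iwalk adj r (\<pi> ! j) v d \<longrightarrow> S + real n < real d) \<or>
       (\<exists>j. ar s 3 v = real j \<and> labelled r S \<pi> (Suc i) v j)" if v: "v < n" for v
      using st'[OF v]
    proof (elim disjE conjE exE)
      fix j assume j: "lab0 v = real j" "labelled r S \<pi> i v j"
      then have "ar s 3 v = real j"
        using lab'[OF v] by simp
      moreover have "labelled r S \<pi> (Suc i) v j"
        using j(2) by (simp add: labelled_def)
      ultimately show ?thesis by blast
    next
      assume l: "lab0 v = - 1" and far: "\<forall>j<i. \<forall>d. iwalk adj r (\<pi> ! j) v d \<longrightarrow> S + real n < real d"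
      show ?thesis
      proof (cases "v \<in> F")
        case True
        note Fv = F[OF True]
        show ?thesis
        proof (cases "real (K v div n) \<le> S")
          case le: True
          then have "ar s 3 v = real i"
            using lab'[OF v] True l by simp
          moreover have "labelled r S \<pi> (Suc i) v i"
            unfolding labelled_def using Fv le far by auto
          ultimately show ?thesis by blast
        next
          case gt: False
          then have "S + real n < real (K v div n)"
            using False True by (auto simp: uncertain_def)
          then have "S + real n < real d" if "iwalk adj r (\<pi> ! i) v d" for d
            using Fv that by (meson less_le_trans of_nat_le_iff)
          then show ?thesis
            using lab'[OF v] gt l far by (simp add: less_Suc_eq)
        qed
      next
        case notin: False
        have "S + real n < real d" if w: "iwalk adj r (\<pi> ! i) v d" for d
        proof (rule ccontr)
          assume "\<not> S + real n < real d"
          then have "real n * (real d + 1) \<le> real n * (S + real n + 2)"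
            by (intro mult_left_mono) auto
          with B have "real (n * (d + 1)) < real (2 ^ J)"
            by simp
          then have "n * (d + 1) < 2 ^ J"
            unfolding of_nat_less_iff .
          then have "n * d + v < 2 ^ J"
            using v by (simp add: distrib_left)
          moreover have "K0 v \<le> n * d + v"
            using e(2)[OF w] e(4)[OF v notin] by simp
          ultimately have "K0 v < 2 ^ J"
            by simp
          then obtain j d0 where j: "j < i" "iwalk adj r (\<pi> ! j) v d0" "K0 v = n * d0 + v"
            using out v unfolding outer_inv_def by metis
          then have "n * d0 \<le> n * d"
            using \<open>K0 v \<le> n * d + v\<close> by simp
          then have "real d0 \<le> real d"
            using n by simp
          moreover have "S + real n < real d0"
            using far j by blast
          ultimately show False
            using \<open>\<not> S + real n < real d\<close> by simp
        qed
        then show ?thesis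
          using lab'[OF v] notin l far by (simp add: less_Suc_eq)
      qed
    qed
    then show ?thesis
      using ok by (simp add: status_def)
  qed
qed

text \<open>Every vertex is itself a center at distance 0, and S is nonnegative, so no vertex lies
  beyond S + n from all centers.\<close>

lemma status_final:
  assumes "status r S \<pi> n lab ok" "\<pi> \<in> permutations_of_set {..<n}" "0 \<le> S"
  shows "ok = 0 \<and> bad r S \<or> ok = 1 \<and> (\<forall>v<n. \<exists>j. lab v = real j \<and> labelled r S \<pi> n v j)"
proof -
  have "\<not> (\<forall>j<n. \<forall>d. iwalk adj r (\<pi> ! j) v d \<longrightarrow> S + real n < real d)" if "v < n" for v
  proof
    assume *: "\<forall>j<n. \<forall>d. iwalk adj r (\<pi> ! j) v d \<longrightarrow> S + real n < real d"
    have "v \<in> set \<pi>" "length \<pi> = n"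
      using that permutations_of_setD[OF assms(2)] length_finite_permutations_of_set[OF assms(2)] by simp_all
    then obtain j where j: "j < n" "\<pi> ! j = v"
      by (metis in_set_conv_nth)
    have "iwalk adj r v v 0"
      using that by (intro iwalk_refl) (simp add: length_adj)
    then have "S + real n < real 0"
      using * j by blast
    then show False using assms(3) by simp
  qed
  then show ?thesis
    using assms(1) unfolding status_def by blast
qed

text \<open>\<open>Suc J\<close> multiplies degrees only in the preprocessing sum, where each vertex
  occurs once. In the sum over records it is paid per visit, and the relaxations are charged without
  it. The numbers are generous instruction counts.\<close>

definition attempt_cost :: "real \<Rightarrow> nat list \<Rightarrow> nat \<Rightarrow> nat" where
  "attempt_cost r \<pi> J = 300 + 100 * Suc J + 100 * Suc n + (\<Sum>v<n. 50 + 220 * Suc J * deg v) +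
     (\<Sum>i<n. 150 + (\<Sum>v\<in>records r \<pi> i. 350 * Suc J + 200 * deg v))"

lemma wp_attempt:
  assumes s: "base s" "vr s rU = U" "0 \<le> U" "vr s rN = N" "0 < N"
    and \<pi>: "\<pi> \<in> permutations_of_set {..<n}" "\<And>j. j < n \<Longrightarrow> ar s aPerm j = real (\<pi> ! j)"
    and post: "\<And>s' J. frame {3..22} {1..6} s' s \<Longrightarrow> vr s' rN = 2 * N \<Longrightarrow>
      vr s' rok = 0 \<and> bad (4 * (2 * N) / \<Delta>) (2 * N * (1 + U)) \<or>
      vr s' rok = 1 \<and> (\<forall>v<n. \<exists>j. ar s' aLab v = real j \<and> labelled (4 * (2 * N) / \<Delta>) (2 * N * (1 + U)) \<pi> n v j) \<Longrightarrow>
      J = 0 \<or> 2 ^ J \<le> 2 * (real n * (2 * N * (1 + U) + real n + 2)) \<Longrightarrow>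
      tm s' \<le> tm s + attempt_cost (4 * (2 * N) / \<Delta>) \<pi> J \<Longrightarrow> P s'"
  shows "wp t attempt_com P s"
  unfolding attempt_com_def wp_Seq_iff
proof (rule wp_table[where n = n and U = U and N = N], goal_cases)
  case 1
  show ?case using base_vr(1)[OF s(1)] .
next
  case (4 s1 J)
  let ?r = "4 * (2 * N) / \<Delta>" and ?S = "2 * N * (1 + U)"
  have b1: "base s1"
    using base_frame[OF s(1) 4(1)] by simp
  show ?case
  proof (rule wp_init[where J = J and c = "(1 / 2) ^ 2 ^ J"], goal_cases)
    case (4 s2)
    note f12 = 4(1)
    have b2: "base s2"
      using base_frame[OF b1 f12] by simp
    note v2 = frame_vr[OF f12] and a2 = frame_ar[OF f12]
    show ?case
    proof (rule wp_weights[where J = J and N = "2 * N"], goal_cases)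
      case (8 s3)
      note f23 = 8(1)
      have f13: "frame ({8, 9, 10, 11, 12, 13, 14, 17} \<union> {9, 20}) ({4} \<union> {1, 2, 3, 6}) s3 s1"
        by (rule frame_trans[OF f23 f12]) auto
      have f3: "frame {3..22} {1..6} s3 s"
        by (rule frame_trans[OF f13 \<open>frame {3, 4, 5, 6, 21} {5} s1 s\<close>]) auto
      have b3: "base s3"
        using base_frame[OF b2 f23] by simp
      have tab3: "\<forall>j\<le>J. ar s3 5 j = (1 / 2) ^ 2 ^ j"
        using frame_ar[OF f13, of 5] \<open>\<And>j. j \<le> J \<Longrightarrow> ar s1 5 j = (1 / 2) ^ 2 ^ j\<close> by simp
      have v3: "vr s3 5 = real J" "vr s3 6 = 2 ^ J" "vr s3 4 = ?S" "vr s3 3 = 2 * N"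
        using frame_vr[OF f13] \<open>vr s1 5 = real J\<close> \<open>vr s1 6 = 2 ^ J\<close> \<open>vr s1 4 = ?S\<close> \<open>vr s1 3 = 2 * N\<close> by simp_all
      define I where "I i s' \<longleftrightarrow> frame (insert 7 work_vars) {1, 2, 3} s' s3 \<and> vr s' 7 = real i \<and>
        (\<exists>K. outer_inv ?r (2 ^ J) \<pi> i K \<and> (\<forall>v<n. ar s' 1 v = (1 / 2) ^ K v \<and> ar s' 2 v = 0)) \<and>
        status ?r ?S \<pi> i (ar s' 3) (vr s' 16) \<and>
        tm s' \<le> tm s3 + 10 + (\<Sum>i<i. 120 + (\<Sum>v\<in>records ?r \<pi> i. 350 * Suc J + 200 * deg v))" for i s'
      have stat: "static ?r J ?S i s'" if "I i s'" for i s'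
      proof -
        have f: "frame (insert 7 work_vars) {1, 2, 3} s' s3" and i: "vr s' 7 = real i"
          using that by (simp_all add: I_def)
        have "base s'"
          using base_frame[OF b3 f] by (simp add: work_vars_def)
        then show ?thesis
          using frame_vr[OF f] frame_ar[OF f] v3 tab3 8(2) i
          by (simp add: static_def work_vars_def)
      qed
      have loop: "wp t (For ri (V rn) center_com) P s4" if "I 0 (s4\<lparr>vr := (vr s4)(ri := 0), tm := tm s4 + 3\<rparr>)" for s4
        using that
      proof (rule wp_For[where Inv = I and m = n], goal_cases)
        case (1 i s')
        then show ?case
          using stat[OF 1(2)] base_vr(1) 1(2) by (simp add: I_def static_def)
      next
        case (2 i s')
        then obtain K where K: "outer_inv ?r (2 ^ J) \<pi> i K" "\<forall>v<n. ar s' 1 v = (1 / 2) ^ K v \<and> ar s' 2 v = 0"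
          and f: "frame (insert 7 work_vars) {1, 2, 3} s' s3"
          unfolding I_def by blast
        \<comment> \<open>The cap must be at least n, so that a center not reached so far has a key
          above its own number.\<close>
        have "real n \<le> real n * (?S + real n + 2)"
        proof -
          have "0 \<le> ?S"
            using s by simp
          then have "real n * 1 \<le> real n * (?S + real n + 2)"
            by (intro mult_left_mono) auto
          then show ?thesis by simp
        qed
        then have "real n < 2 ^ J"
          using \<open>real n * (?S + real n + 2) < 2 ^ J\<close> by linarith
        then have "n \<le> 2 ^ J"
          by simp
        note less = outer_inv_less[OF K(1) \<pi>(1) \<open>i < n\<close> this]
        have perm: "ar s' 0 i = real (\<pi> ! i)"
          using frame_ar[OF f, of 0] frame_ar[OF f3, of 0] \<pi>(2)[OF \<open>i < n\<close>] by simp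
        have tag: "ar s' 6 v = (1 / 2) ^ v" if "v < n" for v
          using frame_ar[OF f, of 6] frame_ar[OF f23, of 6] \<open>\<And>v. v < n \<Longrightarrow> ar s2 6 v = _ v \<and> _ v\<close>[OF that] by simp
        show ?case
        proof (rule wp_center[where r = ?r and J = J and S = ?S and i = i and c = "\<pi> ! i" and ?K0.0 = K], goal_cases)
          case 1
          show ?case
            by (rule static_frame[OF stat[OF 2(2)], of "{}" "{}"]) auto
        next
          case 4
          show ?case using K(1) by (simp add: outer_inv_def)
        next
          case (6 u)
          then show ?case using K(1) by (simp add: outer_inv_def)
        next
          case (8 s5 K' F)
          have 7: "vr s5 7 = real i"
            using frame_vr[OF 8(1), of 7] 2(2) by (simp add: I_def work_vars_def)
          note out = outer_inv_step[OF K(1) 8(2)]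
          have "status ?r ?S \<pi> (Suc i) (ar s5 3) (vr s5 16)"
            by (rule status_step[OF _ K(1) less(1) 8(2) 8(4) \<open>real n * (?S + real n + 2) < 2 ^ J\<close>])
              (use 2(2) in \<open>simp add: I_def\<close>)
          moreover have "frame (insert 7 work_vars) {1, 2, 3} s5 s3"
            by (rule frame_trans[OF 8(1)[unfolded frame_tm'] f]) auto
          moreover have "(\<Sum>v\<in>F. 350 * Suc J + 200 * deg v) \<le> (\<Sum>v\<in>records ?r \<pi> i. 350 * Suc J + 200 * deg v)"
            using out(2) by (intro sum_mono2) (auto simp: records_def)
          ultimately show ?case
            using 7 8(3,5) 2(2) out(1)
            unfolding I_def by (auto simp: frame_def same_vars_def)
        qed (use perm less tag K(2) in simp_all)
      next
        case (3 s')
        have f: "frame (insert 7 work_vars) {1, 2, 3} s' s3"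
          using 3 by (simp add: I_def)
        have "attempt_cost ?r \<pi> J \<ge> 270 + 100 * Suc J + 100 * Suc n + (\<Sum>v<n. 50 + 220 * Suc J * deg v) +
            (\<Sum>i<n. 120 + (\<Sum>v\<in>records ?r \<pi> i. 350 * Suc J + 200 * deg v))"
          unfolding attempt_cost_def by (intro add_mono sum_mono) auto
        then have "tm s' + 8 \<le> tm s + attempt_cost ?r \<pi> J"
          using 3 \<open>tm s3 \<le> _\<close> \<open>tm s2 \<le> _\<close> \<open>tm s1 \<le> _\<close> unfolding I_def by linarith
        moreover have "frame {3..22} {1..6} s' s"
          by (rule frame_trans[OF f f3]) (auto simp: work_vars_def)
        moreover have "vr s' 3 = 2 * N"
          using frame_vr[OF f, of 3] v3 by (simp add: work_vars_def)
        moreover have "0 \<le> ?S"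
          using s by simp
        ultimately show ?case
          using 3 status_final[OF _ \<pi>(1), of ?r ?S] \<open>J = 0 \<or> _\<close>
          unfolding I_def by (intro post[of _ J]) simp_all
      qed
      have "status ?r ?S \<pi> 0 (ar s3 3) 1"
        using frame_ar[OF f23, of 3] \<open>\<And>v. v < n \<Longrightarrow> ar s2 6 v = _ v \<and> _ v\<close> by (simp add: status_def)
      moreover have "outer_inv ?r (2 ^ J) \<pi> 0 (\<lambda>_. 2 ^ J)"
        by (rule outer_inv_init)
      moreover have "\<forall>v<n. ar s3 1 v = (1 / 2) ^ 2 ^ J \<and> ar s3 2 v = 0"
        using frame_ar[OF f23] \<open>\<And>v. v < n \<Longrightarrow> ar s2 6 v = _ v \<and> _ v\<close> by simp
      ultimately have "I 0 (s3\<lparr>vr := (vr s3)(16 := 1, 7 := 0), tm := tm s3 + 6\<rparr>)"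
        unfolding I_def by (auto simp: frame_def same_vars_def work_vars_def)
      then show ?case
        by (simp add: wp_iffs) (rule loop, simp add: add.commute)
    qed (use b2 v2 a2 4 s \<open>vr s1 3 = _\<close> \<open>vr s1 5 = _\<close> \<open>vr s1 6 = _\<close> \<open>\<And>j. j \<le> J \<Longrightarrow> ar s1 5 j = (1 / 2) ^ 2 ^ j\<close> in simp_all)
  qed (use b1 4 in simp_all)
qed (use s in simp_all)

section \<open>The shuffle, the repetitions and the complete program\<close>

lemma wp_shuffle:
  assumes s: "base s" "dr s = 0" and t: "\<And>i. 0 \<le> t i \<and> t i < 1"
    and post: "\<And>s'. base s' \<Longrightarrow> dr s' = n \<Longrightarrow> (\<And>j. j < n \<Longrightarrow> ar s' aPerm j = real (tape_perm n t ! j)) \<Longrightarrow>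
      tm s' \<le> tm s + 20 + 60 * n \<Longrightarrow> P s'"
  shows "wp t shuffle_com P s"
proof -
  define f where "f i = min i (digit t i)" for i
  define I where "I i s' \<longleftrightarrow> base s' \<and> vr s' ri = real i \<and> dr s' = i \<and>
    (\<forall>j<i. ar s' aPerm j = real (shuffled f i ! j)) \<and> tm s' \<le> tm s + 10 + 60 * i" for i s'
  show ?thesis
    unfolding shuffle_com_def
  proof (rule wp_For[where Inv = I and m = n], goal_cases)
    case 1
    show ?case using s by (simp add: I_def base_def)
  next
    case (2 i s')
    then show ?case using base_vr(1) by (auto simp: I_def)
  next
    case (3 i s')
    then have b: "base s'" and i: "vr s' 7 = real i" "dr s' = i"
      and perm: "\<forall>j<i. ar s' 0 j = real (shuffled f i ! j)"
      by (simp_all add: I_def)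
    define d where "d = digit t i"
    have d: "d \<le> i" "f i = d"
      using digit_le[of t i] t[of i] by (auto simp: d_def f_def)
    have fl: "of_int \<lfloor>t i * (real i + 1)\<rfloor> = real d" "nat \<lfloor>t i * (real i + 1)\<rfloor> = d"
      using t[of i] by (simp_all add: d_def digit_def add.commute)
    have d0: "0 \<le> t i * (real i + 1)"
      using t[of i] by simp
    have I: "I (Suc i) s''" if "vr s'' 7 = real (Suc i)" "vr s'' 0 = vr s' 0" "vr s'' 1 = vr s' 1"
      "lo s'' = lo s'" "bnd s'' = bnd s'" "dr s'' = Suc i"
      "ar s'' 0 = (ar s' 0)(i := ar s' 0 d, d := real i)" "tm s'' \<le> tm s' + 60" for s''
      unfolding I_def
    proof (intro conjI)
      show "base s''"
        using b that(2-5) by (simp add: base_def)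
      show "\<forall>j<Suc i. ar s'' 0 j = real (shuffled f (Suc i) ! j)"
        using perm d unfolding that(7) by (auto simp: Let_def nth_list_update nth_append less_Suc_eq)
      show "tm s'' \<le> tm s + 10 + 60 * Suc i"
        using that(8) 3(2) by (simp add: I_def)
    qed (use that in simp_all)
    show ?case
      using i fl d0 by (simp add: wp_iffs) (rule I, auto)
  next
    case (4 s')
    then show ?case
      by (intro post) (simp_all add: I_def tape_perm_def f_def[abs_def] base_def)
  qed
qed

text \<open>The \<open>k\<close>-th attempt uses the unit \<open>\<Delta> / (4 * prec (Suc k))\<close>.\<close>

definition prec :: "nat \<Rightarrow> real" where
  "prec k = 2 ^ k * (real n + 1) ^ 3"

definition scale :: "nat \<Rightarrow> real" where
  "scale k = 4 * prec (Suc k) / \<Delta>"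

definition radius :: "real \<Rightarrow> nat \<Rightarrow> real" where
  "radius U k = prec (Suc k) * (1 + U)"

abbreviation failing :: "real \<Rightarrow> nat \<Rightarrow> bool" where
  "failing U k \<equiv> bad (scale k) (radius U k)"

definition lg :: nat where
  "lg = (LEAST l. n + 1 \<le> 2 ^ l)"

lemma lg: "n + 1 \<le> 2 ^ lg"
  unfolding lg_def
  by (rule LeastI[of _ n]) (simp add: Suc_leI less_exp One_nat_def)

lemma prec_Suc: "2 * prec k = prec (Suc k)"
  by (simp add: prec_def)

lemma prec_pos: "0 < prec k"
  by (simp add: prec_def)

text \<open>With m = n + 1 the bound on 2^J becomes 2 * m * 8 * 2^k * m^3 = 2^(k+4) * m^4, and m is
  at most 2^lg. Each repetition thus adds one bit to an initial O(log n).\<close>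

lemma exponent_bound:
  assumes "0 \<le> U" "U \<le> 1" "J = 0 \<or> 2 ^ J \<le> 2 * (real n * (radius U k + real n + 2))"
  shows "J \<le> k + 4 + 4 * lg"
proof (cases "J = 0")
  case False
  define m where "m = real n + 1"
  have m: "1 \<le> m" "real n \<le> m" "real n + 2 \<le> 2 * m" by (simp_all add: m_def)
  have m3: "m \<le> m ^ 3"
    using power_increasing[of 1 3 m] m by simp
  have "radius U k \<le> prec (Suc k) * 2"
    unfolding radius_def using assms prec_pos[of "Suc k"] by (intro mult_left_mono) auto
  also have "\<dots> = 4 * (2 ^ k * m ^ 3)"
    by (simp add: prec_def m_def)
  finally have "radius U k \<le> 4 * (2 ^ k * m ^ 3)" .
  moreover have "real n + 2 \<le> 2 * (2 ^ k * m ^ 3)"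
  proof -
    have "m ^ 3 \<le> 2 ^ k * m ^ 3"
      using mult_right_mono[of 1 "2 ^ k" "m ^ 3"] m by simp
    then show ?thesis using m m3 by linarith
  qed
  ultimately have "radius U k + real n + 2 \<le> 8 * (2 ^ k * m ^ 3)"
    by linarith
  moreover have "0 \<le> radius U k"
    unfolding radius_def using assms prec_pos[of "Suc k"] by simp
  ultimately have "real n * (radius U k + real n + 2) \<le> m * (8 * (2 ^ k * m ^ 3))"
    using m by (intro mult_mono) auto
  then have "2 ^ J \<le> 2 * (m * (8 * (2 ^ k * m ^ 3)))"
    using assms(3) False by simp
  also have "\<dots> = 2 ^ (k + 4) * m ^ 4"
    by (simp add: power_add numeral_eq_Suc)
  also have "\<dots> \<le> 2 ^ (k + 4) * (2 ^ lg) ^ 4"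
  proof -
    have "real (n + 1) \<le> real (2 ^ lg)"
      using lg unfolding of_nat_le_iff .
    then show ?thesis
      using m by (intro mult_left_mono power_mono) (auto simp: m_def add.commute)
  qed
  also have "\<dots> = 2 ^ (k + 4 + 4 * lg)"
    by (simp add: power_add power_mult mult.commute)
  finally show ?thesis
    by simp
qed simp

lemma attempt_cost_mono: "J \<le> J' \<Longrightarrow> attempt_cost r \<pi> J \<le> attempt_cost r \<pi> J'"
  unfolding attempt_cost_def
  by (intro add_mono sum_mono mult_le_mono order_refl) auto

definition cost :: "nat list \<Rightarrow> nat \<Rightarrow> nat" where
  "cost \<pi> k = attempt_cost (scale k) \<pi> (k + 4 + 4 * lg) + 20"

text \<open>\<open>k0\<close> is a trial that cannot fail, so \<open>Suc k0 - k\<close> is a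
  variant. A trial may succeed although \<open>failing\<close> holds, since not every distance is
  met; the final \<open>k\<close> is therefore only known to be preceded by failures, as the cost
  bound requires.\<close>

lemma wp_retry:
  assumes s: "base s" "vr s rU = U" "0 \<le> U" "U \<le> 1" "vr s rN = prec 0" "vr s rok = 0"
    and \<pi>: "\<pi> \<in> permutations_of_set {..<n}" "\<And>j. j < n \<Longrightarrow> ar s aPerm j = real (\<pi> ! j)"
    and ex: "\<not> failing U k0"
    and post: "\<And>s' k. base s' \<Longrightarrow> (\<And>j. j < k \<Longrightarrow> failing U j) \<Longrightarrow>
      (\<And>v. v < n \<Longrightarrow> \<exists>j. ar s' aLab v = real j \<and> labelled (scale k) (radius U k) \<pi> n v j) \<Longrightarrow>
      tm s' \<le> tm s + 20 + (\<Sum>j\<le>k. cost \<pi> j) \<Longrightarrow> P s'"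
  shows "wp t (While (V rok) (Num 0) attempt_com) P s"
proof -
  define I where "I m s' \<longleftrightarrow> base s' \<and> vr s' rU = U \<and> (\<forall>j<n. ar s' aPerm j = real (\<pi> ! j)) \<and>
    ((\<exists>k\<le>k0. m = Suc k0 - k \<and> vr s' rok = 0 \<and> vr s' rN = prec k \<and> (\<forall>j<k. failing U j) \<and>
        tm s' \<le> tm s + (\<Sum>j<k. cost \<pi> j)) \<or>
     (\<exists>k. m = 0 \<and> vr s' rok = 1 \<and> (\<forall>j<k. failing U j) \<and>
        (\<forall>v<n. \<exists>j. ar s' aLab v = real j \<and> labelled (scale k) (radius U k) \<pi> n v j) \<and>
        tm s' \<le> tm s + (\<Sum>j\<le>k. cost \<pi> j)))" for m s'
  show ?thesis
  proof (rule wp_While_index[where Inv = I and k = "Suc k0"], goal_cases)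
    case 1
    have "\<exists>k\<le>k0. Suc k0 = Suc k0 - k \<and> vr s rok = 0 \<and> vr s rN = prec k \<and> (\<forall>j<k. failing U j) \<and>
        tm s \<le> tm s + (\<Sum>j<k. cost \<pi> j)"
      using s by (intro exI[of _ 0]) simp
    then show ?case
      using s \<pi> unfolding I_def by blast
  next
    case (2 m s')
    show ?case by simp
  next
    case (3 m s')
    then have "vr s' rok \<noteq> 1" by auto
    then obtain k where k: "k \<le> k0" "m = Suc k0 - k" "vr s' rok = 0" "vr s' rN = prec k"
        "\<forall>j<k. failing U j" "tm s' \<le> tm s + (\<Sum>j<k. cost \<pi> j)"
      and b: "base s'" "vr s' rU = U" "\<forall>j<n. ar s' aPerm j = real (\<pi> ! j)"
      using 3(1) unfolding I_def by blast
    show ?case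
    proof (rule wp_attempt[where U = U and N = "prec k" and \<pi> = \<pi>], goal_cases)
      case 1
      show ?case using b(1) by (simp add: base_def)
    next
      case (8 s2 J)
      have J: "J \<le> k + 4 + 4 * lg"
        using exponent_bound[of U J k] s(3,4) 8(4) by (simp add: prec_Suc radius_def)
      have c: "tm s2 \<le> tm s' + cost \<pi> k"
        using 8(5) attempt_cost_mono[OF J, of "scale k" \<pi>] by (simp add: cost_def prec_Suc scale_def)
      have f: "frame {3..22} {1..6} s2 s'"
        using 8(1) by simp
      have b2: "base s2" "vr s2 rU = U" "\<forall>j<n. ar s2 aPerm j = real (\<pi> ! j)"
        using base_frame[OF b(1) f] frame_vr[OF f, of 2] frame_ar[OF f, of 0] b by simp_all
      have res: "vr s2 rok = 0 \<and> failing U k \<or> vr s2 rok = 1 \<and>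
          (\<forall>v<n. \<exists>j. ar s2 aLab v = real j \<and> labelled (scale k) (radius U k) \<pi> n v j)"
        using 8(3) unfolding scale_def radius_def prec_Suc .
      show ?case
        using res
      proof (elim disjE conjE)
        assume bad: "vr s2 rok = 0" "failing U k"
        then have "k \<noteq> k0" using ex by blast
        then have less: "Suc k \<le> k0" using k(1) by simp
        have "\<exists>k'\<le>k0. Suc k0 - Suc k = Suc k0 - k' \<and> vr s2 rok = 0 \<and> vr s2 rN = prec k' \<and>
            (\<forall>j<k'. failing U j) \<and> tm s2 \<le> tm s + (\<Sum>j<k'. cost \<pi> j)"
          using less bad 8(2) k c by (intro exI[of _ "Suc k"]) (auto simp: prec_Suc less_Suc_eq)
        then have "I (Suc k0 - Suc k) s2"
          using b2 unfolding I_def by blast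
        then show ?thesis
          using k(2) less by (intro exI[of _ "Suc k0 - Suc k"]) simp
      next
        assume good: "vr s2 rok = 1"
          "\<forall>v<n. \<exists>j. ar s2 aLab v = real j \<and> labelled (scale k) (radius U k) \<pi> n v j"
        have "tm s2 \<le> tm s + (\<Sum>j\<le>k. cost \<pi> j)"
          using c k(6) by (simp add: lessThan_Suc_atMost[symmetric])
        then have "I 0 s2"
          using good b2 k(5) unfolding I_def by blast
        then show ?thesis
          using k by (intro exI[of _ 0]) simp
      qed
    qed (use b k s(3) prec_pos \<pi> in simp_all)
  next
    case (4 m s')
    then have "vr s' rok \<noteq> 0" by auto
    then obtain k where k: "\<forall>j<k. failing U j"
        "\<forall>v<n. \<exists>j. ar s' aLab v = real j \<and> labelled (scale k) (radius U k) \<pi> n v j"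
        "tm s' \<le> tm s + (\<Sum>j\<le>k. cost \<pi> j)" and b: "base s'"
      using 4(1) unfolding I_def by blast
    show ?case
      by (rule post[of _ k]) (use k b in \<open>simp_all add: base_def\<close>)
  qed
qed

lemma ckr_com_correct:
  assumes t: "\<And>i. 0 \<le> t i \<and> t i < 1" and ex: "\<not> failing (t n) k0"
  shows "\<exists>s' k. big t ckr_com (start inp) s' \<and> bnd s' = length inp \<and> (\<forall>j<k. failing (t n) j) \<and>
    (\<forall>v<n. \<exists>j. lo s' v = real j \<and> labelled (scale k) (radius (t n) k) (tape_perm n t) n v j) \<and>
    tm s' \<le> 200 + 100 * n + (\<Sum>j\<le>k. cost (tape_perm n t) j)"
proof -
  let ?\<pi> = "tape_perm n t"
  define P :: "state \<Rightarrow> bool" where "P s' \<longleftrightarrow> (\<exists>k. bnd s' = length inp \<and> (\<forall>j<k. failing (t n) j) \<and>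
    (\<forall>v<n. \<exists>j. lo s' v = real j \<and> labelled (scale k) (radius (t n) k) ?\<pi> n v j) \<and>
    tm s' \<le> 200 + 100 * n + (\<Sum>j\<le>k. cost ?\<pi> j))" for s'
  have copy: "wp t (For rv (V rn) (StoreL (V rv) (Arr aLab (V rv)))) P s"
    if b: "base s" and k: "\<forall>j<k. failing (t n) j"
      "\<forall>v<n. \<exists>j. ar s aLab v = real j \<and> labelled (scale k) (radius (t n) k) ?\<pi> n v j"
      "tm s \<le> 150 + 60 * n + (\<Sum>j\<le>k. cost ?\<pi> j)" for s k
  proof -
    define I :: "nat \<Rightarrow> state \<Rightarrow> bool" where "I i s' \<longleftrightarrow> bnd s' = length inp \<and> vr s' rn = real n \<and> vr s' rv = real i \<and>
      ar s' aLab = ar s aLab \<and> (\<forall>v<i. lo s' v = ar s aLab v) \<and> tm s' \<le> tm s + 3 + 40 * i" for i s'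
    show ?thesis
    proof (rule wp_For[where Inv = I and m = n], goal_cases)
      case 1
      show ?case using b by (simp add: I_def base_def)
    next
      case (2 i s')
      then show ?case by (simp add: I_def)
    next
      case (3 i s')
      have "i < bnd s'"
        using 3 by (simp add: I_def length_inp ptr_def)
      then show ?case
        using 3 by (simp add: wp_iffs I_def less_Suc_eq)
    next
      case (4 s')
      then show ?case
        using k unfolding P_def by (intro exI[of _ k]) (simp add: I_def)
    qed
  qed
  have len: "0 < length inp" "1 < length inp"
    by (simp_all add: length_inp ptr_def)
  have start: "lo (start inp) 0 = \<Delta>" "lo (start inp) 1 = real n" "bnd (start inp) = length inp"
    "dr (start inp) = 0" "tm (start inp) = 0"
    using len inp_0 inp_1 by (simp_all add: start_def One_nat_def)
  have main: "wp t (shuffle_com ;; Sample rU ;;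
     Assign rN ((V rn \<oplus> Num 1) \<otimes> (V rn \<oplus> Num 1) \<otimes> (V rn \<oplus> Num 1)) ;;
     Assign rok (Num 0) ;; While (V rok) (Num 0) attempt_com ;;
     For rv (V rn) (StoreL (V rv) (Arr aLab (V rv)))) P s"
    if b: "base s" and "dr s = 0" "tm s \<le> 20" for s
    unfolding wp_Seq_iff
  proof (rule wp_shuffle[OF b \<open>dr s = 0\<close> t], goal_cases)
    case (1 s1)
    have n: "vr s1 0 = real n"
      using base_vr(1)[OF 1(1)] .
    have p: "(real n + 1) * (real n + 1) * (real n + 1) = prec 0"
      by (simp add: prec_def numeral_eq_Suc)
    have retry: "wp t (While (V rok) (Num 0) attempt_com)
        (wp t (For rv (V rn) (StoreL (V rv) (Arr aLab (V rv)))) P) s2"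
      if s2: "vr s2 = (vr s1)(2 := t n, 3 := prec 0, 16 := 0)" "ar s2 = ar s1" "lo s2 = lo s1" "bnd s2 = bnd s1"
        "tm s2 \<le> tm s1 + 50" for s2
    proof (rule wp_retry[where U = "t n" and \<pi> = ?\<pi> and ?k0.0 = k0], goal_cases)
      case 1
      show ?case using \<open>base s1\<close> s2 by (simp add: base_def)
    next
      case 7
      show ?case by (rule tape_perm_in)
    next
      case 9
      show ?case by (rule ex)
    next
      case (10 s' k)
      show ?case
        by (rule copy[of s' k]) (use 10 1(4) s2(5) \<open>tm s \<le> 20\<close> in simp_all)
    qed (use s2 t[of n] 1 in \<open>simp_all add: less_imp_le\<close>)
    show ?case
      using n p 1(2) by (simp add: wp_iffs) (rule retry, simp_all)
  qed
  have "wp t ckr_com P (start inp)"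
    unfolding ckr_com_def
  proof (subst wp_Seq_iff, subst wp_Assign_iff, intro conjI, goal_cases)
    case 1
    show ?case using len start by simp
  next
    case 2
    show ?case
      using len start
      by (subst wp_Seq_iff, subst wp_Assign_iff, simp, intro main) (simp_all add: base_def start_def One_nat_def)
  qed
  then show ?thesis
    unfolding wp_def P_def by blast
qed

end

section \<open>From labels to the CKR partition\<close>

text \<open>A point covered by an earlier ball lies in the cluster of the least index whose ball
  covers it, which resolves the recursive set difference.\<close>

lemma ckr_cluster_iff:
  "y \<in> ckr_cluster X \<rho> R xs i \<longleftrightarrow>
     y \<in> X \<and> \<rho> y (xs ! i) \<le> ereal R \<and> (\<forall>j<i. \<not> \<rho> y (xs ! j) \<le> ereal R)"
proof (induction i rule: less_induct)
  case (less i)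
  have "(\<exists>j<i. y \<in> ckr_cluster X \<rho> R xs j) \<longleftrightarrow> y \<in> X \<and> (\<exists>j<i. \<rho> y (xs ! j) \<le> ereal R)" (is "?l \<longleftrightarrow> ?r")
  proof
    assume ?r
    then have ex: "\<exists>j. j < i \<and> \<rho> y (xs ! j) \<le> ereal R" by blast
    define j where "j = (LEAST j. j < i \<and> \<rho> y (xs ! j) \<le> ereal R)"
    have j: "j < i" "\<rho> y (xs ! j) \<le> ereal R"
      using LeastI_ex[OF ex] by (simp_all add: j_def)
    have "\<not> \<rho> y (xs ! j') \<le> ereal R" if "j' < j" for j'
      using not_less_Least[OF that[unfolded j_def]] that j(1) by simp
    then have "y \<in> ckr_cluster X \<rho> R xs j"
      using less.IH[OF j(1)] j \<open>?r\<close> by blast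
    then show ?l using j(1) by blast
  qed (use less.IH in blast)
  then show ?case
    by (subst ckr_cluster.simps) auto
qed

lemma decode_partition_eq_ckr_clusters:
  assumes "length xs = n"
    and l: "\<And>v. v < n \<Longrightarrow> \<exists>j<n. l v = real j \<and> \<rho> v (xs ! j) \<le> ereal R \<and> (\<forall>j'<j. \<not> \<rho> v (xs ! j') \<le> ereal R)"
  shows "decode_partition n l = ckr_clusters {..<n} \<rho> R xs"
proof -
  obtain f where f: "\<And>v. v < n \<Longrightarrow> f v < n" "\<And>v. v < n \<Longrightarrow> l v = real (f v)"
    "\<And>v. v < n \<Longrightarrow> \<rho> v (xs ! f v) \<le> ereal R" "\<And>v j'. v < n \<Longrightarrow> j' < f v \<Longrightarrow> \<not> \<rho> v (xs ! j') \<le> ereal R"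
    using l by metis
  have mem: "v \<in> ckr_cluster {..<n} \<rho> R xs i \<longleftrightarrow> v < n \<and> f v = i" for v i
  proof
    assume "v \<in> ckr_cluster {..<n} \<rho> R xs i"
    then have v: "v < n" "\<rho> v (xs ! i) \<le> ereal R" "\<forall>j<i. \<not> \<rho> v (xs ! j) \<le> ereal R"
      by (auto simp: ckr_cluster_iff)
    have "\<not> f v < i" using v f(3) by blast
    moreover have "\<not> i < f v" using v f(4) by blast
    ultimately show "v < n \<and> f v = i" using v by simp
  qed (use f in \<open>auto simp: ckr_cluster_iff\<close>)
  have cl: "ckr_cluster {..<n} \<rho> R xs i = {u \<in> {..<n}. f u = i}" for i
    using mem by auto
  have "decode_partition n l = (\<lambda>v. {u \<in> {..<n}. f u = f v}) ` {..<n}"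
    unfolding decode_partition_def using f(2) by (intro image_cong) auto
  \<comment> \<open>Indices of centers that attract no vertex yield exactly the empty sets to be
    removed.\<close>
  also have "\<dots> = (\<lambda>i. {u \<in> {..<n}. f u = i}) ` {..<n} - {{}}"
    using f(1) by (auto simp: image_iff)
  finally show ?thesis
    using assms(1) by (simp add: ckr_clusters_def cl)
qed

lemma harm_le_ln: "0 < n \<Longrightarrow> harm n \<le> 1 + ln (real n)"
  using decseqD[OF decseq_harm_diff_ln, of 0 "n - 1"] by (simp add: harm_def One_nat_def)

context ckr_input
begin

abbreviation \<rho> where "\<rho> \<equiv> shortest_path_metric n E \<omega>"

text \<open>At this scale the true radius is exactly \<open>radius U k\<close>. An earlier center
  within the true radius would have a rounded walk of length at most \<open>radius U k + n\<close>,
  which \<open>labelled\<close> excludes.\<close>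

lemma labelled_metric:
  assumes \<pi>: "\<pi> \<in> permutations_of_set {..<n}" and v: "v < n"
    and lab: "labelled (scale k) (radius U k) \<pi> n v j"
  shows "j < n" "\<rho> v (\<pi> ! j) \<le> ereal (\<Delta> / 4 * (1 + U))" "\<forall>j'<j. \<not> \<rho> v (\<pi> ! j') \<le> ereal (\<Delta> / 4 * (1 + U))"
proof -
  have s: "0 < scale k"
    using prec_pos \<Delta> by (simp add: scale_def)
  have eq: "scale k * (\<Delta> / 4 * (1 + U)) = radius U k"
    using \<Delta> by (simp add: scale_def radius_def)
  show j: "j < n" using lab by (simp add: labelled_def)
  obtain d where d: "iwalk adj (scale k) (\<pi> ! j) v d" "real d \<le> radius U k"
    using lab by (auto simp: labelled_def)
  have "\<rho> v (\<pi> ! j) \<le> ereal (real d / scale k)"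
    by (rule iwalk_imp_metric_le[OF G s d(1)])
  also have "\<dots> \<le> ereal (\<Delta> / 4 * (1 + U))"
    using d(2) s by (simp add: eq[symmetric] field_simps)
  finally show "\<rho> v (\<pi> ! j) \<le> ereal (\<Delta> / 4 * (1 + U))" .
  show "\<forall>j'<j. \<not> \<rho> v (\<pi> ! j') \<le> ereal (\<Delta> / 4 * (1 + U))"
  proof (intro allI impI notI)
    fix j' assume j': "j' < j" "\<rho> v (\<pi> ! j') \<le> ereal (\<Delta> / 4 * (1 + U))"
    have "\<pi> ! j' \<in> set \<pi>"
      using j' j length_finite_permutations_of_set[OF \<pi>] by simp
    then have "\<pi> ! j' < n"
      using permutations_of_setD[OF \<pi>] by simp
    from metric_le_imp_iwalk[OF G s this j'(2)] obtain d where
      "iwalk adj (scale k) (\<pi> ! j') v d" "real d \<le> radius U k + real n"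
      unfolding eq by blast
    then show False
      using lab j'(1) unfolding labelled_def by fastforce
  qed
qed

text \<open>Solving S < d <= S + n for U gives one interval per pair of vertices. A Borel superset
  of the failures suffices, so the unspecified value of \<open>LEAST\<close> for unreachable pairs
  does no harm.\<close>

definition fail_set :: "nat \<Rightarrow> real set" where
  "fail_set k = (\<Union>p\<in>{..<n} \<times> {..<n}. let d = real (LEAST d. iwalk adj (scale k) (fst p) (snd p) d) in
     {(d - real n) / prec (Suc k) - 1 ..< d / prec (Suc k) - 1})"

lemma fail_set_borel [measurable]: "fail_set k \<in> sets borel"
  unfolding fail_set_def Let_def by (intro sets.finite_UN) auto

lemma failing_imp_fail_set:
  assumes "failing U k"
  shows "U \<in> fail_set k"
proof -
  obtain u v d where d: "u < n" "v < n" "iwalk adj (scale k) u v d"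
    "\<forall>d'. iwalk adj (scale k) u v d' \<longrightarrow> d \<le> d'" "radius U k < real d" "real d \<le> radius U k + real n"
    using assms unfolding bad_def by blast
  have "(LEAST d. iwalk adj (scale k) u v d) = d"
    using d by (intro Least_equality) auto
  moreover have "(real d - real n) / prec (Suc k) - 1 \<le> U" "U < real d / prec (Suc k) - 1"
    using d(5,6) prec_pos[of "Suc k"] by (simp_all add: radius_def field_simps)
  ultimately show ?thesis
    unfolding fail_set_def Let_def using d(1,2) by (intro UN_I[of "(u, v)"]) auto
qed

text \<open>A union bound over n^2 intervals of length n / \<open>prec (Suc k)\<close>; the factor
  (n + 1)^3 in \<open>prec\<close> cancels the n^3.\<close>

lemma emeasure_fail_set: "emeasure unit (fail_set k) \<le> ennreal ((1 / 2) ^ k)"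
proof -
  let ?A = "\<lambda>p. let d = real (LEAST d. iwalk adj (scale k) (fst p) (snd p) d) in
     {(d - real n) / prec (Suc k) - 1 ..< d / prec (Suc k) - 1}"
  have "emeasure unit (fail_set k) \<le> emeasure lborel (fail_set k)"
    by (subst emeasure_unit) (auto intro!: emeasure_mono)
  also have "\<dots> \<le> (\<Sum>p\<in>{..<n} \<times> {..<n}. emeasure lborel (?A p))"
    unfolding fail_set_def by (intro emeasure_subadditive_finite) (auto simp: Let_def)
  also have "\<dots> = (\<Sum>p\<in>{..<n} \<times> {..<n}. ennreal (real n / prec (Suc k)))"
  proof (intro sum.cong refl)
    fix p
    have "(d - real n) / prec (Suc k) - 1 \<le> d / prec (Suc k) - 1" for d
      using prec_pos[of "Suc k"] by (simp add: divide_right_mono)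
    then show "emeasure lborel (?A p) = ennreal (real n / prec (Suc k))"
      by (simp add: Let_def diff_divide_distrib)
  qed
  also have "\<dots> = ennreal (real (n * n) * (real n / prec (Suc k)))"
    using prec_pos[of "Suc k"]
    by (simp add: ennreal_mult'[symmetric] ennreal_of_nat_eq_real_of_nat)
  also have "\<dots> \<le> ennreal ((1 / 2) ^ k)"
  proof (rule ennreal_leI)
    have "real (n * n) * real n \<le> (real n + 1) ^ 3"
      by (simp add: power3_eq_cube mult_mono)
    then have "real (n * n) * real n * (1 / 2) ^ Suc k \<le> (real n + 1) ^ 3 * (1 / 2) ^ k"
      by (intro mult_mono) auto
    then show "real (n * n) * (real n / prec (Suc k)) \<le> (1 / 2) ^ k"
      using prec_pos[of "Suc k"] by (simp add: prec_def field_simps power_one_over)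
  qed
  finally show ?thesis .
qed

text \<open>If all trials fail, the radius lies in sets of arbitrarily small measure.\<close>

lemma AE_eventually_certain: "AE t in random_tape. \<exists>k. \<not> failing (t n) k"
proof -
  have "emeasure unit (\<Inter>k. fail_set k) \<le> ennreal ((1 / 2) ^ k)" for k
    using emeasure_fail_set[of k] emeasure_mono[of "\<Inter>k. fail_set k" "fail_set k" unit]
    by (force intro: order_trans)
  moreover have "(\<lambda>k. ennreal ((1 / 2) ^ k)) \<longlonglongrightarrow> ennreal 0"
    by (intro tendsto_ennrealI LIMSEQ_power_zero) auto
  ultimately have "emeasure unit (\<Inter>k. fail_set k) \<le> ennreal 0"
    by (intro LIMSEQ_le_const) auto
  then have "AE x in unit. x \<notin> (\<Inter>k. fail_set k)"
    by (intro AE_not_in) (auto simp: null_sets_def)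
  then have "AE x in unit. \<exists>k. \<not> failing x k"
    using failing_imp_fail_set by (auto elim!: eventually_mono)
  then show ?thesis
    unfolding random_tape_def
    by (rule tape.AE_component[rotated]) auto
qed

definition program :: "instr list" where
  "program = assemble ckr_com"

lemma program_run:
  assumes t: "\<And>i. 0 \<le> t i \<and> t i < 1" and ex: "\<exists>k. \<not> failing (t n) k"
  shows "map_option (decode_partition n) (final_memory program inp t) =
      Some (ckr_clusters {..<n} \<rho> (\<Delta> / 4 * (1 + t n)) (tape_perm n t))"
    and "\<exists>k. (\<forall>j<k. failing (t n) j) \<and>
      running_time program inp t \<le> of_nat (205 + 100 * n + (\<Sum>j\<le>k. cost (tape_perm n t) j))"
proof -
  obtain k0 where k0: "\<not> failing (t n) k0" using ex by blast
  let ?\<pi> = "tape_perm n t"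
  from ckr_com_correct[of t, OF t k0] obtain s' k where s': "big t ckr_com (start inp) s'" "bnd s' = length inp"
    "\<forall>j<k. failing (t n) j" "\<forall>v<n. \<exists>j. lo s' v = real j \<and> labelled (scale k) (radius (t n) k) ?\<pi> n v j"
    "tm s' \<le> 200 + 100 * n + (\<Sum>j\<le>k. cost ?\<pi> j)" by blast
  have len: "n + 2 < length inp"
    by (simp add: length_inp ptr_def)
  have i: "1 < length inp" "inp ! 1 = real n" "inp ! (n + 2) = real (length inp)"
    using len inp_1 inp_ptr[of n] by (simp_all add: length_inp One_nat_def)
  note a = assemble_correct[OF s'(1) i(1,2) len i(3), folded program_def]
  obtain l where l: "final_memory program inp t = Some l" "\<forall>a<bnd s'. l a = lo s' a"
    using a(2) by blast
  have "decode_partition n l = ckr_clusters {..<n} \<rho> (\<Delta> / 4 * (1 + t n)) ?\<pi>"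
  proof (rule decode_partition_eq_ckr_clusters)
    show "length ?\<pi> = n"
      using length_finite_permutations_of_set[OF tape_perm_in] by simp
    fix v assume v: "v < n"
    then obtain j where j: "lo s' v = real j" "labelled (scale k) (radius (t n) k) ?\<pi> n v j"
      using s'(4) by blast
    have "l v = real j"
      using l(2) j(1) v len s'(2) by simp
    then show "\<exists>j<n. l v = real j \<and> \<rho> v (?\<pi> ! j) \<le> ereal (\<Delta> / 4 * (1 + t n)) \<and>
        (\<forall>j'<j. \<not> \<rho> v (?\<pi> ! j') \<le> ereal (\<Delta> / 4 * (1 + t n)))"
      using labelled_metric[OF tape_perm_in v j(2)] by blast
  qed
  then show "map_option (decode_partition n) (final_memory program inp t) =
      Some (ckr_clusters {..<n} \<rho> (\<Delta> / 4 * (1 + t n)) ?\<pi>)"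
    by (simp add: l(1))
  have "running_time program inp t \<le> of_nat (5 + tm s')"
    by (rule a(1))
  also have "\<dots> \<le> of_nat (205 + 100 * n + (\<Sum>j\<le>k. cost ?\<pi> j))"
    using s'(5) by (intro of_nat_mono) simp
  finally show "\<exists>k. (\<forall>j<k. failing (t n) j) \<and>
      running_time program inp t \<le> of_nat (205 + 100 * n + (\<Sum>j\<le>k. cost (tape_perm n t) j))"
    using s'(3) by blast
qed

end

section \<open>Expected running time\<close>

context ckr_input
begin

text \<open>Almost surely the output is the partition belonging to the drawn permutation and radius
  themselves, so the laws agree without any conditioning on success.\<close>

lemma program_samples:
  "samples program inp (decode_partition n) (ckr_partition \<Delta> {..<n} \<rho>)"
proof -
  let ?g = "\<lambda>t. ckr_clusters {..<n} \<rho> (\<Delta> / 4 * (1 + t n)) (tape_perm n t)"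
  let ?f = "\<lambda>t. map_option (decode_partition n) (final_memory program inp t)"
  have "(\<lambda>t. (tape_perm n t, \<Delta> / 4 * (1 + t n))) \<in>
      random_tape \<rightarrow>\<^sub>M count_space (permutations_of_set {..<n}) \<Otimes>\<^sub>M borel"
    by measurable
  from measurable_compose[OF this measurable_ckr_clusters[of "{..<n}" \<rho>]]
  have g: "?g \<in> random_tape \<rightarrow>\<^sub>M count_space UNIV"
    by simp
  have "AE t in random_tape. ?f t = Some (?g t)"
    using AE_tape AE_eventually_certain
    by eventually_elim (rule program_run(1), auto)
  moreover have Sg: "(\<lambda>t. Some (?g t)) \<in> random_tape \<rightarrow>\<^sub>M count_space UNIV"
    by (rule measurable_compose[OF g]) simp
  ultimately have "distr random_tape (count_space UNIV) ?f =
      distr random_tape (count_space UNIV) (\<lambda>t. Some (?g t))"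
    using measurable_final_memory by (intro distr_cong_AE) auto
  also have "\<dots> = distr (ckr_partition \<Delta> {..<n} \<rho>) (count_space UNIV) Some"
    using g by (simp add: ckr_partition_tape[OF \<Delta>] distr_distr comp_def)
  finally show ?thesis
    unfolding samples_def using measurable_final_memory by blast
qed

lemma sum_deg_le: "(\<Sum>v<n. deg v) \<le> 2 * card E"
proof -
  have sub: "E \<subseteq> Pow {..<n}"
    using G(1) by (auto simp: weighted_graph_def)
  have finE: "finite E"
    by (rule finite_subset[OF sub]) simp
  have d: "deg v = card {u. {u, v} \<in> E}" if "v < n" for v
  proof -
    have "deg v = card (set (adj ! v))"
      using G(2) that by (intro distinct_card[symmetric]) (simp add: adjacency_lists_def)
    also have "set (adj ! v) = (\<lambda>u. (u, \<omega> {u, v})) ` {u. {u, v} \<in> E}"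
      using G(2) that by (auto simp: adjacency_lists_def)
    also have "card \<dots> = card {u. {u, v} \<in> E}"
      by (intro card_image inj_onI) simp
    finally show ?thesis .
  qed
  have fin: "finite {u. {u, v} \<in> E}" for v
    by (rule finite_subset[of _ "{..<n}"]) (use sub in auto)
  have "(\<Sum>v<n. deg v) = (\<Sum>v<n. card {u. {u, v} \<in> E})"
    using d by simp
  also have "\<dots> = card (SIGMA v:{..<n}. {u. {u, v} \<in> E})"
    using fin by (subst card_SigmaI) auto
  also have "\<dots> \<le> card (\<Union>e\<in>E. {(v, u). {u, v} = e})"
  proof (rule card_mono)
    have "(\<Union>e\<in>E. {(v, u). {u, v} = e}) \<subseteq> {..<n} \<times> {..<n}"
      using sub by auto
    then show "finite (\<Union>e\<in>E. {(v, u). {u, v} = e})"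
      by (rule finite_subset) simp
  qed auto
  also have "\<dots> \<le> (\<Sum>e\<in>E. card {(v, u). {u, v} = e})"
    using finE by (rule card_UN_le)
  also have "\<dots> \<le> (\<Sum>e\<in>E. 2)"
  proof (rule sum_mono)
    fix e assume "e \<in> E"
    then have "card e = 2"
      using G(1) by (auto simp: weighted_graph_def)
    then obtain a b where e: "e = {a, b}" "a \<noteq> b"
      by (auto simp: card_2_iff)
    have "{(v, u). {u, v} = e} \<subseteq> {(a, b), (b, a)}"
    proof (rule subsetI)
      fix p assume "p \<in> {(v, u). {u, v} = e}"
      then have "{snd p, fst p} = {a, b}"
        by (simp add: e(1) case_prod_beta)
      then have "snd p = a \<and> fst p = b \<or> snd p = b \<and> fst p = a"
        by (simp only: doubleton_eq_iff)
      then show "p \<in> {(a, b), (b, a)}"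
        by (cases p) (elim disjE conjE, simp_all)
    qed
    then have le: "card {(v, u). {u, v} = e} \<le> card {(a, b), (b, a)}"
      by (intro card_mono) simp_all
    have "card {(a, b), (b, a)} \<le> 2"
      using card_length[of "[(a, b), (b, a)]"] by simp
    with le show "card {(v, u). {u, v} = e} \<le> 2"
      by (rule le_trans)
  qed
  finally show ?thesis by simp
qed

section \<open>Mean cost of a single trial\<close>

definition workload :: real where
  "workload = real (card E) * ln (real n) + real n * (ln (real n))\<^sup>2"

lemma ln_ge_half: "2 \<le> n \<Longrightarrow> 1 / 2 \<le> ln (real n)"
  using ln2_ge_two_thirds ln_mono[of 2 "real n"] by linarith

lemma lg_le: "2 \<le> n \<Longrightarrow> real (5 + 4 * lg) \<le> 34 * ln (real n)"
proof -
  assume n: "2 \<le> n"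
  define l where "l = ln (real n)"
  have l: "1 / 2 \<le> l"
    using ln_ge_half[OF n] by (simp add: l_def)
  have "real lg \<le> 1 + 4 * l"
  proof (cases lg)
    case (Suc m)
    then have "\<not> n + 1 \<le> 2 ^ m"
      using not_less_Least[of m "\<lambda>l. n + 1 \<le> 2 ^ l"] by (simp add: lg_def)
    then have "2 ^ m \<le> n" by simp
    then have "(2::real) ^ m \<le> real n"
      by (metis of_nat_le_iff of_nat_numeral of_nat_power)
    then have "ln ((2::real) ^ m) \<le> l"
      unfolding l_def using n by (subst ln_le_cancel_iff) auto
    then have "real m * ln 2 \<le> l"
      by (simp add: ln_realpow)
    moreover have "real m * (1 / 2) \<le> real m * ln 2"
      using ln2_ge_two_thirds by (intro mult_left_mono) auto
    ultimately have "real m \<le> 2 * l" by linarith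
    then show ?thesis using Suc l by simp
  qed (use l in simp)
  then have "real (5 + 4 * lg) \<le> 9 + 16 * l" by simp
  also have "\<dots> \<le> 34 * l" using l by simp
  finally show ?thesis by (simp add: l_def)
qed

text \<open>For n >= 2 the logarithm is at least 1/2, so every lower-order term is absorbed at the
  price of a constant.\<close>

lemma workload_bounds:
  assumes n: "2 \<le> n"
  shows "1 \<le> 2 * workload" "real n \<le> 4 * workload" "real n * ln (real n) \<le> 2 * workload"
    "ln (real n) \<le> workload" "real n * (ln (real n))\<^sup>2 \<le> workload" "real (card E) * ln (real n) \<le> workload"
    "0 \<le> workload"
proof -
  define l where "l = ln (real n)"
  have l: "1 / 2 \<le> l"
    using ln_ge_half[OF n] by (simp add: l_def)
  have n': "2 \<le> real n" using n by simp
  have m: "0 \<le> real (card E) * l" using l by simp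
  have w: "workload = real (card E) * l + real n * l\<^sup>2"
    by (simp add: workload_def l_def)
  have l2: "l \<le> 2 * l\<^sup>2"
    using mult_right_mono[OF l, of l] l by (simp add: power2_eq_square)
  have 1: "real n * l \<le> 2 * (real n * l\<^sup>2)"
    using mult_left_mono[OF l2, of "real n"] by simp
  have 2: "real n \<le> 2 * (real n * l)"
    using mult_left_mono[OF l, of "real n"] by simp
  have 3: "2 * l\<^sup>2 \<le> real n * l\<^sup>2"
    using n' by (intro mult_right_mono) auto
  show "real n * (ln (real n))\<^sup>2 \<le> workload" "real (card E) * ln (real n) \<le> workload" "0 \<le> workload"
    unfolding w l_def[symmetric] using m by simp_all
  show "real n * ln (real n) \<le> 2 * workload"
    unfolding w l_def[symmetric] by (rule order_trans[OF 1]) (use m in simp)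
  show "real n \<le> 4 * workload"
    unfolding w l_def[symmetric]
    by (rule order_trans[OF 2], rule order_trans[OF mult_left_mono[OF 1, of 2]]) (use m in simp_all)
  then show "1 \<le> 2 * workload"
    using n' by linarith
  show "ln (real n) \<le> workload"
    unfolding w l_def[symmetric] using m 3 l2 by linarith
qed

text \<open>Averaged over permutations, visits cost about J * n * H_n and relaxations m * H_n, while
  preprocessing costs J * m plus smaller terms. With J at most k + 1 times O(log n), the total is k
  + 1 times the workload.\<close>

lemma average_cost:
  assumes n: "2 \<le> n"
  shows "(\<Sum>\<pi>\<in>permutations_of_set {..<n}. real (cost \<pi> k)) / fact n \<le> 60000 * real (Suc k) * workload"
proof -
  let ?P = "permutations_of_set {..<n}"
  define l where "l = ln (real n)"
  define m where "m = real (card E)"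
  define j where "j = real (Suc k)"
  define L where "L = real (5 + 4 * lg)"
  define J where "J = k + 4 + 4 * lg"
  define S where "S = real (Suc J)"
  define c where "c v = 350 * S + 200 * real (deg v)" for v
  define D where "D = 320 + 100 * S + 100 * real (Suc n) +
    (\<Sum>v<n. 50 + 220 * S * real (deg v)) + 150 * real n"
  have l: "1 / 2 \<le> l"
    using ln_ge_half[OF n] by (simp add: l_def)
  have j: "1 \<le> j" by (simp add: j_def)
  have "S = j + L - 1"
    by (simp add: S_def J_def j_def L_def)
  \<comment> \<open>Separates the number of the trial from the size of the graph: j + L - 1 is at
    most j * L.\<close>
  moreover have "0 \<le> (j - 1) * (L - 1)"
    by (intro mult_nonneg_nonneg) (simp_all add: j_def L_def)
  ultimately have SJ: "S \<le> j * L" "0 \<le> S"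
    by (simp_all add: left_diff_distrib right_diff_distrib) (simp add: j_def L_def)
  have Ll: "L \<le> 34 * l" "0 \<le> L"
    using lg_le[OF n] by (simp_all add: L_def l_def)
  have dg: "(\<Sum>v<n. real (deg v)) \<le> 2 * m"
    using of_nat_mono[OF sum_deg_le, where ?'a = real] by (simp add: m_def)
  have H: "harm n \<le> 3 * l" "0 \<le> (harm n :: real)"
    using harm_le_ln[of n] n l by (simp_all add: l_def harm_nonneg)
  have cost: "real (cost \<pi> k) = D + (\<Sum>i<n. \<Sum>v\<in>records (scale k) \<pi> i. c v)" for \<pi>
  proof -
    define X where "X i = (\<Sum>v\<in>records (scale k) \<pi> i. c v)" for i
    define Y where "Y = (\<Sum>v<n. 50 + 220 * S * real (deg v))"
    have "real (cost \<pi> k) = 300 + 100 * S + 100 * real (Suc n) + Y + (\<Sum>i<n. 150 + X i) + 20"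
      by (simp only: cost_def attempt_cost_def J_def[symmetric] S_def c_def X_def Y_def of_nat_add of_nat_sum
          of_nat_mult of_nat_numeral)
    also have "(\<Sum>i<n. 150 + X i) = 150 * real n + (\<Sum>i<n. X i)"
      by (simp add: sum.distrib)
    finally show ?thesis
      unfolding D_def X_def[symmetric] Y_def[symmetric] by simp
  qed
  have "(\<Sum>\<pi>\<in>?P. \<Sum>i<n. \<Sum>v\<in>records (scale k) \<pi> i. c v) \<le> fact n * ((\<Sum>v<n. c v) * harm n)"
    unfolding records_def
    by (rule sum_prefix_minima_le[where W = "iwalk adj (scale k)"]) (simp add: c_def S_def)
  then have "(\<Sum>\<pi>\<in>?P. real (cost \<pi> k)) \<le> fact n * (D + (\<Sum>v<n. c v) * harm n)"
    by (simp add: cost sum.distrib distrib_left mult.commute)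
  then have "(\<Sum>\<pi>\<in>?P. real (cost \<pi> k)) / fact n \<le> D + (\<Sum>v<n. c v) * harm n"
    by (simp add: field_simps)
  also have "\<dots> \<le> 60000 * j * workload"
  proof -
    define w where "w = j * workload"
    have m0: "0 \<le> m" and n0: "0 \<le> real n" by (simp_all add: m_def)
    note W = workload_bounds[OF n, folded l_def m_def]
    have up: "x \<le> a * w" if "x \<le> a * workload" "0 \<le> a" for x a
    proof -
      have "workload \<le> w"
        unfolding w_def using mult_right_mono[OF j W(7)] by simp
      then show ?thesis
        using that mult_left_mono[of workload w a] by linarith
    qed
    have jL: "S \<le> 34 * (j * l)"
      using SJ(1) mult_left_mono[OF Ll(1), of j] j by linarith
    have jl: "j * l \<le> w" "j * (m * l) \<le> w" "j * (real n * l\<^sup>2) \<le> w"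
      unfolding w_def using mult_left_mono[OF W(4), of j] mult_left_mono[OF W(5), of j]
        mult_left_mono[OF W(6), of j] j by simp_all
    have ml: "m * l \<le> w"
      using up[of "m * l" 1] W(6) by simp
    have SJm: "S * (2 * m) \<le> 68 * w"
    proof -
      have "S * (2 * m) \<le> 34 * (j * l) * (2 * m)"
        using jL m0 by (intro mult_right_mono) auto
      also have "\<dots> = 68 * (j * (m * l))" by simp
      finally show ?thesis using jl(2) by linarith
    qed
    have "(\<Sum>v<n. 50 + 220 * S * real (deg v)) = 50 * real n + 220 * (S * (\<Sum>v<n. real (deg v)))"
      by (simp add: sum.distrib sum_distrib_left mult.assoc)
    also have "\<dots> \<le> 50 * real n + 220 * (S * (2 * m))"
      using dg SJ(2) by (intro add_left_mono mult_left_mono) auto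
    finally have s1: "(\<Sum>v<n. 50 + 220 * S * real (deg v)) \<le> 50 * real n + 220 * (68 * w)"
      using SJm by linarith
    have nw: "real n \<le> 4 * w" "1 \<le> 2 * w"
      using up[OF W(2)] up[OF W(1)] by simp_all
    have "100 * S \<le> 3400 * w"
      using jL jl(1) by linarith
    then have "D \<le> 320 + 3400 * w + 100 * (real n + 1) + (50 * real n + 220 * (68 * w)) + 150 * real n"
      unfolding D_def of_nat_Suc using s1 by (intro add_mono) auto
    moreover have "a \<le> 21000 * b" if "a \<le> 320 + 3400 * b + 100 * (x + 1) + (50 * x + 220 * (68 * b)) + 150 * x"
      "x \<le> 4 * b" "1 \<le> 2 * b" for a b x :: real
      using that by simp
    ultimately have Dw: "D \<le> 21000 * w"
      using nw by blast
    have "(\<Sum>v<n. c v) = 350 * (S * real n) + 200 * (\<Sum>v<n. real (deg v))"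
      by (simp add: c_def sum.distrib sum_distrib_left)
    also have "\<dots> \<le> 350 * (34 * (j * l) * real n) + 200 * (2 * m)"
      using jL dg by (intro add_mono mult_left_mono mult_right_mono) auto
    finally have "(\<Sum>v<n. c v) * harm n \<le> (350 * (34 * (j * l) * real n) + 200 * (2 * m)) * (3 * l)"
      by (rule mult_mono[OF _ H(1) _ H(2)]) (use l j m0 in simp)
    also have "\<dots> = 35700 * (j * (real n * l\<^sup>2)) + 1200 * (m * l)"
      by (simp add: algebra_simps power2_eq_square)
    also have "\<dots> \<le> 35700 * w + 1200 * w"
      using jl(3) ml by (intro add_mono mult_left_mono) simp_all
    finally have "(\<Sum>v<n. c v) * harm n \<le> 36900 * w" by simp
    then have "D + (\<Sum>v<n. c v) * harm n \<le> 21000 * w + 36900 * w"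
      using Dw by (rule add_mono[rotated])
    also have "\<dots> \<le> 60000 * w"
      using j W(7) by (simp add: w_def)
    also have "60000 * w = 60000 * j * workload"
      by (simp only: w_def mult.assoc)
    finally show ?thesis .
  qed
  finally show ?thesis
    unfolding j_def .
qed

text \<open>Contains the event that trial \<open>k\<close> takes place. Only the failure just before
  it is used, as the bound on its probability already decays geometrically.\<close>

definition retry_set :: "nat \<Rightarrow> real set" where
  "retry_set k = (if k = 0 then UNIV else fail_set (k - 1))"

lemma retry_set_borel: "retry_set k \<in> sets borel"
  by (simp add: retry_set_def)

lemma emeasure_retry_set: "emeasure unit (retry_set k) \<le> ennreal (2 * (1 / 2) ^ k)"
proof (cases k)
  case 0
  have "emeasure unit UNIV \<le> ennreal 1"
    using prob_space.emeasure_le_1[OF prob_space_unit, of UNIV] by simp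
  also have "\<dots> \<le> ennreal 2"
    by (rule ennreal_leI) simp
  finally show ?thesis
    using 0 by (simp add: retry_set_def)
next
  case (Suc m)
  then show ?thesis
    using emeasure_fail_set[of m] by (simp add: retry_set_def)
qed

lemma sums_arith_geometric: "(\<lambda>k. real (Suc k) * (1 / 2) ^ k) sums 4"
  using geometric_deriv_sums[of "1 / 2 :: real"] by (simp add: power2_eq_square)

lemma nn_integral_attempt:
  assumes n: "2 \<le> n"
  shows "(\<integral>\<^sup>+t. of_nat (cost (tape_perm n t) k) * indicator (retry_set k) (t n) \<partial>random_tape)
    \<le> ennreal (120000 * workload * (real (Suc k) * (1 / 2) ^ k))"
proof -
  let ?P = "permutations_of_set {..<n}"
  let ?c = "(\<Sum>\<pi>\<in>?P. real (cost \<pi> k)) / fact n"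
  have "(\<Sum>\<pi>\<in>?P. of_nat (cost \<pi> k)) * ennreal (1 / fact n) = ennreal ?c"
    by (simp add: ennreal_of_nat_eq_real_of_nat sum_ennreal sum_nonneg ennreal_mult'[symmetric])
  then have "(\<integral>\<^sup>+t. of_nat (cost (tape_perm n t) k) * indicator (retry_set k) (t n) \<partial>random_tape) =
      ennreal ?c * emeasure unit (retry_set k)"
    by (subst nn_integral_tape_perm[OF retry_set_borel]) simp
  also have "\<dots> \<le> ennreal (60000 * real (Suc k) * workload) * ennreal (2 * (1 / 2) ^ k)"
    by (intro mult_mono ennreal_leI average_cost[OF n] emeasure_retry_set) simp_all
  also have "\<dots> = ennreal (60000 * real (Suc k) * workload * (2 * (1 / 2) ^ k))"
    using workload_bounds(7)[OF n] by (intro ennreal_mult'[symmetric]) simp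
  also have "60000 * real (Suc k) * workload * (2 * (1 / 2) ^ k) = 120000 * workload * (real (Suc k) * (1 / 2) ^ k)"
    by (simp only: mult_ac)
  finally show ?thesis .
qed

text \<open>Trials that take place have indicator 1, so a sum of random length is dominated by a
  series whose terms can be integrated one by one.\<close>

lemma running_time_le:
  assumes t: "\<And>i. 0 \<le> t i \<and> t i < 1" and ex: "\<exists>k. \<not> failing (t n) k"
  shows "running_time program inp t \<le> of_nat (205 + 100 * n) +
    (\<Sum>k. of_nat (cost (tape_perm n t) k) * indicator (retry_set k) (t n))"
proof -
  obtain k where k: "\<forall>j<k. failing (t n) j"
    "running_time program inp t \<le> of_nat (205 + 100 * n + (\<Sum>j\<le>k. cost (tape_perm n t) j))"
    using program_run(2)[of t, OF t ex] by blast
  have "t n \<in> retry_set j" if "j \<le> k" for j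
    using k(1) failing_imp_fail_set[where U = "t n" and k = "j - 1"] that by (auto simp: retry_set_def One_nat_def)
  then have "(\<Sum>j\<le>k. of_nat (cost (tape_perm n t) j)) =
      (\<Sum>j\<le>k. of_nat (cost (tape_perm n t) j) * indicator (retry_set j) (t n) :: ennreal)"
    by (intro sum.cong) auto
  also have "\<dots> \<le> (\<Sum>k. of_nat (cost (tape_perm n t) k) * indicator (retry_set k) (t n))"
    by (intro sum_le_suminf summableI) auto
  finally have "of_nat (\<Sum>j\<le>k. cost (tape_perm n t) j) \<le>
      (\<Sum>k. of_nat (cost (tape_perm n t) k) * indicator (retry_set k) (t n) :: ennreal)"
    by simp
  then have "of_nat (205 + 100 * n) + of_nat (\<Sum>j\<le>k. cost (tape_perm n t) j) \<le>
      of_nat (205 + 100 * n) + (\<Sum>k. of_nat (cost (tape_perm n t) k) * indicator (retry_set k) (t n) :: ennreal)"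
    by (rule add_left_mono)
  with k(2) show ?thesis
    unfolding of_nat_add[of "205 + 100 * n"] by (rule order_trans)
qed

lemma measurable_attempt:
  "(\<lambda>t. of_nat (cost (tape_perm n t) k) * indicator (retry_set k) (t n) :: ennreal) \<in> borel_measurable random_tape"
proof -
  have [measurable]: "(\<lambda>t. of_nat (cost (tape_perm n t) k) :: ennreal) \<in> borel_measurable random_tape"
    by (rule measurable_compose[OF measurable_tape_perm]) simp
  note retry_set_borel[measurable]
  show ?thesis by measurable
qed

lemma program_expected_time:
  assumes n: "2 \<le> n"
  shows "expected_time_le program inp (500000 * workload)"
proof -
  let ?a = "\<lambda>k t. of_nat (cost (tape_perm n t) k) * indicator (retry_set k) (t n) :: ennreal"
  have "(\<integral>\<^sup>+t. running_time program inp t \<partial>random_tape) \<le>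
      (\<integral>\<^sup>+t. of_nat (205 + 100 * n) + (\<Sum>k. ?a k t) \<partial>random_tape)"
  proof (rule nn_integral_mono_AE)
    show "AE t in random_tape. running_time program inp t \<le> of_nat (205 + 100 * n) + (\<Sum>k. ?a k t)"
      using AE_tape AE_eventually_certain by eventually_elim (rule running_time_le, auto)
  qed
  also have "\<dots> = (\<integral>\<^sup>+t. of_nat (205 + 100 * n) \<partial>random_tape) + (\<integral>\<^sup>+t. (\<Sum>k. ?a k t) \<partial>random_tape)"
    using measurable_attempt by (intro nn_integral_add borel_measurable_suminf_order) auto
  also have "(\<integral>\<^sup>+t. of_nat (205 + 100 * n) \<partial>random_tape) = of_nat (205 + 100 * n)"
    using prob_space.emeasure_space_1[OF prob_space_random_tape] by simp
  also have "(\<integral>\<^sup>+t. (\<Sum>k. ?a k t) \<partial>random_tape) = (\<Sum>k. \<integral>\<^sup>+t. ?a k t \<partial>random_tape)"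
    using measurable_attempt by (intro nn_integral_suminf)
  also have "\<dots> \<le> (\<Sum>k. ennreal (120000 * workload * (real (Suc k) * (1 / 2) ^ k)))"
    by (intro suminf_le summableI nn_integral_attempt[OF n])
  also have "\<dots> = ennreal (120000 * workload * 4)"
    using sums_mult[OF sums_arith_geometric, of "120000 * workload"] workload_bounds(7)[OF n]
    by (intro sums_unique[symmetric] sums_ennreal[THEN iffD2]) auto
  also have "of_nat (205 + 100 * n) = ennreal (205 + 100 * real n)"
    by (subst ennreal_of_nat_eq_real_of_nat) simp
  also have "ennreal (205 + 100 * real n) + ennreal (120000 * workload * 4) =
      ennreal (205 + 100 * real n + 120000 * workload * 4)"
    using workload_bounds(7)[OF n] by (intro ennreal_plus[symmetric]) auto
  \<comment> \<open>The trials account for 480000; the rest absorbs 205 + 100 * n.\<close>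
  also have "\<dots> \<le> ennreal (500000 * workload)"
    using workload_bounds(1,2)[OF n] by (intro ennreal_leI) linarith
  finally show ?thesis
    unfolding expected_time_le_def using measurable_running_time by (simp add: add_left_mono)
qed

end

text \<open>One program and one constant serve all inputs. For n = 1 the stated time bound would be
  0, hence the restriction to n >= 2; the sampling claim covers every n.\<close>

theorem theorem1:
  shows "\<exists>(P :: instr list) (C :: real). \<forall>(\<Delta> :: real) (n :: nat) (E :: nat set set)
           (\<omega> :: nat set \<Rightarrow> real) (adj :: (nat \<times> real) list list).
     0 < \<Delta> \<longrightarrow> weighted_graph n E \<omega> \<longrightarrow> adjacency_lists n E \<omega> adj \<longrightarrow>
       samples P (encode_input \<Delta> adj) (decode_partition n)
         (ckr_partition \<Delta> {..<n} (shortest_path_metric n E \<omega>)) \<and>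
       (2 \<le> n \<longrightarrow>
         expected_time_le P (encode_input \<Delta> adj)
           (C * (real (card E) * ln (real n) + real n * (ln (real n))\<^sup>2)))"
proof (intro exI[of _ "assemble ckr_com"] exI[of _ 500000] allI impI)
  fix \<Delta> :: real and n E \<omega> and adj :: "(nat \<times> real) list list"
  assume "0 < \<Delta>" "weighted_graph n E \<omega>" "adjacency_lists n E \<omega> adj"
  then interpret ckr_input n E \<omega> adj \<Delta>
    by unfold_locales
  show "samples (assemble ckr_com) (encode_input \<Delta> adj) (decode_partition n)
         (ckr_partition \<Delta> {..<n} (shortest_path_metric n E \<omega>)) \<and>
       (2 \<le> n \<longrightarrow>
         expected_time_le (assemble ckr_com) (encode_input \<Delta> adj)
           (500000 * (real (card E) * ln (real n) + real n * (ln (real n))\<^sup>2)))"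
    using program_samples program_expected_time
    unfolding program_def inp_def workload_def by blast
qed

end
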